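(* Let $h$ be hyperbolic with respect to $\mathbf{e}\in\mathbb{R}^n$, let $r,m$ be positive integers and $\epsilon>0$, and let $\mathbf{v}_1,\dots,\mathbf{v}_m\in\Lambda_+(h,\mathbf{e})$ have rank at most $r$, satisfy $\mathbf{e}=\mathbf{v}_1+\cdots+\mathbf{v}_m$, and $\operatorname{tr}(\mathbf{v}_j)\leq\epsilon$ for each $1\leq j\leq m$. Then $$\lambda_{\max}(\mathbf{v}_1,\dots,\mathbf{v}_m)\leq\delta(\epsilon,m,r).$$
   Context: $h\in\mathbb{R}[x_1,\dots,x_n]$ homogeneous of degree $d$ is hyperbolic with respect to $\mathbf{e}$ if $h(\mathbf{e})\neq0$ and $t\mapsto h(t\mathbf{e}-\mathbf{x})$ has only real zeros for all $\mathbf{x}$; write $h(t\mathbf{e}-\mathbf{x})=h(\mathbf{e})\prod_{j=1}^d(t-\lambda_j(\mathbf{x}))$. $\Lambda_+(h,\mathbf{e})=\{\mathbf{x}:\min_j\lambda_j(\mathbf{x})\geq0\}$, $\operatorname{tr}(\mathbf{x})=\sum_j\lambda_j(\mathbf{x})$, $\operatorname{rk}(\mathbf{x})=\#\{j:\lambda_j(\mathbf{x})\neq0\}$. $D_{\mathbf{v}}h=\sum_kv_k\partial h/\partial x_k$. $\lambda_{\max}(\mathbf{v}_1,\dots,\mathbf{v}_m)$ is the largest zero of the mixed characteristic polynomial $t\mapsto(1-D_{\mathbf{v}_1})\cdots(1-D_{\mathbf{v}_m})h(t\mathbf{e})$. For a positive integer $r$, $U_r$ is the set of pairs $(\delta,\mu)$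 of positive reals such that $$\delta-1\geq\frac{\delta}{\mu}\cdot\frac{\left(1+\frac{\delta}{r\mu}\right)^{r-1}-\left(\frac{\delta}{r\mu}\right)^{r-1}}{\left(1+\frac{\delta}{r\mu}\right)^{r}-\left(\frac{\delta}{r\mu}\right)^{r}},$$ and either $\mu>1$, or ($1\leq\delta\leq2$ and $\mu>1-\delta/r$); and $\delta(\epsilon,m,r)=\inf\left\{\frac{\epsilon\mu+(1-\frac1m)\delta}{1-\frac1m+\frac{\mu}{m}}:(\delta,\mu)\in U_r\right\}$. *)

theory Defs
  imports "HOL-Analysis.Analysis" "HOL-Computational_Algebra.Computational_Algebra"
begin

text \<open>
  Polynomials in \<open>\<real>[x\<^sub>1, \<dots>, x\<^sub>n]\<close> are represented by the functions they induce on
  \<open>real ^ 'n\<close>; as \<open>\<real>\<close> is infinite, nothing is lost. A map \<open>\<alpha> :: 'n \<Rightarrow> nat\<close> is the multi-index of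
  the monomial \<open>\<Prod>i. x\<^sub>i ^ \<alpha> i\<close>.
\<close>

definition homogeneous_polynomial :: "nat \<Rightarrow> (real ^ 'n \<Rightarrow> real) \<Rightarrow> bool" where
  "homogeneous_polynomial d h \<longleftrightarrow>
     (\<exists>c :: ('n \<Rightarrow> nat) \<Rightarrow> real. \<forall>x.
        h x = (\<Sum>\<alpha> | sum \<alpha> UNIV = d. c \<alpha> * (\<Prod>i\<in>UNIV. (x $ i) ^ \<alpha> i)))"

text \<open>The univariate polynomial \<open>t \<mapsto> h(t e - x)\<close>.\<close>

definition hyp_char_poly :: "(real ^ 'n \<Rightarrow> real) \<Rightarrow> real ^ 'n \<Rightarrow> real ^ 'n \<Rightarrow> real poly" where
  "hyp_char_poly h e x = (THE p. \<forall>t. poly p t = h (t *\<^sub>R e - x))"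

definition hyperbolic :: "nat \<Rightarrow> (real ^ 'n \<Rightarrow> real) \<Rightarrow> real ^ 'n \<Rightarrow> bool" where
  "hyperbolic d h e \<longleftrightarrow>
     homogeneous_polynomial d h \<and> h e \<noteq> 0 \<and>
     (\<forall>x. \<forall>z :: complex. poly (map_poly of_real (hyp_char_poly h e x)) z = 0 \<longrightarrow> z \<in> \<real>)"

text \<open>
  The numbers \<open>\<lambda>\<^sub>1(x), \<dots>, \<lambda>\<^sub>d(x)\<close> in \<open>h(t e - x) = h(e) \<Prod>j. (t - \<lambda>\<^sub>j(x))\<close>, with multiplicity.
\<close>

definition hyp_eigenvalues :: "(real ^ 'n \<Rightarrow> real) \<Rightarrow> real ^ 'n \<Rightarrow> real ^ 'n \<Rightarrow> real multiset" where
  "hyp_eigenvalues h e x = proots (hyp_char_poly h e x)"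

text \<open>For \<open>d = 0\<close> there are no eigenvalues, and the minimum below is meaningless.\<close>

definition hyperbolicity_cone :: "(real ^ 'n \<Rightarrow> real) \<Rightarrow> real ^ 'n \<Rightarrow> (real ^ 'n) set" where
  "hyperbolicity_cone h e = {x. Min (set_mset (hyp_eigenvalues h e x)) \<ge> 0}"

definition hyp_trace :: "(real ^ 'n \<Rightarrow> real) \<Rightarrow> real ^ 'n \<Rightarrow> real ^ 'n \<Rightarrow> real" where
  "hyp_trace h e x = \<Sum>\<^sub># (hyp_eigenvalues h e x)"

definition hyp_rank :: "(real ^ 'n \<Rightarrow> real) \<Rightarrow> real ^ 'n \<Rightarrow> real ^ 'n \<Rightarrow> nat" where
  "hyp_rank h e x = size {# a \<in># hyp_eigenvalues h e x. a \<noteq> 0 #}"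

definition partial_deriv :: "'n \<Rightarrow> (real ^ 'n \<Rightarrow> real) \<Rightarrow> real ^ 'n \<Rightarrow> real" where
  "partial_deriv k f x = deriv (\<lambda>s. f (x + s *\<^sub>R axis k 1)) 0"

definition dir_deriv :: "real ^ 'n \<Rightarrow> (real ^ 'n \<Rightarrow> real) \<Rightarrow> real ^ 'n \<Rightarrow> real" where
  "dir_deriv v f x = (\<Sum>k\<in>UNIV. v $ k * partial_deriv k f x)"

text \<open>For the list of vectors \<open>[v\<^sub>1, \<dots>, v\<^sub>m]\<close>: \<open>t \<mapsto> (1 - D\<^sub>v\<^sub>1) \<cdots> (1 - D\<^sub>v\<^sub>m) h (t e)\<close>.\<close>

definition mixed_char_poly ::
    "(real ^ 'n \<Rightarrow> real) \<Rightarrow> real ^ 'n \<Rightarrow> (real ^ 'n) list \<Rightarrow> real \<Rightarrow> real" where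
  "mixed_char_poly h e vs t = foldr (\<lambda>v f x. f x - dir_deriv v f x) vs h (t *\<^sub>R e)"

definition lambda_max :: "(real ^ 'n \<Rightarrow> real) \<Rightarrow> real ^ 'n \<Rightarrow> (real ^ 'n) list \<Rightarrow> real" where
  "lambda_max h e vs = Max {t. mixed_char_poly h e vs t = 0}"

definition U_set :: "nat \<Rightarrow> (real \<times> real) set" where
  "U_set r = {(\<delta>, \<mu>). \<delta> > 0 \<and> \<mu> > 0 \<and>
     \<delta> - 1 \<ge> \<delta> / \<mu> *
       (((1 + \<delta> / (real r * \<mu>)) ^ (r - 1) - (\<delta> / (real r * \<mu>)) ^ (r - 1)) /
        ((1 + \<delta> / (real r * \<mu>)) ^ r - (\<delta> / (real r * \<mu>)) ^ r)) \<and>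
     (\<mu> > 1 \<or> (1 \<le> \<delta> \<and> \<delta> \<le> 2 \<and> \<mu> > 1 - \<delta> / real r))}"

definition delta_bound :: "real \<Rightarrow> nat \<Rightarrow> nat \<Rightarrow> real" where
  "delta_bound \<epsilon> m r =
     Inf {(\<epsilon> * \<mu> + (1 - 1 / real m) * \<delta>) / (1 - 1 / real m + \<mu> / real m) | \<delta> \<mu>. (\<delta>, \<mu>) \<in> U_set r}"

end

theory Submission
  imports Defs
begin

text \<open>
  Pulling \<open>h\<close> back along \<open>z \<mapsto> \<Sum>j. z\<^sub>j v\<^sub>j\<close> gives a homogeneous polynomial \<open>P\<close> in \<open>m\<close> variables, which is
  stable by Garding's theorem and of degree at most \<open>r\<close> in each variable. The polynomial
  \<open>Q(x, y) = \<Prod>j. (1 - y\<^sub>j \<partial>\<^sub>j) P(x)\<close> is again homogeneous, and hyperbolic with respect to \<open>(1, 0)\<close>.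
  For \<open>(\<delta>, \<mu>) \<in> U\<^sub>r\<close> and \<open>t = \<epsilon> \<mu>\<close>, the barrier argument of Marcus, Spielman and Srivastava, run over
  all variables but the \<open>k\<close>-th, shows that the point with \<open>x = t 1 + \<delta> (1 - e\<^sub>k)\<close> and \<open>y = 1 + (\<mu> - 1) e\<^sub>k\<close> is
  in the closed hyperbolicity cone of \<open>Q\<close>. This cone is convex, so it contains the sum of these points
  over \<open>k\<close>, a multiple of which is the point that gives the bound.

  In the barrier step the rank enters because \<open>\<partial>\<^sub>i F / F\<close>, as a function of \<open>z\<^sub>j\<close>, maps the upper half plane to
  the closed lower one. Hence it is \<open>c\<^sub>0 + \<Sum>a. k\<^sub>a / (z\<^sub>j - a)\<close> with \<open>k\<^sub>a \<ge> 0\<close> and at most \<open>r\<close> poles, and the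
  step can be checked pole by pole.
\<close>

section \<open>Univariate bounds and polynomial functions\<close>

text \<open>Making the coefficients of the operators into variables is what permits averaging:
  \<open>Q\<close> is homogeneous in x and y jointly, so one cone holds points with different y. The
  point for \<open>k\<close> leaves x_k unshifted because after the other m - 1 steps the barrier in
  variable \<open>k\<close> is still at most 1/\<mu>, exactly what the weakened operator with y_k =
  \<mu> tolerates. The choice t = \<epsilon> \<mu> comes from the initial barrier at t 1, which is
  tr(v_i)/t. The sum of the points has all x equal to m t + (m - 1) \<delta> and all y equal to m -
  1 + \<mu>; their ratio, after cancelling m, is the quotient inside the infimum. The inequality in
  U_r bounds the other r - 1 poles in the pole-by-pole check; the alternative for \<mu> gives \<mu>
  + \<delta>/r > 1, so that a step stays above the roots. Both rest on Jensen's inequality, with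
  equal roots as the extremal case. Limits of polynomials without zeros in the upper half plane are
  handled by an explicit lower bound for the modulus, whose constant depends on a degree bound and
  not on the polynomial.\<close>

lemma no_upper_roots_lower_bound:
  fixes p :: "complex poly"
  assumes "degree p \<le> n" and "\<And>w. Im w > 0 \<Longrightarrow> poly p w \<noteq> 0" and z: "Im z > 0"
  shows "norm (poly p t) * (Im z / (Im z + norm (z - t))) ^ n \<le> norm (poly p z)"
  using assms(1,2)
proof (induction n arbitrary: p)
  case 0
  then obtain c where "p = [:c:]" by (metis degree_eq_zeroE le_zero_eq)
  then show ?case by simp
next
  case (Suc n)
  \<comment> \<open>Each linear factor loses at most the factor \<open>k\<close> between
    \<open>t\<close> and \<open>z\<close>: a root \<open>s\<close> has Im s <= 0, so Im z <= |z -
    s|, while |t - s| <= |z - t| + |z - s|. Since \<open>k\<close> does not involve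
    \<open>p\<close>, the bound survives limits in which \<open>p\<close> varies, a quantitative
    form of Hurwitz's theorem.\<close>
  define k where "k = Im z / (Im z + norm (z - t))"
  have k: "0 \<le> k" "k \<le> 1" using z by (auto simp: k_def divide_simps add_pos_nonneg intro: add_nonneg_nonneg)
  show ?case
  proof (cases "degree p = 0")
    case True
    then obtain c where "p = [:c:]" by (metis degree_eq_zeroE)
    then show ?thesis using k power_le_one[OF k] mult_left_mono[OF power_le_one[OF k, of "Suc n"], of "norm c"]
      by (simp add: k_def[symmetric])
  next
    case False
    then obtain s where s: "poly p s = 0"
      using fundamental_theorem_of_algebra[of p] constant_degree[of p] by auto
    then obtain q where q: "p = [:-s, 1:] * q" by (metis dvdE poly_eq_0_iff_dvd)
    have "q \<noteq> 0" using q False by auto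
    then have "degree p = Suc (degree q)"
      by (simp add: q degree_mult_eq del: mult_pCons_left)
    then have dq: "degree q \<le> n" using Suc.prems by simp
    have "poly q w \<noteq> 0" if "Im w > 0" for w using Suc.prems(2)[OF that] by (auto simp: q)
    note IH = Suc.IH[OF dq this, folded k_def]
    have Ims: "Im s \<le> 0" using Suc.prems(2)[of s] s by force
    have "Im z \<le> norm (z - s)" using abs_Im_le_cmod[of "z - s"] Ims by simp
    moreover have "norm (t - s) \<le> norm (z - t) + norm (z - s)"
      using norm_triangle_ineq[of "t - z" "z - s"] by (simp add: norm_minus_commute)
    ultimately have "norm (t - s) * Im z \<le> norm (z - s) * (Im z + norm (z - t))"
      using z mult_right_mono[of "norm (t - s)" "norm (z - t) + norm (z - s)" "Im z"]
        mult_right_mono[of "Im z" "norm (z - s)" "norm (z - t)"]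
      by (simp add: algebra_simps)
    then have "norm (t - s) * k \<le> norm (z - s)" using z
      by (simp add: k_def divide_simps add_pos_nonneg)
    then have "(norm (t - s) * k) * (norm (poly q t) * k ^ n) \<le> norm (z - s) * norm (poly q z)"
      using IH k by (intro mult_mono) (auto intro!: mult_nonneg_nonneg)
    moreover have "poly p x = (x - s) * poly q x" for x by (simp add: q algebra_simps)
    ultimately show ?thesis by (simp only: norm_mult k_def[symmetric] power_Suc mult_ac)
  qed
qed

lemma log_deriv_Im_le:
  fixes p :: "complex poly"
  assumes "\<And>w. Im w > 0 \<Longrightarrow> poly p w \<noteq> 0" and "poly p z \<noteq> 0" and "Im z \<ge> 0"
  shows "Im (poly (pderiv p) z / poly p z) \<le> 0 \<and>
    (Im z > 0 \<longrightarrow> degree p > 0 \<longrightarrow> Im (poly (pderiv p) z / poly p z) < 0)"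
  using assms(1,2)
proof (induction "degree p" arbitrary: p)
  case 0
  then obtain c where "p = [:c:]" by (metis degree_eq_zeroE)
  then show ?case by (simp add: pderiv_pCons)
next
  case (Suc n)
  then obtain s where s: "poly p s = 0"
    using fundamental_theorem_of_algebra constant_degree by (metis nat.simps(3))
  then obtain q where q: "p = [:-s, 1:] * q" by (metis dvdE poly_eq_0_iff_dvd)
  have "q \<noteq> 0" using q Suc by auto
  then have "degree p = Suc (degree q)"
    by (simp add: q degree_mult_eq del: mult_pCons_left)
  moreover have "poly q w \<noteq> 0" if "Im w > 0" for w using Suc.prems(1)[OF that] by (auto simp: q)
  moreover have "poly q z \<noteq> 0" using Suc.prems(2) by (auto simp: q)
  ultimately have IH: "Im (poly (pderiv q) z / poly q z) \<le> 0"
    using Suc.hyps(1)[of q] Suc.hyps(2) by simp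
  have zs: "z \<noteq> s" using s Suc.prems(2) by auto
  have "poly (pderiv p) z / poly p z = 1 / (z - s) + poly (pderiv q) z / poly q z"
    using zs \<open>poly q z \<noteq> 0\<close>
    by (simp add: q pderiv_mult pderiv_pCons del: mult_pCons_left) (simp add: field_simps)
  moreover have "Im s \<le> 0" using Suc.prems(1)[of s] s by force
  then have "Im (1 / (z - s)) \<le> 0" "Im z > 0 \<Longrightarrow> Im (1 / (z - s)) < 0"
    using assms(3) zs
    by (auto simp: Im_divide_Reals complex_eq_iff divide_simps Im_divide sum_power2_gt_zero_iff power2_eq_square[symmetric] split: if_splits)
  ultimately show ?case using IH by auto
qed

text \<open>Polynomials are kept as functions, so that closure properties, continuity and
  derivatives follow by induction. Indices range over all of \<open>nat\<close>, which leaves room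
  for the operator parameters beside the variables.\<close>

inductive polyfun :: "((nat \<Rightarrow> complex) \<Rightarrow> complex) \<Rightarrow> bool" where
  const: "polyfun (\<lambda>z. c)"
| coord: "polyfun (\<lambda>z. z i)"
| add: "polyfun F \<Longrightarrow> polyfun G \<Longrightarrow> polyfun (\<lambda>z. F z + G z)"
| mult: "polyfun F \<Longrightarrow> polyfun G \<Longrightarrow> polyfun (\<lambda>z. F z * G z)"

lemma polyfun_diff: "polyfun F \<Longrightarrow> polyfun G \<Longrightarrow> polyfun (\<lambda>z. F z - G z)"
  using polyfun.add[of F, OF _ polyfun.mult[OF polyfun.const[of "-1"], of G]] by simp

lemma polyfun_sum: "(\<And>a. a \<in> A \<Longrightarrow> polyfun (F a)) \<Longrightarrow> polyfun (\<lambda>z. \<Sum>a\<in>A. F a z)"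
  by (induction A rule: infinite_finite_induct) (auto intro: polyfun.intros)

lemma polyfun_prod: "(\<And>a. a \<in> A \<Longrightarrow> polyfun (F a)) \<Longrightarrow> polyfun (\<lambda>z. \<Prod>a\<in>A. F a z)"
  by (induction A rule: infinite_finite_induct) (auto intro: polyfun.intros)

lemma polyfun_power: "polyfun F \<Longrightarrow> polyfun (\<lambda>z. F z ^ n)"
  by (induction n) (auto intro: polyfun.intros)

text \<open>The degree bound \<open>N\<close> is uniform over all lines; this lets
  \<open>no_upper_roots_lower_bound\<close> be applied with one exponent along a moving
  line.\<close>

lemma polyfun_line:
  assumes "polyfun F"
  obtains N where "\<And>a b. \<exists>p. degree p \<le> N \<and> (\<forall>s. F (\<lambda>i. a i + s * b i) = poly p s)"
proof -
  have "\<exists>N. \<forall>a b. \<exists>p. degree p \<le> N \<and> (\<forall>s. F (\<lambda>i. a i + s * b i) = poly p s)"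
    using assms
  proof induction
    case (const c)
    show ?case
    proof (intro exI[of _ "0::nat"] allI)
      show "\<exists>p. degree p \<le> 0 \<and> (\<forall>s. c = poly p s)"
        by (intro exI[of _ "[:c:]"]) simp
    qed
  next
    case (coord i)
    show ?case
    proof (intro exI[of _ "1::nat"] allI)
      fix a b :: "nat \<Rightarrow> complex"
      show "\<exists>p. degree p \<le> 1 \<and> (\<forall>s. a i + s * b i = poly p s)"
        by (intro exI[of _ "[:a i, b i:]"]) simp
    qed
  next
    case (add F G)
    then obtain M N where
      M: "\<And>a b. \<exists>p. degree p \<le> M \<and> (\<forall>s. F (\<lambda>i. a i + s * b i) = poly p s)" and
      N: "\<And>a b. \<exists>p. degree p \<le> N \<and> (\<forall>s. G (\<lambda>i. a i + s * b i) = poly p s)" by metis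
    show ?case
    proof (intro exI[of _ "max M N"] allI)
      fix a b
      obtain p q where "degree p \<le> M" "\<forall>s. F (\<lambda>i. a i + s * b i) = poly p s"
        "degree q \<le> N" "\<forall>s. G (\<lambda>i. a i + s * b i) = poly q s" using M N by metis
      then show "\<exists>p. degree p \<le> max M N \<and> (\<forall>s. F (\<lambda>i. a i + s * b i) + G (\<lambda>i. a i + s * b i) = poly p s)"
        by (intro exI[of _ "p + q"]) (auto intro: degree_add_le)
    qed
  next
    case (mult F G)
    then obtain M N where
      M: "\<And>a b. \<exists>p. degree p \<le> M \<and> (\<forall>s. F (\<lambda>i. a i + s * b i) = poly p s)" and
      N: "\<And>a b. \<exists>p. degree p \<le> N \<and> (\<forall>s. G (\<lambda>i. a i + s * b i) = poly p s)" by metis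
    show ?case
    proof (intro exI[of _ "M + N"] allI)
      fix a b
      obtain p q where "degree p \<le> M" "\<forall>s. F (\<lambda>i. a i + s * b i) = poly p s"
        "degree q \<le> N" "\<forall>s. G (\<lambda>i. a i + s * b i) = poly q s" using M N by metis
      then show "\<exists>p. degree p \<le> M + N \<and> (\<forall>s. F (\<lambda>i. a i + s * b i) * G (\<lambda>i. a i + s * b i) = poly p s)"
        by (intro exI[of _ "p * q"]) (auto intro: order_trans[OF degree_mult_le])
    qed
  qed
  then show ?thesis using that by blast
qed

lemma polyfun_continuous:
  "polyfun F \<Longrightarrow> (\<And>i. continuous_on S (\<lambda>x. a x i)) \<Longrightarrow> continuous_on S (\<lambda>x. F (a x))"
  by (induction rule: polyfun.induct) (auto intro: continuous_intros)

section \<open>Partial derivatives of polynomial functions\<close>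

definition pd :: "nat \<Rightarrow> ((nat \<Rightarrow> complex) \<Rightarrow> complex) \<Rightarrow> (nat \<Rightarrow> complex) \<Rightarrow> complex" where
  "pd j F z = deriv (\<lambda>s. F (z(j := s))) (z j)"

lemma polyfun_pd_aux:
  "polyfun F \<Longrightarrow> \<exists>G. polyfun G \<and> (\<forall>z. ((\<lambda>s. F (z(j := s))) has_field_derivative G z) (at (z j)))"
proof (induction rule: polyfun.induct)
  case (const c)
  show ?case by (rule exI[of _ "\<lambda>z. 0"]) (auto intro: polyfun.intros)
next
  case (coord i)
  show ?case by (rule exI[of _ "\<lambda>z. if i = j then 1 else 0"]) (auto intro: polyfun.intros)
next
  case (add F G)
  then obtain F' G' where 1: "polyfun F'" "polyfun G'"
    "\<And>z. ((\<lambda>s. F (z(j := s))) has_field_derivative F' z) (at (z j))"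
    "\<And>z. ((\<lambda>s. G (z(j := s))) has_field_derivative G' z) (at (z j))" by metis
  show ?case by (rule exI[of _ "\<lambda>z. F' z + G' z"]) 
    (intro conjI allI polyfun.intros 1 DERIV_add)
next
  case (mult F G)
  then obtain F' G' where 1: "polyfun F'" "polyfun G'"
    "\<And>z. ((\<lambda>s. F (z(j := s))) has_field_derivative F' z) (at (z j))"
    "\<And>z. ((\<lambda>s. G (z(j := s))) has_field_derivative G' z) (at (z j))" by metis
  have "((\<lambda>s. F (z(j := s)) * G (z(j := s))) has_field_derivative F' z * G z + G' z * F z) (at (z j))" for z
    using DERIV_mult[OF 1(3)[of z] 1(4)[of z]] by simp
  moreover have "polyfun (\<lambda>z. F' z * G z + G' z * F z)"
    by (intro polyfun.intros 1 mult.hyps)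
  ultimately show ?case
    by (intro exI[of _ "\<lambda>z. F' z * G z + G' z * F z"] conjI allI) 
qed

lemma polyfun_pd: "polyfun F \<Longrightarrow> polyfun (pd j F)"
  and pd_deriv: "polyfun F \<Longrightarrow> ((\<lambda>s. F (z(j := s))) has_field_derivative pd j F z) (at (z j))"
proof -
  assume "polyfun F"
  then obtain G where G: "polyfun G" "\<And>z. ((\<lambda>s. F (z(j := s))) has_field_derivative G z) (at (z j))"
    using polyfun_pd_aux by blast
  have "pd j F = G" by (rule ext) (simp add: pd_def DERIV_imp_deriv[OF G(2)])
  with G show "polyfun (pd j F)" "((\<lambda>s. F (z(j := s))) has_field_derivative pd j F z) (at (z j))"
    by auto
qed

lemma pd_eqI: "((\<lambda>s. F (z(j := s))) has_field_derivative D) (at (z j)) \<Longrightarrow> pd j F z = D"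
  unfolding pd_def by (rule DERIV_imp_deriv)

lemma pd_const: "pd j (\<lambda>z. c) = (\<lambda>z. 0)"
  by (rule ext, rule pd_eqI) simp

lemma pd_coord: "pd j (\<lambda>z. z i) = (\<lambda>z. if i = j then 1 else 0)"
  by (rule ext, rule pd_eqI) auto

lemma pd_add:
  "polyfun F \<Longrightarrow> polyfun G \<Longrightarrow> pd j (\<lambda>z. F z + G z) = (\<lambda>z. pd j F z + pd j G z)"
  by (rule ext, rule pd_eqI) (rule DERIV_add; rule pd_deriv)

lemma pd_diff:
  "polyfun F \<Longrightarrow> polyfun G \<Longrightarrow> pd j (\<lambda>z. F z - G z) = (\<lambda>z. pd j F z - pd j G z)"
  by (rule ext, rule pd_eqI) (rule DERIV_diff; rule pd_deriv)

lemma pd_mult: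
  "polyfun F \<Longrightarrow> polyfun G \<Longrightarrow> pd j (\<lambda>z. F z * G z) = (\<lambda>z. pd j F z * G z + pd j G z * F z)"
proof (rule ext, rule pd_eqI)
  fix z assume "polyfun F" "polyfun G"
  from DERIV_mult[OF pd_deriv[OF this(1), of z j] pd_deriv[OF this(2), of z j]]
  show "((\<lambda>s. F (z(j := s)) * G (z(j := s))) has_field_derivative pd j F z * G z + pd j G z * F z) (at (z j))"
    by simp
qed

lemma pd_commute: "polyfun F \<Longrightarrow> pd i (pd j F) = pd j (pd i F)"
proof (induction rule: polyfun.induct)
  case (add F G)
  then show ?case by (simp add: pd_add polyfun_pd)
next
  case (mult F G)
  then show ?case
    by (simp add: pd_mult pd_add polyfun_pd polyfun.mult) (simp add: algebra_simps)
qed (simp_all add: pd_const pd_coord)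

text \<open>Reduces \<open>pd\<close> to \<open>pderiv\<close> on a coordinate line, at every point
  of the line, so that it can be iterated.\<close>

lemma polyfun_line_pd:
  assumes F: "polyfun F" and p: "\<And>s. F (z(j := z j + s)) = poly p s"
  shows "pd j F (z(j := z j + s)) = poly (pderiv p) s"
proof -
  have "F (z(j := s)) = poly (p \<circ>\<^sub>p [:- z j, 1:]) s" for s
    using p[of "s - z j"] by (simp add: poly_pcompose)
  then have *: "(\<lambda>s. F (z(j := s))) = poly (p \<circ>\<^sub>p [:- z j, 1:])" by auto
  have "((\<lambda>s. F ((z(j := z j + s))(j := s))) has_field_derivative poly (pderiv p) s) (at (z j + s))"
    using poly_DERIV[of "p \<circ>\<^sub>p [:- z j, 1:]" "z j + s"]
    by (simp only: fun_upd_upd * pderiv_pcompose pderiv_pCons poly_mult poly_pcompose)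
      (simp add: * [symmetric] poly_pcompose[abs_def])
  then show ?thesis by (intro pd_eqI) simp
qed

lemma polyfun_axis:
  assumes "polyfun F" obtains p where "\<And>s. F (z(j := z j + s)) = poly p s"
proof -
  obtain p where "\<forall>s. F (\<lambda>i. z i + s * (if i = j then 1 else 0)) = poly p s"
    using polyfun_line[OF assms] by metis
  moreover have "(\<lambda>i. z i + s * (if i = j then 1 else 0)) = z(j := z j + s)" for s by auto
  ultimately show ?thesis using that by simp
qed

section \<open>Rational functions mapping the upper half plane to the lower one\<close>

definition rp :: "real multiset \<Rightarrow> complex poly" where
  "rp M = (\<Prod>a\<in>#M. [:- of_real a, 1:])"

lemma rp_empty [simp]: "rp {#} = 1"
  and rp_add_mset: "rp (add_mset a M) = [:- of_real a, 1:] * rp M"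
  by (simp_all add: rp_def)

lemma poly_rp: "poly (rp M) z = (\<Prod>a\<in>#M. z - of_real a)"
  by (induction M) (simp_all add: rp_add_mset algebra_simps)

lemma poly_rp_eq_0_iff: "poly (rp M) z = 0 \<longleftrightarrow> (\<exists>a\<in>#M. z = of_real a)"
  by (auto simp: poly_rp prod_mset_zero_iff)

lemma rp_nz [simp]: "rp M \<noteq> 0"
  by (induction M) (simp_all add: rp_add_mset del: mult_pCons_left)

lemma degree_rp [simp]: "degree (rp M) = size M"
  by (induction M) (simp_all add: rp_add_mset degree_mult_eq del: mult_pCons_left)

lemma poly_rp_upper_nz: "Im z \<noteq> 0 \<Longrightarrow> poly (rp M) z \<noteq> 0"
  by (auto simp: poly_rp_eq_0_iff)

lemma real_rooted_split:
  fixes p :: "complex poly"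
  assumes "p \<noteq> 0" "\<And>z. poly p z = 0 \<Longrightarrow> z \<in> \<real>"
  shows "\<exists>c M. c \<noteq> 0 \<and> p = smult c (rp M)"
  using assms
proof (induction "degree p" arbitrary: p)
  case 0
  then obtain c where "p = [:c:]" by (metis degree_eq_zeroE)
  then show ?case using 0 by (intro exI[of _ c] exI[of _ "{#}"]) auto
next
  case (Suc n)
  then obtain s where s: "poly p s = 0"
    using fundamental_theorem_of_algebra constant_degree by (metis nat.simps(3))
  then obtain a where a: "s = of_real a" using Suc.prems(2) by (auto elim: Reals_cases)
  obtain q where q: "p = [:-s, 1:] * q" using s by (metis dvdE poly_eq_0_iff_dvd)
  have "q \<noteq> 0" using q Suc by auto
  then have "degree p = Suc (degree q)"
    by (simp add: q degree_mult_eq del: mult_pCons_left)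
  then obtain c M where "c \<noteq> 0" "q = smult c (rp M)"
    using Suc.hyps(1)[of q] Suc.hyps(2) Suc.prems(2) \<open>q \<noteq> 0\<close> by (auto simp: q)
  then show ?case
    by (intro exI[of _ c] exI[of _ "add_mset a M"]) (simp add: q a rp_add_mset del: mult_pCons_left)
qed

text \<open>\<open>\<gamma> / \<omega> ^ k\<close> is the leading term at a pole of order
  \<open>k\<close>. As \<omega> crosses the upper half plane its argument sweeps an angle k \<pi>;
  for k >= 2 this is a full turn, which no half plane contains. For k = 1 the whole lower half plane
  is swept, which fixes the argument of \<gamma>.\<close>

lemma sector_pole:
  fixes \<gamma> :: complex
  assumes H: "\<And>\<omega>. Im \<omega> > 0 \<Longrightarrow> Im (\<gamma> / \<omega> ^ k) \<le> 0" and "\<gamma> \<noteq> 0" "k \<ge> 1"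
  shows "k = 1 \<and> Im \<gamma> = 0 \<and> Re \<gamma> \<ge> 0"
proof -
  have rot: "Im \<gamma> * cos \<phi> - Re \<gamma> * sin \<phi> \<le> 0" if "0 < \<phi>" "\<phi> < k * pi" for \<phi>
  proof -
    have "\<phi> / k < pi" "0 < \<phi> / k" using that \<open>k \<ge> 1\<close> by (auto simp: field_simps)
    then have "Im (cis (\<phi> / k)) > 0" by (simp add: sin_gt_zero)
    then have "Im (\<gamma> / cis (\<phi> / k) ^ k) \<le> 0" by (rule H)
    moreover have "cis (\<phi> / k) ^ k = cis \<phi>" using \<open>k \<ge> 1\<close> by (simp add: Complex.DeMoivre)
    ultimately show ?thesis
      by (simp add: divide_inverse flip: cis_inverse)
  qed
  have "k < 2"
  proof (rule ccontr)
    assume "\<not> k < 2"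
    then have k: "real k \<ge> 2" by simp
    then have "2 * pi \<le> k * pi" by simp
    then have b: "0 < \<phi> \<Longrightarrow> \<phi> < 2 * pi \<Longrightarrow> Im \<gamma> * cos \<phi> - Re \<gamma> * sin \<phi> \<le> 0" for \<phi>
      by (intro rot) linarith+
    \<comment> \<open>The angles \<pi>/2, 3 \<pi>/2 and \<pi> give Re \<gamma> = 0 and Im \<gamma>
      >= 0. The remaining direction would be the excluded angle 0; \<pi>/3 does the same once Re
      \<gamma> = 0.\<close>
    have "Re \<gamma> \<ge> 0" using b[of "pi / 2"] by simp
    moreover have "sin (3 * pi / 2) = -1" "cos (3 * pi / 2) = 0"
      using sin_add[of pi "pi / 2"] cos_add[of pi "pi / 2"] by (simp_all add: field_simps)
    then have "Re \<gamma> \<le> 0" using b[of "3 * pi / 2"] by simp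
    moreover have "Im \<gamma> \<ge> 0" using b[of pi] by simp
    moreover have "Im \<gamma> \<le> 0" using b[of "pi / 3"] calculation by (simp add: cos_60)
    ultimately show False using \<open>\<gamma> \<noteq> 0\<close> by (simp add: complex_eq_iff)
  qed
  then have k: "k = 1" using \<open>k \<ge> 1\<close> by simp
  have "Re \<gamma> \<ge> 0" using H[of \<i>] by (simp add: k)
  \<comment> \<open>Test points 1 + \<i> e and -1 + \<i> e close to the real axis; as e tends to 0
    they force Im \<gamma> = 0. The value of e chosen below makes Re \<gamma> * e at most half of
    |Im \<gamma>|.\<close>
  have 1: "Im \<gamma> \<le> Re \<gamma> * e" "- Im \<gamma> \<le> Re \<gamma> * e" if "e > 0" for e
    using H[of "Complex 1 e"] H[of "Complex (-1) e"] that sum_power2_gt_zero_iff[of 1 e]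
    by (auto simp: k Im_divide field_simps power2_eq_square)
  have "\<bar>Im \<gamma>\<bar> \<le> 0"
  proof (rule ccontr)
    assume "\<not> \<bar>Im \<gamma>\<bar> \<le> 0"
    then have "\<bar>Im \<gamma>\<bar> / (2 * (Re \<gamma> + 1)) > 0" (is "?e > 0") using \<open>Re \<gamma> \<ge> 0\<close> by simp
    from 1[OF this] have "\<bar>Im \<gamma>\<bar> \<le> Re \<gamma> * ?e" by linarith
    also have "Re \<gamma> * ?e = \<bar>Im \<gamma>\<bar> / 2 * (Re \<gamma> / (Re \<gamma> + 1))" using \<open>Re \<gamma> \<ge> 0\<close>
      by (simp add: field_simps)
    also have "\<dots> \<le> \<bar>Im \<gamma>\<bar> / 2 * 1" using \<open>Re \<gamma> \<ge> 0\<close>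
      by (intro mult_left_mono) (auto simp: field_simps)
    finally show False using \<open>\<not> \<bar>Im \<gamma>\<bar> \<le> 0\<close> by simp
  qed
  with \<open>Re \<gamma> \<ge> 0\<close> show ?thesis using k by simp
qed

text \<open>The map \<omega> to -1/\<omega> preserves the upper half plane and exchanges growth at
  infinity with a pole at 0.\<close>

lemma sector_infinity:
  fixes \<gamma> :: complex
  assumes H: "\<And>\<omega>. Im \<omega> > 0 \<Longrightarrow> Im (\<gamma> * \<omega> ^ k) \<le> 0" and "\<gamma> \<noteq> 0" "k \<ge> 1"
  shows "k = 1 \<and> Re \<gamma> \<le> 0 \<and> Im \<gamma> = 0"
proof -
  have "Im ((-1) ^ k * \<gamma> / \<omega> ^ k) \<le> 0" if "Im \<omega> > 0" for \<omega>
  proof -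
    have "Im (- 1 / \<omega>) > 0" using that by (simp add: Im_divide divide_simps sum_power2_gt_zero_iff)
    from H[OF this] show ?thesis
      by (simp only: power_divide times_divide_eq_right mult.commute[of \<gamma>])
  qed
  then have "k = 1 \<and> Im ((-1) ^ k * \<gamma>) = 0 \<and> Re ((-1) ^ k * \<gamma>) \<ge> 0"
    using assms by (intro sector_pole) auto
  then show ?thesis by auto
qed

text \<open>Zooming in: \<open>\<rho> ^ k\<close> times the quotient at
  \<open>a + \<rho> * \<omega>\<close> tends to a constant over \<open>\<omega> ^ k\<close> as
  \<rho> decreases to 0, so \<open>sector_pole\<close> applies to the leading Laurent coefficient.
  It is nonzero because \<open>q\<close> does not vanish at \<open>a\<close>.\<close>

lemma pick_pole:
  assumes H: "\<And>z. Im z > 0 \<Longrightarrow> Im (poly q z / poly (rp M) z) \<le> 0"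
    and a: "a \<in># M" and qa: "poly q (of_real a) \<noteq> 0"
  shows "count M a = 1 \<and> Im (poly q a / poly (rp (M - {#a#})) a) = 0
    \<and> Re (poly q a / poly (rp (M - {#a#})) a) \<ge> 0"
proof -
  define k where "k = count M a"
  define M' where "M' = filter_mset (\<lambda>b. b \<noteq> a) M"
  have M: "M = replicate_mset k a + M'"
    by (rule multiset_eqI) (simp add: M'_def k_def)
  have k: "k \<ge> 1" using a by (simp add: k_def)
  have rpM: "poly (rp M) z = (z - of_real a) ^ k * poly (rp M') z" for z
    by (subst M) (simp add: poly_rp image_replicate_mset)
  define u where "u z = poly q z / poly (rp M') z" for z
  have nz: "poly (rp M') (of_real a) \<noteq> 0" by (auto simp: poly_rp_eq_0_iff M'_def)
  have "Im (u (of_real a) / \<omega> ^ k) \<le> 0" if \<omega>: "Im \<omega> > 0" for \<omega>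
  proof (rule tendsto_upperbound)
    show "((\<lambda>\<rho>. Im (u (of_real a + of_real \<rho> * \<omega>) / \<omega> ^ k)) \<longlongrightarrow> Im (u (of_real a) / \<omega> ^ k)) (at_right 0)"
      unfolding u_def using nz \<omega> by (auto intro!: tendsto_eq_intros)
    have "Im (u (of_real a + of_real \<rho> * \<omega>) / \<omega> ^ k) \<le> 0" if "\<rho> > 0" for \<rho>
    proof -
      have "Im (poly q (a + \<rho> * \<omega>) / poly (rp M) (a + \<rho> * \<omega>)) \<le> 0"
        using that \<omega> by (intro H) simp
      also have "poly q (a + \<rho> * \<omega>) / poly (rp M) (a + \<rho> * \<omega>) =
          of_real (1 / \<rho> ^ k) * (u (of_real a + of_real \<rho> * \<omega>) / \<omega> ^ k)"
        by (simp add: rpM u_def power_mult_distrib)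
      finally show ?thesis using that
        by (simp only: times_complex.sel(2) Re_complex_of_real Im_complex_of_real) (simp add: field_simps)
    qed
    then show "\<forall>\<^sub>F \<rho> in at_right 0. Im (u (of_real a + of_real \<rho> * \<omega>) / \<omega> ^ k) \<le> 0"
      by (auto simp: eventually_at_right_less intro: eventually_mono[OF eventually_at_right_less])
  qed simp
  then have "k = 1 \<and> Im (u a) = 0 \<and> Re (u a) \<ge> 0"
    using k qa nz by (intro sector_pole) (auto simp: u_def)
  moreover from this have "M - {#a#} = M'" by (subst M) simp
  ultimately show ?thesis by (simp add: u_def k_def)
qed

lemma rp_dvd:
  assumes "\<And>a. a \<in># M \<Longrightarrow> count M a = 1" "\<And>a. a \<in># M \<Longrightarrow> poly r (of_real a) = 0"
  shows "rp M dvd r"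
  using assms
proof (induction M arbitrary: r)
  case (add a M)
  obtain r1 where r1: "r = [:- of_real a, 1:] * r1"
    using add.prems(2)[of a] by (auto simp: poly_eq_0_iff_dvd)
  have a: "a \<notin># M" using add.prems(1)[of a] by (simp add: count_eq_zero_iff)
  have "rp M dvd r1"
  proof (rule add.IH)
    fix b assume b: "b \<in># M"
    then have "b \<noteq> a" using a by auto
    then show "count M b = 1" "poly r1 (of_real b) = 0"
      using add.prems(1)[of b] add.prems(2)[of b] b by (auto simp: r1)
  qed
  then show ?case by (simp only: rp_add_mset r1 mult_dvd_mono dvd_refl)
qed simp

text \<open>Partial fractions of a rational function of Nevanlinna-Pick type, cleared of
  denominators; the \<open>k a\<close> are the residues. After cancelling common roots all poles are
  simple by \<open>pick_pole\<close>, which is why the sum can run over the distinct members of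
  \<open>M\<close>. The polynomial part \<open>w\<close> is still arbitrary here.\<close>

lemma pick_partial_fractions:
  assumes "\<And>z. Im z > 0 \<Longrightarrow> Im (poly q z / poly (rp M) z) \<le> 0"
  shows "\<exists>w (k :: real \<Rightarrow> real). (\<forall>a. k a \<ge> 0) \<and>
    q = w * rp M + (\<Sum>a\<in>set_mset M. smult (of_real (k a)) (rp (M - {#a#})))"
  using assms
proof (induction "size M" arbitrary: q M)
  case 0
  then show ?case by (intro exI[of _ q] exI[of _ "\<lambda>a. 0"]) simp
next
  case (Suc n)
  show ?case
  proof (cases "\<exists>a\<in>#M. poly q (of_real a) = 0")
    case True
    then obtain a where a: "a \<in># M" "poly q (of_real a) = 0" by auto
    then obtain M1 where M: "M = add_mset a M1" by (metis multi_member_split)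
    obtain q1 where q: "q = [:- of_real a, 1:] * q1" using a by (auto simp: poly_eq_0_iff_dvd)
    have "Im (poly q1 z / poly (rp M1) z) \<le> 0" if "Im z > 0" for z
    proof -
      have "z \<noteq> of_real a" using that by auto
      then show ?thesis using Suc.prems[OF that]
        by (simp add: q M rp_add_mset del: mult_pCons_left)
    qed
    then obtain w k where k: "\<And>a. k a \<ge> 0" and
      q1: "q1 = w * rp M1 + (\<Sum>a\<in>set_mset M1. smult (of_real (k a)) (rp (M1 - {#a#})))"
      using Suc.hyps(1)[of M1 q1] Suc.hyps(2) M by auto
    \<comment> \<open>If cancelling removed the last copy of \<open>a\<close>, then \<open>a\<close>
      is no longer a pole and gets residue 0.\<close>
    define k' where "k' b = (if b \<in># M1 then k b else 0)" for b
    have "(\<Sum>b\<in>set_mset M. smult (of_real (k' b)) (rp (M - {#b#}))) =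
        (\<Sum>b\<in>set_mset M1. smult (of_real (k' b)) (rp (M - {#b#})))"
      by (rule sum.mono_neutral_right) (auto simp: M k'_def)
    also have "\<dots> = (\<Sum>b\<in>set_mset M1. [:- of_real a, 1:] * smult (of_real (k b)) (rp (M1 - {#b#})))"
      by (intro sum.cong refl)
        (auto simp: M k'_def rp_add_mset add_mset_diff_bothsides simp flip: rp_add_mset add_mset_remove_trivial_If simp del: mult_pCons_left)
    finally have "q = w * rp M + (\<Sum>b\<in>set_mset M. smult (of_real (k' b)) (rp (M - {#b#})))"
      by (simp add: q q1 M rp_add_mset distrib_left mult.left_commute sum_distrib_left del: mult_pCons_left)
    then show ?thesis using k by (intro exI[of _ w] exI[of _ k']) (auto simp: k'_def)
  next
    case False
    define R where "R a = poly q (of_real a) / poly (rp (M - {#a#})) (of_real a)" for a :: real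
    have R: "count M a = 1" "R a = of_real (Re (R a))" "Re (R a) \<ge> 0" if "a \<in># M" for a
      using pick_pole[OF Suc.prems that] False that by (auto simp: R_def complex_eq_iff)
    define k where "k a = (if a \<in># M then Re (R a) else 0)" for a
    define S where "S = (\<Sum>a\<in>set_mset M. smult (of_real (k a)) (rp (M - {#a#})))"
    \<comment> \<open>At a root \<open>a\<close> only its own term of \<open>S\<close> survives, and
      its residue was chosen to match \<open>q\<close> there. All roots being simple, agreement at
      the roots gives divisibility.\<close>
    have "rp M dvd q - S"
    proof (rule rp_dvd)
      fix a assume a: "a \<in># M"
      have "poly S (of_real a) = (\<Sum>b\<in>set_mset M. of_real (k b) * poly (rp (M - {#b#})) (of_real a))"
        by (simp add: S_def poly_sum)
      also have "\<dots> = (\<Sum>b\<in>{a}. of_real (k b) * poly (rp (M - {#b#})) (of_real a))"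
      proof (rule sum.mono_neutral_right)
        show "\<forall>b\<in>set_mset M - {a}. of_real (k b) * poly (rp (M - {#b#})) (of_real a) = (0::complex)"
        proof
          fix b assume "b \<in> set_mset M - {a}"
          then have "a \<in># M - {#b#}" using a by (simp add: in_diff_count)
          then show "of_real (k b) * poly (rp (M - {#b#})) (of_real a) = (0::complex)"
            by (auto simp: poly_rp_eq_0_iff)
        qed
      qed (use a in auto)
      also have "\<dots> = R a * poly (rp (M - {#a#})) (of_real a)"
        using a R(2)[OF a] by (simp add: k_def)
      also have "\<dots> = poly q (of_real a)"
      proof -
        have "a \<notin># M - {#a#}" using R(1)[OF a] by (simp add: in_diff_count)
        then show ?thesis by (auto simp: R_def poly_rp_eq_0_iff)
      qed
      finally show "poly (q - S) (of_real a) = 0" by simp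
    qed (use R in auto)
    then obtain w where "q - S = rp M * w" by (rule dvdE)
    then have "q = w * rp M + S" by (simp add: algebra_simps)
    then show ?thesis using R by (intro exI[of _ w] exI[of _ k]) (auto simp: S_def k_def)
  qed
qed

lemma poly_rp_remove:
  "a \<in># M \<Longrightarrow> poly (rp M) z = (z - of_real a) * poly (rp (M - {#a#})) z"
  by (metis insert_DiffM poly_rp image_mset_add_mset prod_mset.add_mset)

lemma poly_pderiv_rp:
  "(\<And>a. a \<in># M \<Longrightarrow> z \<noteq> of_real a) \<Longrightarrow>
    poly (pderiv (rp M)) z = poly (rp M) z * (\<Sum>a\<in>#M. 1 / (z - of_real a))"
proof (induction M)
  case (add a M)
  have "z \<noteq> of_real a" using add.prems by simp
  moreover have "poly (pderiv (rp M)) z = poly (rp M) z * (\<Sum>a\<in>#M. 1 / (z - of_real a))"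
    using add by simp
  ultimately show ?case
    by (simp add: rp_add_mset pderiv_mult pderiv_pCons distrib_left del: mult_pCons_left)
qed simp

text \<open>If the polynomial part had degree n >= 1, its leading term would map the upper half
  plane to the closed lower one, so n = 1 with a negative coefficient by
  \<open>sector_infinity\<close>. Then the function would become negative far out on the positive
  axis, against the second hypothesis.\<close>

lemma pick_partial_fractions_const:
  assumes H: "\<And>z. Im z > 0 \<Longrightarrow> Im (poly q z / poly (rp M) z) \<le> 0"
    and nonneg: "\<And>t. (0::real) < t \<Longrightarrow> Re (poly q (of_real t) / poly (rp M) (of_real t)) \<ge> 0"
  shows "\<exists>c (k :: real \<Rightarrow> real). (\<forall>a. k a \<ge> 0) \<and>
    q = smult c (rp M) + (\<Sum>a\<in>set_mset M. smult (of_real (k a)) (rp (M - {#a#})))"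
proof -
  obtain w k where k: "\<And>a. k a \<ge> 0" and
    q: "q = w * rp M + (\<Sum>a\<in>set_mset M. smult (of_real (k a)) (rp (M - {#a#})))"
    using pick_partial_fractions[OF H] by blast
  have "degree w = 0"
  proof (rule ccontr)
    assume n: "degree w \<noteq> 0"
    define n where "n = degree w"
    define \<gamma> where "\<gamma> = lead_coeff w"
    have \<gamma>: "\<gamma> \<noteq> 0" using n by (auto simp: \<gamma>_def)
    define f where "f z = poly q z / poly (rp M) z" for z
    \<comment> \<open>\<open>g\<close> is \<open>f z / z ^ n\<close> in a form whose limit at
      infinity is read off termwise; the two agree away from the poles.\<close>
    define g where "g z = poly w z / z ^ n + (\<Sum>a\<in>set_mset M. of_real (k a) / (z - of_real a)) / z ^ n" for z :: complex
    have fg: "f z / z ^ n = g z" if "\<forall>a\<in>#M. z \<noteq> of_real a" for z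
    proof -
      have nz: "poly (rp M) z \<noteq> 0" using that by (auto simp: poly_rp_eq_0_iff)
      have "f z = poly w z + (\<Sum>a\<in>set_mset M. of_real (k a) * poly (rp (M - {#a#})) z) / poly (rp M) z"
        using nz by (simp add: f_def q poly_sum field_simps)
      also have "(\<Sum>a\<in>set_mset M. of_real (k a) * poly (rp (M - {#a#})) z) / poly (rp M) z
          = (\<Sum>a\<in>set_mset M. of_real (k a) / (z - of_real a))"
        unfolding sum_divide_distrib
      proof (intro sum.cong refl)
        fix a assume "a \<in> set_mset M"
        then show "of_real (k a) * poly (rp (M - {#a#})) z / poly (rp M) z = of_real (k a) / (z - of_real a)"
          using nz poly_rp_remove[of a M z] that by (simp add: divide_simps)
      qed
      finally show ?thesis by (simp add: g_def add_divide_distrib)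
    qed
    have "(g \<longlongrightarrow> \<gamma> + (\<Sum>a\<in>set_mset M. of_real (k a) * 0) * 0) at_infinity"
    proof -
      have inv: "((\<lambda>z. inverse (z - c)) \<longlongrightarrow> 0) at_infinity" for c :: complex
      proof -
        have "filterlim (\<lambda>z. (-c) + z) at_infinity at_infinity"
          by (rule tendsto_add_filterlim_at_infinity[OF tendsto_const filterlim_ident])
        from filterlim_compose[OF tendsto_inverse_0 this] show ?thesis by simp
      qed
      have "((\<lambda>z::complex. inverse (z ^ n)) \<longlongrightarrow> 0) at_infinity"
        by (rule filterlim_compose[OF tendsto_inverse_0 Polynomial.filterlim_power_at_infinity])
          (use n in \<open>simp add: n_def\<close>)
      then show ?thesis
        unfolding g_def n_def \<gamma>_def divide_inverse[of "sum _ _"] divide_inverse[of "of_real _"]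
        by (intro tendsto_intros poly_divide_tendsto_aux inv)
    qed
    then have g: "(g \<longlongrightarrow> \<gamma>) at_infinity" by simp
    have ray: "filterlim (\<lambda>R. of_real R * \<omega>) at_infinity at_top" if "\<omega> \<noteq> 0" for \<omega> :: complex
    proof -
      have "filterlim (\<lambda>R. \<omega> * of_real R) at_infinity at_top"
        using that by (intro tendsto_mult_filterlim_at_infinity[OF tendsto_const]
          filterlim_of_real_at_infinity)
      then show ?thesis by (simp add: mult.commute)
    qed
    have "Im (\<gamma> * \<omega> ^ n) \<le> 0" if \<omega>: "Im \<omega> > 0" for \<omega>
    proof (rule tendsto_upperbound)
      have "\<omega> \<noteq> 0" using \<omega> by auto
      then show "((\<lambda>R. Im (g (of_real R * \<omega>) * \<omega> ^ n)) \<longlongrightarrow> Im (\<gamma> * \<omega> ^ n)) at_top"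
        by (intro tendsto_intros filterlim_compose[OF g] ray)
      have "Im (g (of_real R * \<omega>) * \<omega> ^ n) \<le> 0" if "R > 0" for R
      proof -
        have *: "Im (of_real R * \<omega>) > 0" using that \<omega> by simp
        then have "Im (f (of_real R * \<omega>)) \<le> 0" unfolding f_def by (rule H)
        moreover have "f (of_real R * \<omega>) = of_real (R ^ n) * (g (of_real R * \<omega>) * \<omega> ^ n)"
        proof -
          have "\<forall>a\<in>#M. of_real R * \<omega> \<noteq> of_real a" using * by (metis Im_complex_of_real less_irrefl)
          from fg[OF this] show ?thesis using \<open>\<omega> \<noteq> 0\<close> that by (simp add: field_simps power_mult_distrib)
        qed
        ultimately show ?thesis using zero_less_power[OF that, of n]
          by (simp only: times_complex.sel(2) Re_complex_of_real Im_complex_of_real)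
            (auto simp: mult_le_0_iff simp flip: of_real_power)
      qed
      then show "\<forall>\<^sub>F R in at_top. Im (g (of_real R * \<omega>) * \<omega> ^ n) \<le> 0"
        by (auto intro: eventually_mono[OF eventually_gt_at_top[of 0]])
    qed simp
    then have *: "n = 1 \<and> Re \<gamma> \<le> 0 \<and> Im \<gamma> = 0"
      using \<gamma> n by (intro sector_infinity) (auto simp: n_def)
    have "Re \<gamma> \<ge> 0"
    proof (rule tendsto_lowerbound)
      show "((\<lambda>R. Re (g (of_real R * 1))) \<longlongrightarrow> Re \<gamma>) at_top"
        by (intro tendsto_intros filterlim_compose[OF g] ray) simp
      have "Re (g (of_real R * 1)) \<ge> 0" if "R > Max (insert 0 (set_mset M))" for R
      proof -
        have R: "R > 0" "\<forall>a\<in>#M. R > a" using that by auto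
        then have "f (of_real R) / of_real R ^ n = g (of_real R)" by (intro fg) auto
        then have "g (of_real R * 1) = f (of_real R) / of_real R" using * by simp
        then show ?thesis using nonneg[OF R(1)] R(1) by (simp add: f_def Re_divide_of_real del: divide_divide_eq_left)
      qed
      then show "\<forall>\<^sub>F R in at_top. Re (g (of_real R * 1)) \<ge> 0"
        by (blast intro: eventually_mono[OF eventually_gt_at_top])
    qed simp
    then show False using * \<gamma> by (simp add: complex_eq_iff)
  qed
  then obtain c where "w = [:c:]" by (metis degree_eq_zeroE)
  then show ?thesis using k q by (intro exI[of _ c] exI[of _ k]) auto
qed

section \<open>Stability and Garding's theorem\<close>

definition homog :: "nat \<Rightarrow> ((nat \<Rightarrow> complex) \<Rightarrow> complex) \<Rightarrow> bool" where
  "homog d F \<longleftrightarrow> (\<forall>c z. F (\<lambda>i. c * z i) = c ^ d * F z)"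

text \<open>Coordinates outside \<open>J\<close> stay real. For \<open>J = {1..m}\<close> this is
  stability in the x-variables for every real choice of the operator parameters, and it contains
  hyperbolicity with respect to (1, 0).\<close>

definition stable :: "nat set \<Rightarrow> ((nat \<Rightarrow> complex) \<Rightarrow> complex) \<Rightarrow> bool" where
  "stable J F \<longleftrightarrow> (\<forall>z. (\<forall>j\<in>J. Im (z j) > 0) \<longrightarrow> (\<forall>j. j \<notin> J \<longrightarrow> Im (z j) = 0) \<longrightarrow> F z \<noteq> 0)"

lemma homog_minus: "homog d F \<Longrightarrow> F (\<lambda>i. - z i) = (-1) ^ d * F z"
  using homog_def[of d F, THEN iffD1, rule_format, of "-1" z] by simp

lemma homog_eq_0_iff: "homog d F \<Longrightarrow> c \<noteq> 0 \<Longrightarrow> F (\<lambda>i. c * z i) = 0 \<longleftrightarrow> F z = 0"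
  by (simp add: homog_def)

text \<open>Stability itself does not cover a base point with real coordinates or a direction with
  zero entries. Pushing the base point by \<open>\<eta> * \<i>\<close> on \<open>J\<close> makes
  every line point with Im s >= 0 admissible; the lower bound on |F| has a constant \<open>K\<close>
  independent of \<eta>, so it passes to \<eta> = 0, where \<open>F z \<noteq> 0\<close> keeps it
  positive.\<close>

lemma stable_boundary:
  assumes F: "polyfun F" "stable J F"
    and z: "\<And>j. j \<in> J \<Longrightarrow> Im (z j) \<ge> 0" "\<And>j. j \<notin> J \<Longrightarrow> Im (z j) = 0" and nz: "F z \<noteq> 0"
    and y: "\<And>j. j \<in> J \<Longrightarrow> (y j :: real) \<ge> 0" "\<And>j. j \<notin> J \<Longrightarrow> y j = 0"
    and s: "Im s > 0"
  shows "F (\<lambda>i. z i + s * of_real (y i)) \<noteq> 0"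
proof -
  obtain N where N: "\<And>a b. \<exists>p. degree p \<le> N \<and> (\<forall>s. F (\<lambda>i. a i + s * b i) = poly p s)"
    using polyfun_line[OF F(1)] by blast
  define u where "u i = (if i \<in> J then \<i> else 0)" for i
  define K where "K = (Im s / (Im s + norm s)) ^ N"
  have bound: "norm (F (\<lambda>i. z i + of_real \<eta> * u i)) * K
      \<le> norm (F (\<lambda>i. z i + of_real \<eta> * u i + s * of_real (y i)))" if "\<eta> > 0" for \<eta> :: real
  proof -
    obtain p where p: "degree p \<le> N"
      "\<And>s. F (\<lambda>i. (z i + of_real \<eta> * u i) + s * of_real (y i)) = poly p s"
      using N[of "\<lambda>i. z i + of_real \<eta> * u i" "\<lambda>i. of_real (y i)"] by auto
    have "poly p w \<noteq> 0" if "Im w > 0" for w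
    proof -
      have "F (\<lambda>i. (z i + of_real \<eta> * u i) + w * of_real (y i)) \<noteq> 0"
      proof (rule F(2)[unfolded stable_def, rule_format])
        show "Im (z j + of_real \<eta> * u j + w * of_real (y j)) > 0" if "j \<in> J" for j
          using z(1)[OF that] y(1)[OF that] that \<open>\<eta> > 0\<close> \<open>Im w > 0\<close>
          by (simp add: u_def add_nonneg_pos add_pos_nonneg)
        show "Im (z j + of_real \<eta> * u j + w * of_real (y j)) = 0" if "j \<notin> J" for j
          using z(2)[OF that] y(2)[OF that] that by (simp add: u_def)
      qed
      then show ?thesis by (simp add: p)
    qed
    from no_upper_roots_lower_bound[OF p(1) this s, of 0] show ?thesis
      using p(2)[of 0] p(2)[of s] by (simp add: K_def)
  qed
  have "norm (F z) * K \<le> norm (F (\<lambda>i. z i + s * of_real (y i)))"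
  proof (rule tendsto_le)
    have c: "continuous_on UNIV (\<lambda>\<eta>. F (\<lambda>i. z i + of_real \<eta> * u i + s * of_real (y i)))" for s
      by (intro polyfun_continuous[OF F(1)] continuous_intros)
    have "((\<lambda>\<eta>. F (\<lambda>i. z i + of_real \<eta> * u i + s * of_real (y i))) \<longlongrightarrow> F (\<lambda>i. z i + s * of_real (y i))) (at_right 0)" for s
      using c[of s, unfolded continuous_on_def, rule_format, of 0]
      by (auto intro: tendsto_mono[OF at_le])
    from this[of 0] this[of s]
    show "((\<lambda>\<eta>. norm (F (\<lambda>i. z i + of_real \<eta> * u i)) * K) \<longlongrightarrow> norm (F z) * K) (at_right 0)"
      "((\<lambda>\<eta>. norm (F (\<lambda>i. z i + of_real \<eta> * u i + s * of_real (y i)))) \<longlongrightarrow> norm (F (\<lambda>i. z i + s * of_real (y i)))) (at_right 0)"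
      by (auto intro!: tendsto_intros)
    show "\<forall>\<^sub>F \<eta> in at_right 0. norm (F (\<lambda>i. z i + of_real \<eta> * u i)) * K
      \<le> norm (F (\<lambda>i. z i + of_real \<eta> * u i + s * of_real (y i)))"
      using bound by (auto intro: eventually_mono[OF eventually_at_right_less])
  qed simp
  moreover have "K > 0" unfolding K_def using s
    by (intro zero_less_power divide_pos_pos add_pos_nonneg) auto
  ultimately show ?thesis using nz by (smt (verit) mult_pos_pos norm_eq_zero norm_ge_zero)
qed

text \<open>
  The parameter \<open>\<tau> \<in> [0, 1]\<close> scales \<open>x\<close> and \<open>y\<close>, and \<open>w' = w + \<eta> u\<close>. Along this homotopy no root in \<open>s\<close>
  of \<open>F (\<dots> + s w')\<close> is real, so the absence of roots in the upper half plane is both an open and a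
  closed condition on \<open>\<tau>\<close>.
\<close>

lemma garding_step:
  fixes u w y :: "nat \<Rightarrow> real"
  assumes F: "polyfun F" "homog d F"
    and hyp: "\<And>x z. Im z > 0 \<Longrightarrow> F (\<lambda>i. of_real (x i) + z * of_real (u i)) \<noteq> 0"
    and w: "\<And>t::real. t > 0 \<Longrightarrow> F (\<lambda>i. of_real (w i + t * u i)) \<noteq> 0"
    and y: "\<And>x c. c > 0 \<Longrightarrow> F (\<lambda>i. Complex (x i) (y i + c * u i)) \<noteq> 0"
    and c: "c > 0"
  shows "F (\<lambda>i. Complex (x i) (y i + w i + c * u i)) \<noteq> 0"
proof -
  define \<eta> where "\<eta> = c / 2"
  have \<eta>: "\<eta> > 0" using c by (simp add: \<eta>_def)
  define w' where "w' i = complex_of_real (w i + \<eta> * u i)" for i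
  define X where "X \<tau> i = Complex (\<tau> * x i) (\<tau> * y i + \<eta> * u i)" for \<tau> :: real and i
  define G where "G \<tau> s = F (\<lambda>i. X \<tau> i + s * w' i)" for \<tau> s
  have Fw': "F w' \<noteq> 0" using w[OF \<eta>] by (simp add: w'_def[abs_def])
  have cone: "F (\<lambda>i. Complex (v i) (\<tau> * y i + a * u i)) \<noteq> 0" if "\<tau> \<ge> 0" "a > 0" for \<tau> a v
  proof (cases "\<tau> = 0")
    case True
    have "(\<lambda>i. Complex (v i) (a * u i)) = (\<lambda>i. of_real (v i) + (\<i> * a) * of_real (u i))"
      by (auto simp: complex_eq_iff)
    then show ?thesis using hyp[of "\<i> * a" v] that True by simp
  next
    case False
    then have "\<tau> > 0" using that by simp
    have "(\<lambda>i. Complex (v i) (\<tau> * y i + a * u i)) =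
        (\<lambda>i. of_real \<tau> * Complex (v i / \<tau>) (y i + a / \<tau> * u i))"
      using False by (auto simp: complex_eq_iff field_simps)
    then show ?thesis using y[of "a / \<tau>" "\<lambda>i. v i / \<tau>"] \<open>\<tau> > 0\<close> that
      by (simp add: homog_eq_0_iff[OF F(2)])
  qed
  have real_s: "G \<tau> s \<noteq> 0" if "\<tau> \<ge> 0" "Im s = 0" for \<tau> s
  proof -
    have "(\<lambda>i. X \<tau> i + s * w' i) = (\<lambda>i. Complex (\<tau> * x i + Re s * (w i + \<eta> * u i)) (\<tau> * y i + \<eta> * u i))"
      using that(2) by (auto simp: complex_eq_iff X_def w'_def)
    then show ?thesis using cone[OF that(1) \<eta>] by (simp add: G_def)
  qed
  have zero: "G 0 s \<noteq> 0" if s: "Im s > 0" for s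
  proof -
    have s0: "s \<noteq> 0" using s by auto
    \<comment> \<open>At \<tau> = 0 the argument is
      \<open>\<i> * \<eta> * u + s * (w + \<eta> * u)\<close>, that is, s times
      \<open>w + z * u\<close>. So a zero would be one on the pencil of \<open>w\<close> and
      \<open>u\<close>: excluded for nonreal \<open>z\<close> by hyperbolicity, with homogeneity for
      Im z < 0, and for z real and positive by the hypothesis on \<open>w\<close>.\<close>
    define z where "z = of_real \<eta> + \<i> * \<eta> / s"
    have "(\<lambda>i. X 0 i + s * w' i) = (\<lambda>i. s * (of_real (w i) + z * of_real (u i)))"
      using s0 by (auto simp: X_def w'_def z_def complex_eq_iff[of "Complex _ _"] field_simps Complex_eq)
    then have *: "G 0 s = 0 \<longleftrightarrow> F (\<lambda>i. of_real (w i) + z * of_real (u i)) = 0"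
      by (simp add: G_def homog_eq_0_iff[OF F(2) s0])
    have Imz: "Im z = \<eta> * Re s / (cmod s)\<^sup>2" and Rez: "Re z = \<eta> + \<eta> * Im s / (cmod s)\<^sup>2"
      by (simp_all add: z_def Im_divide Re_divide cmod_power2)
    consider "Re s = 0" | "Im z > 0" | "Im z < 0"
    proof -
      have "(cmod s)\<^sup>2 > 0" using s0 by simp
      then have "Im z > 0" if "Re s > 0" using that \<eta> by (simp add: Imz)
      moreover have "Im z < 0" if "Re s < 0"
        using that \<eta> \<open>(cmod s)\<^sup>2 > 0\<close> unfolding Imz by (intro divide_neg_pos mult_pos_neg)
      ultimately show ?thesis using that by linarith
    qed
    then show ?thesis
    proof cases
      case 1
      then have "z = of_real (Re z)" by (simp add: complex_eq_iff Imz)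
      moreover have "Re z > 0" using \<eta> s by (auto simp: Rez intro!: add_pos_nonneg divide_nonneg_nonneg)
      ultimately show ?thesis using w[of "Re z"] * by simp
    next
      case 2
      then show ?thesis using hyp[of z w] * by simp
    next
      case 3
      have "F (\<lambda>i. - (of_real (w i) + z * of_real (u i))) \<noteq> 0"
        using hyp[of "-z" "\<lambda>i. - w i"] 3 by (simp add: algebra_simps)
      then show ?thesis
        using homog_minus[OF F(2), of "\<lambda>i. of_real (w i) + z * of_real (u i)"] * by auto
    qed
  qed
  define A where "A = {\<tau> \<in> {0..1}. \<forall>s. Im s > 0 \<longrightarrow> G \<tau> s \<noteq> 0}"
  have contX: "continuous_on S (\<lambda>p. X (fst p) i)" for S i
    unfolding X_def Complex_eq by (intro continuous_intros)
  have contG: "continuous_on S (\<lambda>p. G (fst p) (snd p))" for S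
    unfolding G_def by (intro polyfun_continuous[OF F(1)] continuous_intros contX)
  have "closed A"
  proof -
    obtain N where N: "\<And>a b. \<exists>p. degree p \<le> N \<and> (\<forall>s. F (\<lambda>i. a i + s * b i) = poly p s)"
      using polyfun_line[OF F(1)] by blast
    \<comment> \<open>\<open>K\<close> does not depend on \<tau>, so absence of roots above the axis
      becomes a family of closed inequalities. They suffice conversely because
      \<open>G \<tau> 0 \<noteq> 0\<close>.\<close>
    define K where "K s = (Im s / (Im s + norm s)) ^ N" for s :: complex
    have K: "K s > 0" if "Im s > 0" for s
      unfolding K_def using that by (intro zero_less_power divide_pos_pos add_pos_nonneg) auto
    have "A = (\<Inter>s\<in>{s. Im s > 0}. {\<tau> \<in> {0..1}. norm (G \<tau> 0) * K s \<le> norm (G \<tau> s)})"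
    proof (intro equalityI subsetI)
      fix \<tau> assume \<tau>: "\<tau> \<in> A"
      obtain p where p: "degree p \<le> N" "\<And>s. G \<tau> s = poly p s"
        using N[of "X \<tau>" w'] by (auto simp: G_def)
      have "norm (poly p 0) * (Im s / (Im s + norm (s - 0))) ^ N \<le> norm (poly p s)" if "Im s > 0" for s
        by (rule no_upper_roots_lower_bound[OF p(1) _ that]) (use \<tau> in \<open>simp add: A_def p\<close>)
      then show "\<tau> \<in> (\<Inter>s\<in>{s. Im s > 0}. {\<tau> \<in> {0..1}. norm (G \<tau> 0) * K s \<le> norm (G \<tau> s)})"
        using \<tau> by (auto simp: A_def p K_def)
    next
      fix \<tau> assume "\<tau> \<in> (\<Inter>s\<in>{s. Im s > 0}. {\<tau> \<in> {0..1}. norm (G \<tau> 0) * K s \<le> norm (G \<tau> s)})"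
      then have *: "0 \<le> \<tau> \<and> \<tau> \<le> 1 \<and> norm (G \<tau> 0) * K s \<le> norm (G \<tau> s)" if "Im s > 0" for s
        using that by auto
      have \<tau>: "0 \<le> \<tau>" "\<tau> \<le> 1" using *[of \<i>] by auto
      note \<tau> = \<tau> conjunct2[OF conjunct2[OF *]]
      have "norm (G \<tau> 0) > 0" using real_s[of \<tau> 0] \<tau> by simp
      then have "norm (G \<tau> s) > 0" if "Im s > 0" for s
        using \<tau>(3)[OF that] K[OF that] by (smt (verit) mult_pos_pos)
      then show "\<tau> \<in> A" using \<tau> by (auto simp: A_def)
    qed
    moreover have "continuous_on UNIV (\<lambda>\<tau>. G \<tau> s)" for s
      using continuous_on_compose2[OF contG[of UNIV], of UNIV "\<lambda>\<tau>. (\<tau>, s)"] by (simp add: continuous_on_Pair)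
    then have "closed {\<tau> \<in> {0..1}. norm (G \<tau> 0) * K s \<le> norm (G \<tau> s)}" for s
      unfolding Collect_conj_eq Collect_mem_eq
      by (intro closed_Int closed_Collect_le continuous_intros) auto
    ultimately show ?thesis by (auto intro: closed_INT)
  qed
  moreover have "closed ({0..1} - A)"
  proof -
    \<comment> \<open>The closed upper half plane is made compact by two charts, s with |s| <= 1 and
      1/s with |1/s| <= 1. The value 0 in the second chart stands for a root at infinity, which
      \<open>F w' \<noteq> 0\<close> rules out. Projecting the two compact root sets to \<tau> gives
      a closed set.\<close>
    define B1 where "B1 = {p \<in> {0..1} \<times> cball 0 1. Im (snd p) \<ge> 0 \<and> G (fst p) (snd p) = 0}"
    define B2 where "B2 = {p \<in> {0..1} \<times> cball 0 1. Im (snd p) \<le> 0 \<and> F (\<lambda>i. w' i + snd p * X (fst p) i) = 0}"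
    have inv: "F (\<lambda>i. w' i + inverse s * X \<tau> i) = 0 \<longleftrightarrow> G \<tau> s = 0" if "s \<noteq> 0" for \<tau> s
    proof -
      have "(\<lambda>i. X \<tau> i + s * w' i) = (\<lambda>i. s * (w' i + inverse s * X \<tau> i))"
        using that by (auto simp: field_simps)
      then show ?thesis by (simp add: G_def homog_eq_0_iff[OF F(2) that])
    qed
    have cl: "closed {p :: real \<times> complex. f p = 0}" if "continuous_on UNIV f" for f :: "_ \<Rightarrow> complex"
      using that by (intro closed_Collect_eq continuous_intros)
    have "B1 = ({0..1} \<times> cball 0 1) \<inter> ({p. Im (snd p) \<ge> 0} \<inter> {p. G (fst p) (snd p) = 0})"
      by (auto simp: B1_def)
    moreover have "closed ({p. Im (snd p) \<ge> 0} \<inter> {p :: real \<times> complex. G (fst p) (snd p) = 0})"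
      by (intro closed_Int cl contG closed_Collect_le continuous_intros)
    ultimately have "compact B1" by (simp add: compact_Int_closed compact_Times)
    have "B2 = ({0..1} \<times> cball 0 1) \<inter> ({p. Im (snd p) \<le> 0} \<inter> {p. F (\<lambda>i. w' i + snd p * X (fst p) i) = 0})"
      by (auto simp: B2_def)
    moreover have "closed ({p. Im (snd p) \<le> 0} \<inter> {p :: real \<times> complex. F (\<lambda>i. w' i + snd p * X (fst p) i) = 0})"
      by (intro closed_Int cl closed_Collect_le polyfun_continuous[OF F(1)] continuous_intros contX)
    ultimately have "compact B2" by (simp add: compact_Int_closed compact_Times)
    have "{0..1} - A = fst ` B1 \<union> fst ` B2"
    proof (intro equalityI subsetI)
      fix \<tau> assume "\<tau> \<in> {0..1} - A"
      then obtain s where \<tau>: "\<tau> \<in> {0..1}" and s: "Im s > 0" "G \<tau> s = 0" by (auto simp: A_def)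
      show "\<tau> \<in> fst ` B1 \<union> fst ` B2"
      proof (cases "norm s \<le> 1")
        case True
        then have "(\<tau>, s) \<in> B1" using \<tau> s by (auto simp: B1_def)
        then show ?thesis by force
      next
        case False
        have "s \<noteq> 0" using s by auto
        moreover have "norm (inverse s) \<le> 1"
          using False unfolding norm_inverse by (intro inverse_le_1_iff[THEN iffD2]) simp
        moreover have "Im (inverse s) \<le> 0" using s by (simp add: divide_nonpos_nonneg)
        ultimately have "(\<tau>, inverse s) \<in> B2" using \<tau> s inv[of s \<tau>]
          by (simp add: B2_def)
        then show ?thesis by force
      qed
    next
      fix \<tau> assume "\<tau> \<in> fst ` B1 \<union> fst ` B2"
      then consider s where "(\<tau>, s) \<in> B1" | s where "(\<tau>, s) \<in> B2" by force
      then show "\<tau> \<in> {0..1} - A"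
      proof cases
        case 1
        then have "Im s > 0" using real_s[of \<tau> s] by (force simp: B1_def)
        then show ?thesis using 1 by (auto simp: A_def B1_def)
      next
        case 2
        then have s: "s \<noteq> 0" using Fw' by (auto simp: B2_def)
        then have "G \<tau> (inverse s) = 0" using inv[of "inverse s" \<tau>] 2 by (simp add: B2_def)
        moreover have "Im (inverse s) \<ge> 0" using 2 by (auto simp: B2_def divide_nonpos_nonneg)
        then have "Im (inverse s) > 0" using real_s[of \<tau> "inverse s"] 2 \<open>G \<tau> (inverse s) = 0\<close>
          by (force simp: B2_def)
        ultimately show ?thesis using 2
          by (auto simp: A_def B2_def simp del: inverse_complex.sel intro!: exI[of _ "inverse s"])
      qed
    qed
    then show ?thesis using \<open>compact B1\<close> \<open>compact B2\<close>
      by (simp add: closed_Un compact_imp_closed compact_continuous_image continuous_on_fst continuous_on_id)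
  qed
  moreover have "connected {0..1::real}" by simp
  moreover have "0 \<in> A" using zero by (simp add: A_def)
  moreover have "A \<subseteq> {0..1}" by (auto simp: A_def)
  ultimately have "({0..1} - A) \<inter> {0..1} = {}"
    using connected_closedD[of "{0..1}" A "{0..1} - A"] by auto
  moreover have "(1::real) \<in> {0..1}" by simp
  ultimately have "1 \<in> A" by blast
  \<comment> \<open>At s = \<i> the imaginary part is \<open>y + w + 2 * \<eta> * u\<close>, which
    is why \<eta> was taken as c / 2.\<close>
  then have "G 1 \<i> \<noteq> 0" by (simp add: A_def)
  moreover have "(\<lambda>i. X 1 i + \<i> * w' i) = (\<lambda>i. Complex (x i) (y i + w i + c * u i))"
    by (auto simp: complex_eq_iff X_def w'_def \<eta>_def algebra_simps)
  ultimately show ?thesis by (simp add: G_def)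
qed

section \<open>The barrier argument\<close>

text \<open>The parameter \<open>y\<^sub>j\<close> of \<open>1 - y\<^sub>j \<partial>\<^sub>j\<close> is the coordinate with index \<open>m + j\<close>.\<close>

definition diff_op :: "nat \<Rightarrow> nat \<Rightarrow> ((nat \<Rightarrow> complex) \<Rightarrow> complex) \<Rightarrow> (nat \<Rightarrow> complex) \<Rightarrow> complex" where
  "diff_op m j F z = F z - z (m + j) * pd j F z"

definition stable_form :: "nat \<Rightarrow> nat \<Rightarrow> ((nat \<Rightarrow> complex) \<Rightarrow> complex) \<Rightarrow> bool" where
  "stable_form m d F \<longleftrightarrow> polyfun F \<and> homog d F \<and> stable {1..m} F"

lemma stable_formD: "stable_form m d F \<Longrightarrow> polyfun F" "stable_form m d F \<Longrightarrow> homog d F" "stable_form m d F \<Longrightarrow> stable {1..m} F"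
  by (auto simp: stable_form_def)

lemma polyfun_diff_op: "polyfun F \<Longrightarrow> polyfun (diff_op m j F)"
  unfolding diff_op_def[abs_def] by (intro polyfun_diff polyfun.mult polyfun.coord polyfun_pd)

lemma pd_diff_op:
  "polyfun F \<Longrightarrow> i \<noteq> m + j \<Longrightarrow> pd i (diff_op m j F) = (\<lambda>z. pd i F z - z (m + j) * pd i (pd j F) z)"
  unfolding diff_op_def[abs_def]
  by (simp add: pd_diff pd_mult pd_coord polyfun.coord polyfun.mult polyfun_pd) (simp add: mult.commute)

lemma diff_op_commute:
  assumes "polyfun F" "i \<in> {1..m}" "j \<in> {1..m}"
  shows "diff_op m i (diff_op m j F) = diff_op m j (diff_op m i F)"
proof -
  have "i \<noteq> m + j" "j \<noteq> m + i" using assms by auto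
  then show ?thesis
    using assms(1) pd_commute[OF assms(1), of i j]
    by (intro ext) (subst (1 2) diff_op_def, simp add: pd_diff_op, simp add: diff_op_def algebra_simps)
qed

text \<open>Differentiate \<open>F (c z) = c ^ d * F z\<close>. Leaving the factor \<open>c\<close>
  on the left avoids the exponent d - 1 and fits \<open>diff_op\<close>, whose coefficient z_(m+j)
  is scaled by \<open>c\<close> as well.\<close>

lemma homog_pd:
  assumes "polyfun F" "homog d F"
  shows "c * pd j F (\<lambda>i. c * z i) = c ^ d * pd j F z"
proof -
  let ?cz = "\<lambda>i. c * z i"
  obtain p where p: "\<And>s. F (z(j := z j + s)) = poly p s" using polyfun_axis[OF assms(1)] by blast
  obtain q where q: "\<And>s. F (?cz(j := ?cz j + s)) = poly q s" using polyfun_axis[OF assms(1)] by blast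
  have "q \<circ>\<^sub>p [:0, c:] = smult (c ^ d) p"
  proof (intro poly_eq_poly_eq_iff[THEN iffD1] ext)
    show "poly (q \<circ>\<^sub>p [:0, c:]) s = poly (smult (c ^ d) p) s" for s
    proof -
      have "?cz(j := ?cz j + c * s) = (\<lambda>i. c * (z(j := z j + s)) i)"
        by (auto simp: algebra_simps)
      then have "F (?cz(j := ?cz j + c * s)) = c ^ d * F (z(j := z j + s))"
        using assms(2) by (simp only: homog_def)
      then have "poly q (c * s) = c ^ d * poly p s" by (simp only: p q)
      then show ?thesis by (simp add: poly_pcompose mult.commute)
    qed
  qed
  then have "poly (pderiv (q \<circ>\<^sub>p [:0, c:])) 0 = poly (pderiv (smult (c ^ d) p)) 0" by simp
  then have "c * poly (pderiv q) 0 = c ^ d * poly (pderiv p) 0"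
    by (simp add: pderiv_pcompose pderiv_smult pderiv_pCons poly_pcompose mult.commute)
  then show ?thesis
    using polyfun_line_pd[OF assms(1) p, of 0] polyfun_line_pd[OF assms(1) q, of 0]
      fun_upd_triv[of ?cz j] by simp
qed

text \<open>At a zero with z_(m+j) = y real, the logarithmic derivative of \<open>F\<close> in z_j
  would be the real number 1/y, but above the real axis its imaginary part is strictly negative. The
  sign of y does not matter, so the parameter may range over all reals.\<close>

lemma stable_form_diff_op:
  assumes F: "stable_form m d F" and j: "j \<in> {1..m}"
  shows "stable_form m d (diff_op m j F)"
proof -
  note F' = stable_formD[OF F]
  have "homog d (diff_op m j F)"
    using F'(2) homog_pd[OF F'(1,2), of _ j]
    by (auto simp: homog_def diff_op_def algebra_simps)
  moreover have "stable {1..m} (diff_op m j F)"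
    unfolding stable_def
  proof (intro allI impI)
    fix z :: "nat \<Rightarrow> complex"
    assume z: "\<forall>j\<in>{1..m}. Im (z j) > 0" "\<forall>j. j \<notin> {1..m} \<longrightarrow> Im (z j) = 0"
    define z0 where "z0 = z(j := of_real (Re (z j)))"
    obtain p where p: "\<And>s. F (z0(j := z0 j + s)) = poly p s" using polyfun_axis[OF F'(1)] by blast
    define w where "w = \<i> * of_real (Im (z j))"
    have zw: "z0(j := z0 j + w) = z"
      by (auto simp: z0_def w_def complex_eq_iff)
    have nz: "poly p s \<noteq> 0" if "Im s > 0" for s
    proof -
      have "F (z0(j := z0 j + s)) \<noteq> 0"
        using z that j by (intro F'(3)[unfolded stable_def, rule_format]) (auto simp: z0_def)
      then show ?thesis by (simp add: p)
    qed
    have w: "Im w > 0" using z j by (simp add: w_def)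
    have Fz: "F z = poly p w" "pd j F z = poly (pderiv p) w"
      using p[of w] polyfun_line_pd[OF F'(1) p, of w] by (simp_all add: zw)
    have "Im (z (m + j)) = 0" using z j by auto
    then obtain y where y: "z (m + j) = of_real y" by (metis complex_is_Real_iff Reals_cases)
    show "diff_op m j F z \<noteq> 0"
    proof
      assume "diff_op m j F z = 0"
      then have eq: "poly p w = of_real y * poly (pderiv p) w" by (simp add: diff_op_def Fz y)
      then have "y \<noteq> 0" "degree p > 0" using nz[OF w] by (auto intro!: Nat.gr0I simp: pderiv_eq_0_iff[symmetric])
      then have "poly (pderiv p) w / poly p w = of_real (1 / y)"
        using eq nz[OF w] by (simp add: field_simps)
      moreover have "Im (poly (pderiv p) w / poly p w) < 0"
        using log_deriv_Im_le[OF nz nz[OF w]] w \<open>degree p > 0\<close> by simp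
      ultimately show False by simp
    qed
  qed
  ultimately show ?thesis using polyfun_diff_op[OF F'(1)] by (simp add: stable_form_def)
qed

definition cx :: "(nat \<Rightarrow> real) \<Rightarrow> nat \<Rightarrow> complex" where
  "cx x i = complex_of_real (x i)"

lemma cx_upd: "cx (x(j := a)) = (cx x)(j := of_real a)"
  by (auto simp: cx_def)

text \<open>The condition of lying above the roots from the barrier method, with the operator
  parameters held fixed.\<close>

definition above_roots :: "nat \<Rightarrow> ((nat \<Rightarrow> complex) \<Rightarrow> complex) \<Rightarrow> (nat \<Rightarrow> real) \<Rightarrow> bool" where
  "above_roots m F x \<longleftrightarrow>
    (\<forall>y. (\<forall>j\<in>{1..m}. y j \<ge> 0) \<longrightarrow> (\<forall>j. j \<notin> {1..m} \<longrightarrow> y j = 0) \<longrightarrow> F (cx (\<lambda>i. x i + y i)) \<noteq> 0)"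

text \<open>The barrier function: the logarithmic derivative in direction \<open>j\<close> at a real
  point. \<open>Re\<close> only makes it real-valued by type, as \<open>F\<close> is
  complex-valued.\<close>

definition Phi :: "nat \<Rightarrow> ((nat \<Rightarrow> complex) \<Rightarrow> complex) \<Rightarrow> (nat \<Rightarrow> real) \<Rightarrow> real" where
  "Phi j F x = Re (pd j F (cx x) / F (cx x))"

lemma above_roots_nz: "above_roots m F x \<Longrightarrow> F (cx x) \<noteq> 0"
  unfolding above_roots_def by (drule spec[of _ "\<lambda>i. 0"]) simp

lemma above_roots_plus:
  assumes "above_roots m F x" "\<And>j. j \<in> {1..m} \<Longrightarrow> y j \<ge> 0" "\<And>j. j \<notin> {1..m} \<Longrightarrow> y j = 0"
  shows "above_roots m F (\<lambda>i. x i + y i)"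
  unfolding above_roots_def
proof (intro allI impI)
  fix y' :: "nat \<Rightarrow> real" assume "\<forall>j\<in>{1..m}. y' j \<ge> 0" "\<forall>j. j \<notin> {1..m} \<longrightarrow> y' j = 0"
  then show "F (cx (\<lambda>i. x i + y i + y' i)) \<noteq> 0"
    using assms(1)[unfolded above_roots_def, rule_format, of "\<lambda>i. y i + y' i"] assms(2,3)
    by (simp add: add.assoc)
qed

lemma above_roots_upd:
  assumes "above_roots m F x" "j \<in> {1..m}" "t \<ge> 0"
  shows "above_roots m F (x(j := x j + t))"
proof -
  have "x(j := x j + t) = (\<lambda>i. x i + (if i = j then t else 0))" by auto
  moreover have "above_roots m F (\<lambda>i. x i + (if i = j then t else 0))"
    by (rule above_roots_plus[OF assms(1)]) (use assms in auto)
  ultimately show ?thesis by simp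
qed



text \<open>Roots above the axis are excluded by \<open>stable_boundary\<close> at the real point
  \<open>x\<close>, roots below it by homogeneity applied to \<open>- x\<close>, and nonnegative
  ones by \<open>above_roots\<close>. \<open>M\<close> holds the roots relative to x_j.\<close>

lemma axis_roots:
  assumes F: "stable_form m d F" and x: "above_roots m F x" and j: "j \<in> {1..m}"
  shows "\<exists>c M. c \<noteq> 0 \<and> (\<forall>a. a \<in># M \<longrightarrow> a < 0) \<and>
    (\<forall>s. F ((cx x)(j := of_real (x j) + s)) = c * poly (rp M) s)"
proof -
  note F' = stable_formD[OF F]
  obtain p where p: "\<And>s. F ((cx x)(j := of_real (x j) + s)) = poly p s"
    using polyfun_axis[OF F'(1), of "cx x" j] by (auto simp: cx_def)
  define y where "y i = (if i = j then 1 else 0 :: real)" for i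
  have upper: "F (\<lambda>i. cx x' i + s * of_real (y i)) \<noteq> 0" if "F (cx x') \<noteq> 0" "Im s > 0" for s x'
    by (rule stable_boundary[OF F'(1,3) _ _ that(1) _ _ that(2)]) (use j in \<open>auto simp: y_def cx_def\<close>)
  have upd: "(\<lambda>i. cx x i + s * of_real (y i)) = (cx x)(j := of_real (x j) + s)" for s
    by (auto simp: y_def cx_def)
  have Fx: "F (cx x) \<noteq> 0" using above_roots_nz[OF x] .
  have "poly p 0 \<noteq> 0" using Fx p[of 0] by (metis add_0_right fun_upd_triv cx_def)
  moreover have neg: "s \<in> \<real> \<and> Re s < 0" if "poly p s = 0" for s
  proof -
    have zero: "F (\<lambda>i. cx x i + s * of_real (y i)) = 0" using that by (simp add: upd p)
    then have "\<not> Im s > 0" using upper[OF Fx] by blast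
    moreover have "\<not> Im s < 0"
    proof
      assume "Im s < 0"
      moreover have "F (cx (\<lambda>i. - x i)) \<noteq> 0" using Fx homog_minus[OF F'(2), of "cx x"] by (simp add: cx_def[abs_def])
      ultimately have "F (\<lambda>i. cx (\<lambda>i. - x i) i + (- s) * of_real (y i)) \<noteq> 0"
        by (intro upper) auto
      then show False using homog_minus[OF F'(2), of "\<lambda>i. cx x i + s * of_real (y i)"] zero
        by (simp add: cx_def)
    qed
    ultimately have s: "s = of_real (Re s)" by (simp add: complex_eq_iff)
    have "\<not> Re s \<ge> 0"
    proof
      assume "Re s \<ge> 0"
      then have "F (cx (x(j := x j + Re s))) \<noteq> 0" by (intro above_roots_nz[of m] above_roots_upd x j)
      then show False using zero s by (simp only: cx_upd upd of_real_add)
    qed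
    then show ?thesis using s by (metis Reals_of_real not_le)
  qed
  ultimately obtain c M where cM: "c \<noteq> 0" "p = smult c (rp M)"
    using real_rooted_split[of p] by force
  have "a < 0" if "a \<in># M" for a
    using neg[of "of_real a"] that by (auto simp: cM poly_rp_eq_0_iff)
  then show ?thesis using cM p by auto
qed

lemma of_real_sum_mset_inverse:
  "(\<Sum>b\<in>#N. 1 / (of_real t - of_real b)) = complex_of_real (\<Sum>b\<in>#N. 1 / (t - b))"
  by (induction N) auto

lemma Phi_axis:
  assumes F: "polyfun F" and c: "c \<noteq> 0" and M: "\<And>a. a \<in># M \<Longrightarrow> a < 0"
    and eq: "\<And>s. F ((cx x)(j := of_real (x j) + s)) = c * poly (rp M) s" and t: "t \<ge> 0"
  shows "pd j F (cx (x(j := x j + t))) = F (cx (x(j := x j + t))) * of_real (\<Sum>a\<in>#M. 1 / (t - a))"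
    "F (cx (x(j := x j + t))) = c * poly (rp M) (of_real t)"
    "poly (rp M) (of_real t) \<noteq> 0"
    "Phi j F (x(j := x j + t)) = (\<Sum>a\<in>#M. 1 / (t - a))"
proof -
  have nz: "of_real t \<noteq> complex_of_real a" if "a \<in># M" for a using M[OF that] t by auto
  show 3: "poly (rp M) (of_real t) \<noteq> 0" using nz by (auto simp: poly_rp_eq_0_iff)
  show 2: "F (cx (x(j := x j + t))) = c * poly (rp M) (of_real t)"
    by (simp only: cx_upd of_real_add eq)
  have "pd j F (cx (x(j := x j + t))) = poly (pderiv (smult c (rp M))) (of_real t)"
    using polyfun_line_pd[OF F, of "cx x" j "smult c (rp M)" "of_real t"] eq
    by (simp add: cx_upd cx_def[of x j])
  also have "\<dots> = c * (poly (rp M) (of_real t) * (\<Sum>a\<in>#M. 1 / (of_real t - of_real a)))"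
    using nz by (simp add: pderiv_smult poly_pderiv_rp)
  also have "(\<Sum>a\<in>#M. 1 / (of_real t - of_real a)) = complex_of_real (\<Sum>a\<in>#M. 1 / (t - a))"
    by (rule of_real_sum_mset_inverse)
  finally show 1: "pd j F (cx (x(j := x j + t))) = F (cx (x(j := x j + t))) * of_real (\<Sum>a\<in>#M. 1 / (t - a))"
    by (simp only: 2 mult.assoc)
  show "Phi j F (x(j := x j + t)) = (\<Sum>a\<in>#M. 1 / (t - a))"
    unfolding Phi_def 1 using 2 3 c by simp
qed

lemma Phi_nonneg:
  assumes "stable_form m d F" "above_roots m F x" "j \<in> {1..m}"
  shows "Phi j F x \<ge> 0"
proof -
  obtain c M where "c \<noteq> 0" "\<And>a. a \<in># M \<Longrightarrow> a < 0"
    "\<And>s. F ((cx x)(j := of_real (x j) + s)) = c * poly (rp M) s"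
    using axis_roots[OF assms] by blast
  from Phi_axis(4)[OF stable_formD(1)[OF assms(1)] this, of 0]
  have "Phi j F x = (\<Sum>a\<in>#M. 1 / (0 - a))" by simp
  also have "\<dots> \<ge> 0" using \<open>\<And>a. a \<in># M \<Longrightarrow> a < 0\<close>
  proof (induction M)
    case (add a M)
    have "1 / (0 - a) \<ge> 0" using add.prems[of a] by simp
    moreover have "(\<Sum>a\<in>#M. 1 / (0 - a)) \<ge> 0" using add by simp
    ultimately show ?case by (simp only: image_mset_add_mset sum_mset.add_mset add_nonneg_nonneg)
  qed simp
  finally show ?thesis .
qed

text \<open>For Im s > 0 the point has one nonreal coordinate, the j-th; moving from it along axis
  \<open>i\<close> meets no zero with Im t > 0 by \<open>stable_boundary\<close>, so the logarithmic
  derivative in direction \<open>i\<close> has imaginary part <= 0. \<open>Phi_nonneg\<close> on the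
  positive ray makes the polynomial part constant.\<close>

lemma barrier_partial_fractions:
  assumes F: "stable_form m d F" and x: "above_roots m F x" and i: "i \<in> {1..m}" and j: "j \<in> {1..m}"
    and c: "c \<noteq> 0" and M: "\<And>a. a \<in># M \<Longrightarrow> a < 0"
    and eq: "\<And>s. F ((cx x)(j := of_real (x j) + s)) = c * poly (rp M) s"
  shows "\<exists>c0 (k :: real \<Rightarrow> real). (\<forall>a. k a \<ge> 0) \<and>
    (\<forall>s. pd i F ((cx x)(j := of_real (x j) + s)) =
      poly (smult c (smult c0 (rp M) + (\<Sum>a\<in>set_mset M. smult (of_real (k a)) (rp (M - {#a#}))))) s)"
proof -
  note F' = stable_formD[OF F]
  obtain q where q: "\<And>s. pd i F ((cx x)(j := of_real (x j) + s)) = poly q s"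
    using polyfun_axis[OF polyfun_pd[OF F'(1)], of i "cx x" j] by (auto simp: cx_def)
  have "Im (poly (smult (1 / c) q) s / poly (rp M) s) \<le> 0" if s: "Im s > 0" for s
  proof -
    define z where "z = (cx x)(j := of_real (x j) + s)"
    have Fz: "F z \<noteq> 0" using c s poly_rp_upper_nz[of s M] by (simp add: z_def eq)
    obtain p where p: "\<And>t. F (z(i := z i + t)) = poly p t" using polyfun_axis[OF F'(1)] by blast
    have p0: "poly p 0 = F z" using p[of 0] by simp
    have "poly p t \<noteq> 0" if "Im t > 0" for t
    proof -
      have "F (\<lambda>l. z l + t * of_real (if l = i then 1 else 0)) \<noteq> 0"
        by (rule stable_boundary[OF F'(1,3) _ _ Fz _ _ that])
          (use s j i in \<open>auto simp: z_def cx_def\<close>)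
      moreover have "(\<lambda>l. z l + t * of_real (if l = i then 1 else 0)) = z(i := z i + t)" by auto
      ultimately show ?thesis by (simp flip: p)
    qed
    then have "Im (poly (pderiv p) 0 / poly p 0) \<le> 0"
      using log_deriv_Im_le[of p 0] p0 Fz by simp
    also have "poly (pderiv p) 0 = poly q s"
      using polyfun_line_pd[OF F'(1) p, of 0] q[of s] by (simp add: z_def[symmetric])
    also have "poly p 0 = c * poly (rp M) s" by (simp add: p0 z_def eq)
    finally show ?thesis by (simp add: field_simps)
  qed
  moreover have "Re (poly (smult (1 / c) q) (of_real t) / poly (rp M) (of_real t)) \<ge> 0" if t: "0 < t" for t :: real
  proof -
    have "Phi i F (x(j := x j + t)) \<ge> 0"
      using t by (intro Phi_nonneg[OF F _ i] above_roots_upd x j) simp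
    then show ?thesis using q[of "of_real t"] eq[of "of_real t"]
      by (simp add: Phi_def cx_upd)
  qed
  ultimately obtain c0 k where k: "\<And>a. k a \<ge> 0" and
    "smult (1 / c) q = smult c0 (rp M) + (\<Sum>a\<in>set_mset M. smult (of_real (k a)) (rp (M - {#a#})))"
    using pick_partial_fractions_const[of "smult (1 / c) q" M] by blast
  then have "q = smult c (smult c0 (rp M) + (\<Sum>a\<in>set_mset M. smult (of_real (k a)) (rp (M - {#a#}))))"
    using c by (metis smult_smult nonzero_eq_divide_eq mult.commute smult_1_left)
  then show ?thesis using k q by (intro exI[of _ c0] exI[of _ k]) simp
qed

lemma partial_fractions_value:
  assumes "poly (rp M) z \<noteq> 0"
  shows "poly (smult c0 (rp M) + (\<Sum>a\<in>set_mset M. smult (of_real (k a)) (rp (M - {#a#})))) z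
    = poly (rp M) z * (c0 + (\<Sum>a\<in>set_mset M. of_real (k a) / (z - of_real a)))"
proof -
  have "of_real (k a) * poly (rp (M - {#a#})) z = poly (rp M) z * (of_real (k a) / (z - of_real a))"
    if "a \<in># M" for a
    using poly_rp_remove[OF that, of z] assms by auto
  then show ?thesis
    by (simp add: poly_sum distrib_left sum_distrib_left mult.commute[of c0])
qed

text \<open>In the partial fraction form each term k_a / (s - a), with a < 0 and k_a >= 0, decreases
  in s >= 0.\<close>

lemma Phi_mono_axis:
  assumes F: "stable_form m d F" and x: "above_roots m F x" and i: "i \<in> {1..m}" and j: "j \<in> {1..m}" and t: "t \<ge> 0"
  shows "Phi i F (x(j := x j + t)) \<le> Phi i F x"
proof -
  obtain c M where cM: "c \<noteq> 0" "\<And>a. a \<in># M \<Longrightarrow> a < 0"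
    "\<And>s. F ((cx x)(j := of_real (x j) + s)) = c * poly (rp M) s"
    using axis_roots[OF F x j] by blast
  obtain c0 and k :: "real \<Rightarrow> real" where k: "\<And>a. k a \<ge> 0"
    and q: "\<And>s. pd i F ((cx x)(j := of_real (x j) + s)) =
      poly (smult c (smult c0 (rp M) + (\<Sum>a\<in>set_mset M. smult (of_real (k a)) (rp (M - {#a#}))))) s"
    using barrier_partial_fractions[OF F x i j cM] by blast
  have val: "Phi i F (x(j := x j + s)) = Re c0 + (\<Sum>a\<in>set_mset M. k a / (s - a))" if "s \<ge> 0" for s
  proof -
    note nz = Phi_axis(3)[OF stable_formD(1)[OF F] cM that]
    have "pd i F (cx (x(j := x j + s))) / F (cx (x(j := x j + s)))
        = c0 + of_real (\<Sum>a\<in>set_mset M. k a / (s - a))"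
      using cM(1) nz partial_fractions_value[OF nz, of c0 k]
      by (simp add: cx_upd q cM(3))
    then show ?thesis by (simp add: Phi_def)
  qed
  have "(\<Sum>a\<in>set_mset M. k a / (t - a)) \<le> (\<Sum>a\<in>set_mset M. k a / (0 - a))"
  proof (intro sum_mono)
    fix a assume "a \<in> set_mset M"
    then have "a < 0" using cM(2) by simp
    then show "k a / (t - a) \<le> k a / (0 - a)" using k t by (intro divide_left_mono mult_pos_pos) auto
  qed
  then show ?thesis using val[OF t] val[of 0] by simp
qed

lemma Phi_mono:
  assumes F: "stable_form m d F" and x: "above_roots m F x" and i: "i \<in> {1..m}"
    and y: "\<And>j. j \<in> {1..m} \<Longrightarrow> y j \<ge> 0" "\<And>j. j \<notin> {1..m} \<Longrightarrow> y j = 0"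
  shows "Phi i F (\<lambda>l. x l + y l) \<le> Phi i F x"
proof -
  have "Phi i F (\<lambda>l. x l + (if l \<in> S then y l else 0)) \<le> Phi i F x" if "finite S" "S \<subseteq> {1..m}" for S
    using that
  proof (induction S rule: finite_induct)
    case empty
    show ?case by simp
  next
    case (insert j S)
    let ?x = "\<lambda>l. x l + (if l \<in> S then y l else 0)"
    have "above_roots m F ?x" using above_roots_plus[OF x, of "\<lambda>l. if l \<in> S then y l else 0"] y insert by auto
    moreover have "(\<lambda>l. x l + (if l \<in> insert j S then y l else 0)) = ?x(j := ?x j + y j)"
      using insert by auto
    ultimately have "Phi i F (\<lambda>l. x l + (if l \<in> insert j S then y l else 0)) \<le> Phi i F ?x"
      using Phi_mono_axis[OF F _ i, of ?x j "y j"] y insert by simp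
    then show ?case using insert by simp
  qed
  moreover have "(\<lambda>l. x l + (if l \<in> {1..m} then y l else 0)) = (\<lambda>l. x l + y l)"
    using y(2) by auto
  ultimately show ?thesis by (metis finite_atLeastAtMost order_refl)
qed

text \<open>With \<phi> the j-th barrier of \<open>F\<close> at the shifted point, the new i-th
  barrier is that of \<open>F\<close> there minus its j-th derivative divided by 1 - \<phi>. In
  partial fractions the pole \<open>a\<close> thus contributes k_a times 1/(\<delta> - a) +
  1/((\<delta> - a)^2 (1 - \<phi>)), against k_a / (-a) at the old point. The comparison of these
  two factors is equivalent to \<open>cond\<close> for that \<open>a\<close>. Only one copy of
  \<open>a\<close> is removed in \<open>cond\<close>.\<close>

lemma barrier_step:
  assumes F: "stable_form m d F" and x: "above_roots m F x" and j: "j \<in> {1..m}"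
    and c: "c \<noteq> 0" and M: "\<And>a. a \<in># M \<Longrightarrow> a < 0"
    and eq: "\<And>s. F ((cx x)(j := of_real (x j) + s)) = c * poly (rp M) s"
    and xm: "x (m + j) = 1" and \<delta>: "\<delta> > 0" and less1: "(\<Sum>a\<in>#M. 1 / (\<delta> - a)) < 1"
    and cond: "\<And>a. a \<in># M \<Longrightarrow> (\<Sum>b\<in>#M - {#a#}. \<delta> / (\<delta> - b)) \<le> \<delta> - 1"
  shows "above_roots m (diff_op m j F) (x(j := x j + \<delta>))"
    and "\<And>i. i \<in> {1..m} \<Longrightarrow> Phi i (diff_op m j F) (x(j := x j + \<delta>)) \<le> Phi i F x"
proof -
  note F' = stable_formD[OF F]
  define x' where "x' = x(j := x j + \<delta>)"
  have x': "above_roots m F x'" unfolding x'_def using \<delta> by (intro above_roots_upd x j) simp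
  note ax = Phi_axis[OF F'(1) c M eq less_imp_le[OF \<delta>], folded x'_def]
  show "above_roots m (diff_op m j F) (x(j := x j + \<delta>))"
    unfolding above_roots_def x'_def[symmetric]
  proof (intro allI impI)
    fix y :: "nat \<Rightarrow> real"
    assume y: "\<forall>j\<in>{1..m}. y j \<ge> 0" "\<forall>j. j \<notin> {1..m} \<longrightarrow> y j = 0"
    define x'' where "x'' i = x' i + y i" for i
    have "Phi j F x'' \<le> Phi j F x'" unfolding x''_def using y by (intro Phi_mono[OF F x' j]) auto
    then have "Phi j F x'' < 1" using less1 ax(4) by simp
    moreover have "F (cx x'') \<noteq> 0" using x' y unfolding above_roots_def x''_def[abs_def] by blast
    moreover have "x'' (m + j) = 1" using xm y j by (simp add: x''_def x'_def)
    ultimately have "diff_op m j F (cx x'') \<noteq> 0" by (auto simp: diff_op_def Phi_def cx_def[of x'' "m + j"])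
    then show "diff_op m j F (cx (\<lambda>i. x' i + y i)) \<noteq> 0" by (simp add: x''_def[abs_def])
  qed
  fix i assume i: "i \<in> {1..m}"
  obtain c0 and k :: "real \<Rightarrow> real" where k: "\<And>a. k a \<ge> 0"
    and q: "\<And>s. pd i F ((cx x)(j := of_real (x j) + s)) =
      poly (smult c (smult c0 (rp M) + (\<Sum>a\<in>set_mset M. smult (of_real (k a)) (rp (M - {#a#}))))) s"
    using barrier_partial_fractions[OF F x i j c M eq] by blast
  define \<phi> where "\<phi> = (\<Sum>a\<in>#M. 1 / (\<delta> - a))"
  have remove: "(\<Sum>b\<in>#M - {#a#}. 1 / (\<delta> - b)) = \<phi> - 1 / (\<delta> - a)" if a: "a \<in># M" for a
  proof -
    obtain M' where "M = add_mset a M'" using multi_member_split[OF a] by blast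
    then show ?thesis by (simp add: \<phi>_def)
  qed
  define R where "R = poly (rp M) (of_real \<delta>)"
  define S1 where "S1 = (\<Sum>a\<in>set_mset M. k a / (\<delta> - a))"
  define S2 where "S2 = (\<Sum>a\<in>set_mset M. k a / (\<delta> - a)\<^sup>2)"
  have pi: "pd i F (cx x') = c * (R * (c0 + of_real S1))"
    using partial_fractions_value[OF ax(3), of c0 k] q[of "of_real \<delta>"]
    by (simp add: x'_def cx_upd R_def S1_def)
  have pji: "pd j (pd i F) (cx x') = c * (R * (of_real \<phi> * (c0 + of_real S1) - of_real S2))"
  proof -
    have "pd j (pd i F) (cx x') = poly (pderiv (smult c (smult c0 (rp M) +
        (\<Sum>a\<in>set_mset M. smult (of_real (k a)) (rp (M - {#a#})))))) (of_real \<delta>)"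
      using polyfun_line_pd[OF polyfun_pd[OF F'(1)], of i "cx x" j _ "of_real \<delta>"] q
      by (simp add: x'_def cx_upd cx_def[of x j])
    also have "\<dots> = c * (c0 * poly (pderiv (rp M)) (of_real \<delta>) +
        (\<Sum>a\<in>set_mset M. of_real (k a) * poly (pderiv (rp (M - {#a#}))) (of_real \<delta>)))"
      by (simp add: pderiv_smult pderiv_add higher_pderiv_sum[where n = 1, simplified] poly_sum)
    also have "poly (pderiv (rp M)) (of_real \<delta>) = R * of_real \<phi>"
    proof -
      have "pd j F (cx x') = poly (pderiv (smult c (rp M))) (of_real \<delta>)"
        using polyfun_line_pd[OF F'(1), of "cx x" j "smult c (rp M)" "of_real \<delta>"] eq
        by (simp add: cx_upd x'_def cx_def[of x j])
      then show ?thesis using ax(1,2) c by (simp add: pderiv_smult R_def \<phi>_def)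
    qed
    also have "(\<Sum>a\<in>set_mset M. of_real (k a) * poly (pderiv (rp (M - {#a#}))) (of_real \<delta>))
        = (\<Sum>a\<in>set_mset M. R * (of_real \<phi> * of_real (k a / (\<delta> - a)) - of_real (k a / (\<delta> - a)\<^sup>2)))"
    proof (intro sum.cong refl)
      fix a assume a: "a \<in> set_mset M"
      define g where "g = \<delta> - a"
      have nz: "g \<noteq> 0" using M a \<delta> by (force simp: g_def)
      have "poly (pderiv (rp (M - {#a#}))) (of_real \<delta>) =
          poly (rp (M - {#a#})) (of_real \<delta>) * (\<Sum>b\<in>#M - {#a#}. 1 / (of_real \<delta> - of_real b))"
        using M \<delta> by (intro poly_pderiv_rp) (fastforce dest: in_diffD)
      also have "(\<Sum>b\<in>#M - {#a#}. 1 / (of_real \<delta> - of_real b)) = complex_of_real (\<Sum>b\<in>#M - {#a#}. 1 / (\<delta> - b))"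
        by (rule of_real_sum_mset_inverse)
      also have "(\<Sum>b\<in>#M - {#a#}. 1 / (\<delta> - b)) = \<phi> - 1 / (\<delta> - a)"
        using remove a by simp
      also have "poly (rp (M - {#a#})) (of_real \<delta>) = R / of_real (\<delta> - a)"
        using poly_rp_remove[of a M "of_real \<delta>"] a nz by (simp add: R_def g_def flip: of_real_diff)
      finally have D: "poly (pderiv (rp (M - {#a#}))) (of_real \<delta>) = R / of_real g * of_real (\<phi> - 1 / g)"
        by (simp only: g_def)
      show "of_real (k a) * poly (pderiv (rp (M - {#a#}))) (of_real \<delta>) =
          R * (of_real \<phi> * of_real (k a / (\<delta> - a)) - of_real (k a / (\<delta> - a)\<^sup>2))"
        using nz unfolding D g_def[symmetric] by (simp add: field_simps power2_eq_square)
    qed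
    also have "\<dots> = R * (of_real \<phi> * of_real S1 - of_real S2)"
      unfolding S1_def S2_def of_real_sum sum_distrib_left sum_subtractf[symmetric] ..
    finally show ?thesis by (simp add: algebra_simps)
  qed
  have xm': "cx x' (m + j) = 1" using xm j by (simp add: cx_def x'_def)
  have "i \<noteq> m + j" using i j by auto
  then have "pd i (diff_op m j F) (cx x') = pd i F (cx x') - pd j (pd i F) (cx x')"
    using xm' pd_commute[OF F'(1), of i j] by (simp add: pd_diff_op[OF F'(1)])
  also have "\<dots> = c * R * ((1 - of_real \<phi>) * (c0 + of_real S1) + of_real S2)"
    by (simp add: pi pji algebra_simps)
  finally have num: "pd i (diff_op m j F) (cx x') = c * R * ((1 - of_real \<phi>) * (c0 + of_real S1) + of_real S2)" .
  have den: "diff_op m j F (cx x') = c * R * (1 - of_real \<phi>)"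
    using xm' ax(1,2) by (simp add: diff_op_def R_def \<phi>_def[symmetric] algebra_simps)
  have \<phi>1: "\<phi> < 1" using less1 by (simp add: \<phi>_def)
  then have "1 - complex_of_real \<phi> \<noteq> 0" by (metis eq_iff_diff_eq_0 less_irrefl of_real_1 of_real_eq_iff)
  then have "pd i (diff_op m j F) (cx x') / diff_op m j F (cx x') = c0 + of_real (S1 + S2 / (1 - \<phi>))"
    unfolding num den using c ax(3) by (simp add: field_simps R_def)
  then have "Phi i (diff_op m j F) x' = Re c0 + S1 + S2 / (1 - \<phi>)" by (simp add: Phi_def)
  also have "\<dots> = Re c0 + (\<Sum>a\<in>set_mset M. k a * (1 / (\<delta> - a) + 1 / ((\<delta> - a)\<^sup>2 * (1 - \<phi>))))"
    by (simp add: S1_def S2_def sum_divide_distrib distrib_left sum.distrib)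
  also have "\<dots> \<le> Re c0 + (\<Sum>a\<in>set_mset M. k a * (1 / (0 - a)))"
  proof (intro add_left_mono sum_mono mult_left_mono k)
    fix a assume a: "a \<in> set_mset M"
    define g where "g = \<delta> - a"
    have g: "g > 0" "a < 0" using M[of a] a \<delta> by (auto simp: g_def)
    \<comment> \<open>Putting the missing pole back turns \<open>cond\<close> into a lower bound for
      1 - \<phi>, the only quantity here that involves the other poles.\<close>
    have "(\<Sum>b\<in>#M - {#a#}. \<delta> / (\<delta> - b)) = \<delta> * (\<phi> - 1 / g)"
      using a unfolding g_def by (subst remove[symmetric]) (simp_all add: sum_mset_distrib_left)
    then have "\<delta> * (1 - \<phi>) \<ge> 1 - \<delta> / g" using cond[of a] a by (simp add: algebra_simps)
    also have "1 - \<delta> / g = - a / g" using g by (simp add: g_def field_simps)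
    finally have "- a / g \<le> \<delta> * (1 - \<phi>)" .
    then have "1 / (g\<^sup>2 * (1 - \<phi>)) \<le> \<delta> / (g * - a)"
    proof -
      define X Y where "X = g\<^sup>2 * (1 - \<phi>)" and "Y = g * - a"
      have XY: "X > 0" "Y > 0" using g \<phi>1 by (auto simp: X_def Y_def mult_pos_neg)
      have "g\<^sup>2 * (- a / g) \<le> g\<^sup>2 * (\<delta> * (1 - \<phi>))"
        using \<open>- a / g \<le> _\<close> by (intro mult_left_mono) auto
      then have "Y \<le> \<delta> * X" using g by (simp add: X_def Y_def power2_eq_square mult_ac)
      then have "1 / X \<le> \<delta> / Y" using XY by (simp add: field_simps)
      then show ?thesis by (simp add: X_def Y_def)
    qed
    also have "\<delta> / (g * - a) = 1 / (0 - a) - 1 / g" using g by (simp add: g_def field_simps)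
    finally show "1 / (\<delta> - a) + 1 / ((\<delta> - a)\<^sup>2 * (1 - \<phi>)) \<le> 1 / (0 - a)" by (simp add: g_def)
  qed
  also have "\<dots> = Phi i F x"
  proof -
    have nz: "poly (rp M) (of_real 0) \<noteq> 0" using Phi_axis(3)[OF F'(1) c M eq order_refl] .
    have "pd i F (cx x) / F (cx x) = c0 + of_real (\<Sum>a\<in>set_mset M. k a / (0 - a))"
      using partial_fractions_value[OF nz, of c0 k] q[of 0] eq[of 0] c nz fun_upd_triv[of "cx x" j]
      by (simp add: cx_def[of x j])
    then show ?thesis by (simp add: Phi_def)
  qed
  finally show "Phi i (diff_op m j F) (x(j := x j + \<delta>)) \<le> Phi i F x" by (simp add: x'_def)
qed

section \<open>Barrier points in the hyperbolicity cone\<close>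

text \<open>In terms of k = 1/(-a) the summand is k / (1 + \<delta> k), which is concave, so by
  Jensen the extremal case is n equal values l = 1/(n \<mu>).\<close>

lemma sum_inverse_bound:
  fixes M :: "real multiset"
  assumes M: "\<And>a. a \<in># M \<Longrightarrow> a < 0" and n: "size M \<le> n" "n \<ge> 1" and pos: "\<delta> > 0" "\<mu> > 0"
    and sum: "(\<Sum>a\<in>#M. 1 / (0 - a)) \<le> 1 / \<mu>"
  shows "(\<Sum>a\<in>#M. 1 / (\<delta> - a)) \<le> 1 / (\<mu> + \<delta> / n)"
proof -
  define l where "l = 1 / (n * \<mu>)"
  define D where "D = 1 + \<delta> * l"
  have l: "l > 0" using n pos by (simp add: l_def)
  have D: "D > 1" using l pos by (simp add: D_def)
  \<comment> \<open>The tangent line of k / (1 + \<delta> k) at k = l; the gap is an explicit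
    square.\<close>
  have tangent: "1 / (\<delta> - a) \<le> (l / D - l / D\<^sup>2) + 1 / (0 - a) / D\<^sup>2" if "a < 0" for a
  proof -
    define k where "k = 1 / (0 - a)"
    have k: "k > 0" using that by (simp add: k_def)
    have E: "1 + \<delta> * k > 0" using k pos by (simp add: add_pos_pos)
    have "1 / (\<delta> - a) = k / (1 + \<delta> * k)"
      using that pos by (simp add: k_def divide_simps add_pos_pos)
    moreover have "(l / D - l / D\<^sup>2) + k / D\<^sup>2 - k / (1 + \<delta> * k)
        = \<delta> * (k - l)\<^sup>2 / (D\<^sup>2 * (1 + \<delta> * k))"
    proof -
      have "((l * D - l + k) * (1 + \<delta> * k) - k * D\<^sup>2) = \<delta> * (k - l)\<^sup>2"
        by (simp add: D_def power2_eq_square algebra_simps)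
      moreover have "(l / D - l / D\<^sup>2) + k / D\<^sup>2 - k / (1 + \<delta> * k)
          = ((l * D - l + k) * (1 + \<delta> * k) - k * D\<^sup>2) / (D\<^sup>2 * (1 + \<delta> * k))"
        using D E by (simp add: divide_simps power2_eq_square)
      ultimately show ?thesis by simp
    qed
    moreover have "\<delta> * (k - l)\<^sup>2 / (D\<^sup>2 * (1 + \<delta> * k)) \<ge> 0" using pos E by simp
    ultimately show ?thesis by (simp add: k_def)
  qed
  have "(\<Sum>a\<in>#M. 1 / (\<delta> - a)) \<le> size M * (l / D - l / D\<^sup>2) + (\<Sum>a\<in>#M. 1 / (0 - a)) / D\<^sup>2"
    using M
  proof (induction M)
    case (add a M)
    have "(\<Sum>a\<in>#M. 1 / (\<delta> - a)) \<le> size M * (l / D - l / D\<^sup>2) + (\<Sum>a\<in>#M. 1 / (0 - a)) / D\<^sup>2"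
      using add by simp
    with tangent[of a] add.prems[of a]
    have "1 / (\<delta> - a) + (\<Sum>a\<in>#M. 1 / (\<delta> - a)) \<le>
        Suc (size M) * (l / D - l / D\<^sup>2) + (1 / (0 - a) + (\<Sum>a\<in>#M. 1 / (0 - a))) / D\<^sup>2"
      unfolding add_divide_distrib of_nat_Suc distrib_right by simp
    then show ?case by (simp only: image_mset_add_mset sum_mset.add_mset size_add_mset)
  qed simp
  also have "\<dots> \<le> n * (l / D - l / D\<^sup>2) + 1 / \<mu> / D\<^sup>2"
  proof (intro add_mono mult_right_mono divide_right_mono sum)
    \<comment> \<open>The tangent has a nonnegative intercept, so fewer than \<open>n\<close> roots
      can only lower the bound.\<close>
    have "l / D\<^sup>2 \<le> l / D" using l D by (intro divide_left_mono) (auto simp: power2_eq_square)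
    then show "0 \<le> l / D - l / D\<^sup>2" by simp
  qed (use n D in auto)
  also have "\<dots> = n * l / D"
    using n pos by (simp add: l_def algebra_simps)
  also have "\<dots> = 1 / (\<mu> + \<delta> / n)"
    using n pos D by (simp add: l_def D_def divide_simps add_pos_pos) (simp add: algebra_simps)
  finally show ?thesis .
qed

text \<open>Bernoulli's inequality for (1 + 1/a)^k without the division. It bounds the quotient in
  U_r from below by 1/(1 + q + q/k), the Jensen value for k = r - 1 roots.\<close>

lemma power_diff_ge:
  fixes a :: real
  assumes "a \<ge> 0"
  shows "a * ((1 + a) ^ k - a ^ k) \<ge> k * a ^ k"
proof (induction k)
  case (Suc k)
  have "a * ((1 + a) ^ Suc k - a ^ Suc k) = (1 + a) * (a * ((1 + a) ^ k - a ^ k)) + a * a ^ k"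
    by (simp add: algebra_simps)
  also have "\<dots> \<ge> (1 + a) * (k * a ^ k) + a * a ^ k"
    using Suc assms by (intro add_right_mono mult_left_mono) auto
  also have "(1 + a) * (k * a ^ k) + a * a ^ k \<ge> Suc k * a ^ Suc k"
    using assms by (simp add: algebra_simps)
  finally show ?case .
qed simp

text \<open>Translates membership in U_r into the hypotheses of \<open>barrier_step\<close>. Jensen
  with \<open>r\<close> roots gives a sum of at most 1/(\<mu> + \<delta>/r) < 1. For the second
  claim the term of \<open>a\<close> is dropped from the initial barrier and Jensen is used with the
  remaining r - 1 roots.\<close>

lemma U_set_barrier:
  fixes M :: "real multiset"
  assumes U: "(\<delta>, \<mu>) \<in> U_set r" and r: "r \<ge> 1" and M: "\<And>a. a \<in># M \<Longrightarrow> a < 0" and size: "size M \<le> r"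
    and sum: "(\<Sum>a\<in>#M. 1 / (0 - a)) \<le> 1 / \<mu>"
  shows "(\<Sum>a\<in>#M. 1 / (\<delta> - a)) < 1"
    and "\<And>a. a \<in># M \<Longrightarrow> (\<Sum>b\<in>#M - {#a#}. \<delta> / (\<delta> - b)) \<le> \<delta> - 1"
proof -
  define q where "q = \<delta> / (real r * \<mu>)"
  have pos: "\<delta> > 0" "\<mu> > 0"
    and Uq: "\<delta> / \<mu> * (((1 + q) ^ (r - 1) - q ^ (r - 1)) / ((1 + q) ^ r - q ^ r)) \<le> \<delta> - 1"
    and alt: "\<mu> > 1 \<or> \<mu> > 1 - \<delta> / r"
    using U by (auto simp: U_set_def q_def)
  have q: "q > 0" using pos r by (simp add: q_def)
  have "\<mu> + \<delta> / r > 1" using alt pos r by (auto simp: add_pos_pos intro: less_le_trans)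
  then have "1 / (\<mu> + \<delta> / r) < 1" by simp
  then show "(\<Sum>a\<in>#M. 1 / (\<delta> - a)) < 1"
    using sum_inverse_bound[OF M size r pos sum] by linarith
  fix a assume a: "a \<in># M"
  obtain M' where M': "M = add_mset a M'" using multi_member_split[OF a] by blast
  show "(\<Sum>b\<in>#M - {#a#}. \<delta> / (\<delta> - b)) \<le> \<delta> - 1"
  proof (cases "r = 1")
    \<comment> \<open>Kept apart because the general case divides by r - 1. No other root remains,
      and the inequality of U_r reads \<delta> >= 1.\<close>
    case True
    then have "M' = {#}" using size M' by simp
    then show ?thesis using Uq True by (simp add: M')
  next
    case False
    define k where "k = r - 1"
    have k: "k \<ge> 1" "r = Suc k" using r False by (auto simp: k_def)
    have "(\<Sum>b\<in>#M'. 1 / (\<delta> - b)) \<le> 1 / (\<mu> + \<delta> / k)"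
    proof (rule sum_inverse_bound[OF _ _ k(1) pos])
      show "(\<Sum>a\<in>#M'. 1 / (0 - a)) \<le> 1 / \<mu>"
      proof -
        have "1 / (0 - a) \<ge> 0" using M[OF a] by simp
        moreover have "(\<Sum>a\<in>#M. 1 / (0 - a)) = 1 / (0 - a) + (\<Sum>a\<in>#M'. 1 / (0 - a))"
          by (simp only: M' image_mset_add_mset sum_mset.add_mset)
        ultimately show ?thesis using sum by linarith
      qed
    qed (use M size k M' in auto)
    then have "\<delta> * (\<Sum>b\<in>#M'. 1 / (\<delta> - b)) \<le> \<delta> * (1 / (\<mu> + \<delta> / k))"
      using pos by (intro mult_left_mono) auto
    also have "\<dots> = \<delta> / \<mu> * (1 / (1 + q + q / k))"
    proof -
      have "\<mu> * (1 + q + q / k) = \<mu> + \<delta> / k"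
      proof -
        have "q + q / k = q * ((real k + 1) / k)" using k(1) by (simp add: field_simps)
        also have "real k + 1 = r" using k by simp
        also have "q * (r / k) = \<delta> / \<mu> / k" using r by (simp add: q_def)
        finally have *: "q + q / k = \<delta> / \<mu> / k" .
        show ?thesis using pos unfolding add.assoc * by (simp add: distrib_left)
      qed
      then show ?thesis by (simp add: field_simps)
    qed
    also have "\<dots> \<le> \<delta> / \<mu> * (((1 + q) ^ k - q ^ k) / ((1 + q) ^ Suc k - q ^ Suc k))"
    proof (intro mult_left_mono)
      define D where "D = (1 + q) ^ k - q ^ k"
      define E where "E = (1 + q) ^ Suc k - q ^ Suc k"
      have E: "E = (1 + q) * D + q ^ k" by (simp add: E_def D_def algebra_simps)
      have "D \<ge> 0" using q by (simp add: D_def power_mono)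
      then have Epos: "E > 0" using q by (simp add: E add_nonneg_pos)
      have "q * D / k \<ge> q ^ k" using power_diff_ge[of q k] q k by (simp add: D_def field_simps)
      then have "E \<le> D * (1 + q + q / k)" by (simp add: E algebra_simps)
      moreover have "1 + q + q / k > 0" using q by (simp add: add_pos_nonneg)
      ultimately have "1 / (1 + q + q / k) \<le> D / E" using Epos by (simp add: divide_simps mult.commute)
      then show "1 / (1 + q + q / k) \<le> ((1 + q) ^ k - q ^ k) / ((1 + q) ^ Suc k - q ^ Suc k)"
        by (simp only: D_def E_def)
    qed (use pos in auto)
    also have "\<dots> \<le> \<delta> - 1" using Uq k by simp
    finally show ?thesis by (simp add: M' sum_mset_distrib_left)
  qed
qed

text \<open>The degree in \<open>z\<^sub>j\<close> is at most \<open>r\<close>, tested by a derivative so that other derivatives preserve it.\<close>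

definition deg_le :: "nat \<Rightarrow> nat \<Rightarrow> nat \<Rightarrow> ((nat \<Rightarrow> complex) \<Rightarrow> complex) \<Rightarrow> bool" where
  "deg_le m r j F \<longleftrightarrow> (\<forall>x. (\<forall>i\<in>{1..m}. x i > 0) \<longrightarrow> (pd j ^^ Suc r) F (cx x) = 0)"

lemma poly_eq_0_nonneg:
  fixes p :: "complex poly"
  assumes "\<And>s::real. s \<ge> 0 \<Longrightarrow> poly p (of_real s) = 0"
  shows "p = 0"
proof (rule ccontr)
  assume "p \<noteq> 0"
  then have "finite {z. poly p z = 0}" by (rule poly_roots_finite)
  moreover have "complex_of_real ` {0..} \<subseteq> {z. poly p z = 0}" using assms by auto
  ultimately have "finite (complex_of_real ` {0..})" by (rule finite_subset[rotated])
  then show False by (simp add: finite_image_iff inj_on_def infinite_Ici)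
qed

lemma polyfun_pd_funpow: "polyfun F \<Longrightarrow> polyfun ((pd j ^^ n) F)"
  by (induction n) (auto intro: polyfun_pd)

lemma pd_funpow_diff_op:
  assumes "polyfun F" "j \<noteq> m + i"
  shows "(pd j ^^ n) (diff_op m i F) = diff_op m i ((pd j ^^ n) F)"
proof (induction n)
  case (Suc n)
  have G: "polyfun ((pd j ^^ n) F)" by (rule polyfun_pd_funpow[OF assms(1)])
  have "pd j (diff_op m i ((pd j ^^ n) F)) = diff_op m i (pd j ((pd j ^^ n) F))"
    unfolding pd_diff_op[OF G assms(2)] pd_commute[OF G, of j i] by (simp add: fun_eq_iff diff_op_def)
  then show ?case by (simp add: Suc)
qed simp

text \<open>The derivative of order r + 1 in z_j commutes with \<open>diff_op\<close> for
  \<open>i\<close>, and it vanishes along the ray from \<open>x\<close> in direction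
  \<open>i\<close>, which stays in the positive orthant; hence its derivative in z_i vanishes at
  \<open>x\<close> too.\<close>

lemma deg_le_diff_op:
  assumes F: "polyfun F" "deg_le m r j F" and ij: "i \<in> {1..m}" "j \<in> {1..m}"
  shows "deg_le m r j (diff_op m i F)"
  unfolding deg_le_def
proof (intro allI impI)
  fix x :: "nat \<Rightarrow> real" assume x: "\<forall>i\<in>{1..m}. x i > 0"
  define G where "G = (pd j ^^ Suc r) F"
  have G: "polyfun G" unfolding G_def by (rule polyfun_pd_funpow[OF F(1)])
  have zero: "G (cx x') = 0" if "\<forall>i\<in>{1..m}. x' i > 0" for x'
    using F(2) that unfolding deg_le_def G_def by blast
  obtain p where p: "\<And>s. G ((cx x)(i := cx x i + s)) = poly p s" using polyfun_axis[OF G] by blast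
  have "p = 0"
  proof (rule poly_eq_0_nonneg)
    fix s :: real assume "s \<ge> 0"
    then have "G (cx (x(i := x i + s))) = 0" using x by (intro zero) (auto simp: add_pos_nonneg)
    then show "poly p (of_real s) = 0" using p[of "of_real s"] by (simp add: cx_upd cx_def[of x i])
  qed
  then have "pd i G (cx x) = 0"
    using polyfun_line_pd[OF G p, of 0] by simp
  moreover have "j \<noteq> m + i" using ij by auto
  ultimately show "(pd j ^^ Suc r) (diff_op m i F) (cx x) = 0"
    using zero[OF x] unfolding pd_funpow_diff_op[OF F(1) \<open>j \<noteq> m + i\<close>] G_def[symmetric] by (simp add: diff_op_def)
qed

lemma pd_funpow_axis:
  assumes "polyfun F" "\<And>s. F (z(j := z j + s)) = poly p s"
  shows "(pd j ^^ n) F (z(j := z j + s)) = poly ((pderiv ^^ n) p) s"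
proof (induction n arbitrary: s)
  case (Suc n)
  show ?case using polyfun_line_pd[OF polyfun_pd_funpow[OF assms(1)] Suc]
    unfolding funpow.simps comp_apply .
qed (simp add: assms(2))

lemma deg_le_axis:
  assumes F: "polyfun F" "deg_le m r j F" and x: "\<forall>i\<in>{1..m}. x i > 0"
    and p: "\<And>s. F ((cx x)(j := of_real (x j) + s)) = poly p s"
  shows "degree p \<le> r"
proof (rule ccontr)
  assume "\<not> degree p \<le> r"
  have "(pderiv ^^ Suc r) p = 0"
  proof (rule poly_eq_0_nonneg)
    fix s :: real assume "s \<ge> 0"
    then have "(pd j ^^ Suc r) F (cx (x(j := x j + s))) = 0"
      using x F(2)[unfolded deg_le_def, rule_format, of "x(j := x j + s)"] by (auto simp: add_pos_nonneg)
    moreover have "(pd j ^^ Suc r) F ((cx x)(j := cx x j + of_real s)) = poly ((pderiv ^^ Suc r) p) (of_real s)"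
      by (rule pd_funpow_axis[OF F(1)]) (simp add: p cx_def[of x j])
    ultimately show "poly ((pderiv ^^ Suc r) p) (of_real s) = 0" by (simp add: cx_upd cx_def[of x j])
  qed
  then have "degree ((pderiv ^^ r) p) = 0" by (simp add: pderiv_eq_0_iff)
  then show False using \<open>\<not> degree p \<le> r\<close> by (simp add: degree_higher_pderiv)
qed

lemma deg_leI:
  assumes F: "polyfun F"
    and p: "\<And>x. (\<forall>i\<in>{1..m}. x i > 0) \<Longrightarrow>
      \<exists>p. degree p \<le> r \<and> (\<forall>s. F ((cx x)(j := of_real (x j) + s)) = poly p s)"
  shows "deg_le m r j F"
  unfolding deg_le_def
proof (intro allI impI)
  fix x :: "nat \<Rightarrow> real" assume "\<forall>i\<in>{1..m}. x i > 0"
  then obtain p where p: "degree p \<le> r" "\<And>s. F ((cx x)(j := of_real (x j) + s)) = poly p s"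
    using p by blast
  have "degree ((pderiv ^^ r) p) = 0" using p(1) by (simp add: degree_higher_pderiv)
  then have "(pderiv ^^ Suc r) p = 0" by (simp add: pderiv_eq_0_iff)
  then show "(pd j ^^ Suc r) F (cx x) = 0"
    using pd_funpow_axis[OF F, of "cx x" j p "Suc r" 0] p(2) fun_upd_triv[of "cx x" j]
    by (simp add: cx_def[of x j])
qed

text \<open>For the next variable, the barrier bound 1/\<mu> and \<open>deg_le\<close> are what
  \<open>U_set_barrier\<close> needs; both are carried along for the variables not yet processed.
  Leaving \<open>k\<close> out of the list therefore ends with the barrier in variable
  \<open>k\<close> still at most 1/\<mu>.\<close>

lemma barrier_list:
  assumes P: "stable_form m d P" and U: "(\<delta>, \<mu>) \<in> U_set r" and r: "r \<ge> 1"
    and x0: "above_roots m P x0" "\<forall>i\<in>{1..m}. x0 i > 0" "\<And>i. i \<in> {1..m} \<Longrightarrow> Phi i P x0 \<le> 1 / \<mu>"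
    and deg: "\<And>j. j \<in> {1..m} \<Longrightarrow> deg_le m r j P"
    and js: "distinct js" "set js \<subseteq> {1..m}" "\<And>j. j \<in> set js \<Longrightarrow> x0 (m + j) = 1"
  shows "stable_form m d (foldr (diff_op m) js P) \<and>
    above_roots m (foldr (diff_op m) js P) (\<lambda>i. x0 i + (if i \<in> set js then \<delta> else 0)) \<and>
    (\<forall>i\<in>{1..m} - set js. Phi i (foldr (diff_op m) js P) (\<lambda>i. x0 i + (if i \<in> set js then \<delta> else 0)) \<le> 1 / \<mu>) \<and>
    (\<forall>j\<in>{1..m} - set js. deg_le m r j (foldr (diff_op m) js P))"
  using js
proof (induction js)
  case Nil
  then show ?case using P x0 deg by simp
next
  case (Cons j js)
  define F where "F = foldr (diff_op m) js P"
  define x where "x i = x0 i + (if i \<in> set js then \<delta> else 0)" for i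
  have IH: "stable_form m d F" "above_roots m F x" "\<And>i. i \<in> {1..m} - set js \<Longrightarrow> Phi i F x \<le> 1 / \<mu>"
    "\<And>i. i \<in> {1..m} - set js \<Longrightarrow> deg_le m r i F"
    using Cons by (auto simp: F_def x_def[abs_def])
  have j: "j \<in> {1..m}" "j \<notin> set js" using Cons.prems by auto
  have \<delta>: "\<delta> > 0" using U by (simp add: U_set_def)
  obtain c M where cM: "c \<noteq> 0" "\<And>a. a \<in># M \<Longrightarrow> a < 0"
    "\<And>s. F ((cx x)(j := of_real (x j) + s)) = c * poly (rp M) s"
    using axis_roots[OF IH(1,2) j(1)] by blast
  have "\<forall>i\<in>{1..m}. x i > 0" using x0(2) \<delta> by (auto simp: x_def add_pos_nonneg)
  then have "degree (smult c (rp M)) \<le> r"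
    using cM(3) j by (intro deg_le_axis[OF stable_formD(1)[OF IH(1)] IH(4)[of j]]) auto
  then have size: "size M \<le> r" using cM(1) by simp
  have "Phi j F x = (\<Sum>a\<in>#M. 1 / (0 - a))"
    using Phi_axis(4)[OF stable_formD(1)[OF IH(1)] cM, of 0] by simp
  then have "(\<Sum>a\<in>#M. 1 / (0 - a)) \<le> 1 / \<mu>" using IH(3)[of j] j by simp
  note bar = U_set_barrier[OF U r cM(2) size this]
  have xm: "x (m + j) = 1" using Cons.prems j by (auto simp: x_def)
  have upd: "(\<lambda>i. x0 i + (if i \<in> set (j # js) then \<delta> else 0)) = x(j := x j + \<delta>)"
    using j by (auto simp: x_def)
  have fold: "foldr (diff_op m) (j # js) P = diff_op m j F" by (simp add: F_def)
  note step = barrier_step[OF IH(1,2) j(1) cM xm \<delta> bar]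
  show ?case
    unfolding upd fold
  proof (intro conjI ballI)
    show "stable_form m d (diff_op m j F)" by (rule stable_form_diff_op[OF IH(1) j(1)])
    show "above_roots m (diff_op m j F) (x(j := x j + \<delta>))" by (rule step(1))
    fix i assume i: "i \<in> {1..m} - set (j # js)"
    then show "Phi i (diff_op m j F) (x(j := x j + \<delta>)) \<le> 1 / \<mu>"
      using step(2)[of i] IH(3)[of i] by auto
    show "deg_le m r i (diff_op m j F)"
      using i by (intro deg_le_diff_op[OF stable_formD(1)[OF IH(1)] IH(4)] j) auto
  qed
qed

lemma polyfun_foldr_diff_op: "polyfun P \<Longrightarrow> polyfun (foldr (diff_op m) js P)"
  by (induction js) (auto intro: polyfun_diff_op)

lemma foldr_diff_op_remove1:
  assumes "polyfun P" "set js \<subseteq> {1..m}" "k \<in> set js"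
  shows "foldr (diff_op m) js P = diff_op m k (foldr (diff_op m) (remove1 k js) P)"
  using assms(2,3)
proof (induction js)
  case (Cons j js)
  show ?case
  proof (cases "j = k")
    case False
    then have "foldr (diff_op m) (j # js) P = diff_op m j (diff_op m k (foldr (diff_op m) (remove1 k js) P))"
      using Cons by simp
    also have "\<dots> = diff_op m k (diff_op m j (foldr (diff_op m) (remove1 k js) P))"
      using Cons.prems by (intro diff_op_commute polyfun_foldr_diff_op assms(1)) auto
    finally show ?thesis using False by simp
  qed simp
qed simp

lemma stable_form_foldr: "stable_form m d P \<Longrightarrow> set js \<subseteq> {1..m} \<Longrightarrow> stable_form m d (foldr (diff_op m) js P)"
  by (induction js) (auto intro: stable_form_diff_op)

text \<open>The barrier point that leaves out the \<open>k\<close>-th variable: the \<open>x\<close> part, then the \<open>y\<close> part.\<close>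

definition cone_pt :: "nat \<Rightarrow> real \<Rightarrow> real \<Rightarrow> real \<Rightarrow> nat \<Rightarrow> nat \<Rightarrow> real" where
  "cone_pt m t \<delta> \<mu> k i =
    (if i \<in> {1..m} then t + (if i = k then 0 else \<delta>)
     else if i \<in> {m+1..2*m} then (if i = m + k then \<mu> else 1) else 0)"

text \<open>With the operator of \<open>k\<close> moved to the outside, its value at y_k = \<mu>
  vanishes only where the k-th barrier of the rest equals 1/\<mu>. That barrier is at most 1/\<mu>
  at the cone point and strictly smaller after a shift by s > 0.\<close>

lemma cone_pt_nonzero:
  assumes P: "stable_form m d P" and U: "(\<delta>, \<mu>) \<in> U_set r" and r: "r \<ge> 1" and t: "t > 0"
    and above_roots: "\<And>x. \<forall>i\<in>{1..m}. x i > 0 \<Longrightarrow> above_roots m P x"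
    and Phi: "\<And>i x. i \<in> {1..m} \<Longrightarrow> \<forall>l\<in>{1..m}. x l = t \<Longrightarrow> Phi i P x \<le> 1 / \<mu>"
    and deg: "\<And>j. j \<in> {1..m} \<Longrightarrow> deg_le m r j P"
    and js: "distinct js" "set js = {1..m}" and k: "k \<in> {1..m}" and s: "s > 0"
  shows "foldr (diff_op m) js P (cx (\<lambda>i. cone_pt m t \<delta> \<mu> k i + s * (if i \<in> {1..m} then 1 else 0))) \<noteq> 0"
proof -
  define w where "w = cone_pt m t \<delta> \<mu> k"
  define F where "F = foldr (diff_op m) (remove1 k js) P"
  define x0 where "x0 i = (if i \<in> {1..m} then t else w i)" for i
  have \<mu>: "\<mu> > 0" using U by (simp add: U_set_def)
  have set: "set (remove1 k js) = {1..m} - {k}" using js by simp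
  have w: "(\<lambda>i. x0 i + (if i \<in> set (remove1 k js) then \<delta> else 0)) = w"
    unfolding set by (auto simp: x0_def w_def cone_pt_def)
  have "x0 (m + j) = 1" if "j \<in> set (remove1 k js)" for j
    using that unfolding set by (auto simp: x0_def w_def cone_pt_def)
  then have F: "stable_form m d F" "above_roots m F w" "Phi k F w \<le> 1 / \<mu>"
    using barrier_list[OF P U r above_roots _ Phi deg, of x0 "remove1 k js"] js k t
    unfolding w F_def[symmetric] by (auto simp: x0_def)
  define x where "x i = w i + s * (if i \<in> {1..m} then 1 else 0)" for i
  \<comment> \<open>Coordinate \<open>k\<close> is shifted first: there the barrier is a sum of 1/(s
    - a), which drops strictly (or is 0 if there are no roots). The other shifts then only need
    monotonicity.\<close>
  define w' where "w' = w(k := w k + s)"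
  have "above_roots m F w'" unfolding w'_def using s by (intro above_roots_upd F k) simp
  moreover have "x = (\<lambda>i. w' i + (if i \<in> {1..m} - {k} then s else 0))"
    using k by (auto simp: x_def w'_def)
  moreover define y where "y i = (if i \<in> {1..m} - {k} then s else 0)" for i
  ultimately have x: "above_roots m F w'" "x = (\<lambda>i. w' i + y i)" by simp_all
  have y: "y j \<ge> 0" "j \<notin> {1..m} \<Longrightarrow> y j = 0" for j using s by (auto simp: y_def)
  have 1: "Phi k F x \<le> Phi k F w'" "F (cx x) \<noteq> 0"
    unfolding x(2) using Phi_mono[OF F(1) x(1) k y] above_roots_nz[OF above_roots_plus[OF x(1) y]] by auto
  have 2: "Phi k F w' < 1 / \<mu>"
  proof -
    obtain c M where cM: "c \<noteq> 0" "\<And>a. a \<in># M \<Longrightarrow> a < 0"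
      "\<And>z. F ((cx w)(k := of_real (w k) + z)) = c * poly (rp M) z"
      using axis_roots[OF F(1,2) k] by blast
    note ax = Phi_axis(4)[OF stable_formD(1)[OF F(1)] cM]
    show ?thesis
    proof (cases "M = {#}")
      case True
      then show ?thesis using ax[of s] s \<mu> by (simp add: w'_def)
    next
      case False
      then have "(\<Sum>a\<in>#M. 1 / (s - a)) < (\<Sum>a\<in>#M. 1 / (0 - a))"
        using cM(2)
      proof (induction M)
        case (add a M)
        have "1 / (s - a) < 1 / (0 - a)" using s add.prems(2)[of a] by (intro divide_strict_left_mono mult_pos_pos) auto
        moreover have "(\<Sum>a\<in>#M. 1 / (s - a)) \<le> (\<Sum>a\<in>#M. 1 / (0 - a))"
          using add by (cases "M = {#}") (auto simp del: diff_0)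
        ultimately show ?case by (simp only: image_mset_add_mset sum_mset.add_mset add_less_le_mono)
      qed simp
      then show ?thesis using ax[of s] ax[of 0] s F(3) by (simp add: w'_def)
    qed
  qed
  have xk: "cx x (m + k) = of_real \<mu>" using k by (auto simp: cx_def x_def w_def cone_pt_def)
  have "diff_op m k F (cx x) \<noteq> 0"
  proof
    assume "diff_op m k F (cx x) = 0"
    then have "F (cx x) = of_real \<mu> * pd k F (cx x)" by (simp add: diff_op_def xk)
    then have "pd k F (cx x) / F (cx x) = of_real (1 / \<mu>)" using 1(2) \<mu> by (auto simp: field_simps)
    then have "Phi k F x = 1 / \<mu>" by (simp add: Phi_def)
    then show False using 1 2 by simp
  qed
  then show ?thesis
    using foldr_diff_op_remove1[OF stable_formD(1)[OF P], of js m k] js k by (simp add: F_def x_def[abs_def] w_def)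
qed

text \<open>Garding's convexity applied to the sum of the m barrier points. By homogeneity, dividing
  by the common y-coordinate m - 1 + \<mu> moves that sum to y = 1, and any larger x-coordinate
  \<tau> is then interior.\<close>

lemma mixed_nonzero:
  fixes t :: real
  assumes P: "stable_form m d P" and U: "(\<delta>, \<mu>) \<in> U_set r" and r: "r \<ge> 1" and t: "t > 0" and m: "m \<ge> 1"
    and above_roots: "\<And>x. \<forall>i\<in>{1..m}. x i > 0 \<Longrightarrow> above_roots m P x"
    and Phi: "\<And>i x. i \<in> {1..m} \<Longrightarrow> \<forall>l\<in>{1..m}. x l = t \<Longrightarrow> Phi i P x \<le> 1 / \<mu>"
    and deg: "\<And>j. j \<in> {1..m} \<Longrightarrow> deg_le m r j P"
    and js: "distinct js" "set js = {1..m}"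
    and \<tau>: "\<tau> > (real m * t + (real m - 1) * \<delta>) / (real m - 1 + \<mu>)"
  shows "foldr (diff_op m) js P (cx (\<lambda>i. if i \<in> {1..m} then \<tau> else if i \<in> {m+1..2*m} then 1 else 0)) \<noteq> 0"
proof -
  define Q where "Q = foldr (diff_op m) js P"
  define u where "u i = (if i \<in> {1..m} then 1 else 0 :: real)" for i
  define w where "w = cone_pt m t \<delta> \<mu>"
  have Q: "stable_form m d Q" unfolding Q_def using js by (intro stable_form_foldr P) simp
  have \<mu>: "\<mu> > 0" using U by (simp add: U_set_def)
  \<comment> \<open>The barrier points are added one by one by \<open>garding_step\<close>; the term
    \<open>c * u\<close> keeps every partial sum in the open cone.\<close>
  have garding: "Q (\<lambda>i. Complex (x i) ((\<Sum>k\<in>S. w k i) + c * u i)) \<noteq> 0"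
    if "finite S" "S \<subseteq> {1..m}" "c > 0" for S x c
    using that
  proof (induction S arbitrary: x c rule: finite_induct)
    case empty
    then show ?case by (intro stable_formD(3)[OF Q, unfolded stable_def, rule_format]) (auto simp: u_def)
  next
    case (insert k S)
    have "Q (\<lambda>i. Complex (x i) ((\<Sum>k\<in>S. w k i) + w k i + c * u i)) \<noteq> 0"
    proof (rule garding_step[OF stable_formD(1)[OF Q] stable_formD(2)[OF Q]])
      show "Q (\<lambda>i. of_real (x i) + z * of_real (u i)) \<noteq> 0" if "Im z > 0" for x z
        using that by (intro stable_formD(3)[OF Q, unfolded stable_def, rule_format]) (auto simp: u_def)
      show "Q (\<lambda>i. of_real (w k i + s * u i)) \<noteq> 0" if "s > 0" for s
      proof -
        have "Q (cx (\<lambda>i. w k i + s * u i)) \<noteq> 0"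
          unfolding Q_def w_def u_def
          by (rule cone_pt_nonzero[OF P U r t above_roots Phi deg js _ that]) (use insert.prems in auto)
        then show ?thesis unfolding cx_def[abs_def] .
      qed
    qed (use insert in auto)
    then show ?case using insert by (simp add: add.commute)
  qed
  \<comment> \<open>\<open>K\<close> and \<open>N\<close> are the common y- and x-coordinates of the
    sum of all barrier points. Adding (\<tau> K - N) \<open>u\<close> yields exactly K times the
    target, and the factor \<i> K is removed by homogeneity.\<close>
  define K where "K = real m - 1 + \<mu>"
  define N where "N = real m * t + (real m - 1) * \<delta>"
  have K: "K > 0" using m \<mu> by (simp add: K_def add_nonneg_pos)
  define v where "v i = (if i \<in> {1..m} then \<tau> else if i \<in> {m+1..2*m} then 1 else 0)" for i
  have "Q (\<lambda>i. Complex 0 ((\<Sum>k\<in>{1..m}. w k i) + (\<tau> * K - N) * u i)) \<noteq> 0"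
  proof (rule garding)
    have "N / K < \<tau>" using \<tau> by (simp add: K_def N_def)
    then show "\<tau> * K - N > 0" by (simp add: pos_divide_less_eq[OF K])
  qed simp_all
  also have "(\<lambda>i. Complex 0 ((\<Sum>k\<in>{1..m}. w k i) + (\<tau> * K - N) * u i)) = (\<lambda>i. (\<i> * K) * cx v i)"
  proof (rule ext)
    fix i
    consider "i \<in> {1..m}" | j where "j \<in> {1..m}" "i = m + j" | "i \<notin> {1..m}" "i \<notin> {m+1..2*m}"
    proof -
      have "i - m \<in> {1..m}" "i = m + (i - m)" if "i \<in> {m+1..2*m}" using that by auto
      then show ?thesis using that by blast
    qed
    then have "(\<Sum>k\<in>{1..m}. w k i) + (\<tau> * K - N) * u i = K * v i"
    proof cases
      case 1
      have "(\<Sum>k\<in>{1..m}. w k i) = (\<Sum>k\<in>{1..m}. (t + \<delta>) - (if k = i then \<delta> else 0))"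
        using 1 by (intro sum.cong) (auto simp: w_def cone_pt_def)
      also have "\<dots> = N" using 1 m by (simp add: sum_subtractf N_def algebra_simps of_nat_diff)
      finally show ?thesis using 1 by (simp add: u_def v_def)
    next
      case 2
      have "(\<Sum>k\<in>{1..m}. w k i) = (\<Sum>k\<in>{1..m}. 1 + (if k = j then \<mu> - 1 else 0))"
        using 2 by (intro sum.cong) (auto simp: w_def cone_pt_def)
      also have "\<dots> = K" using 2 m by (simp add: sum.distrib K_def of_nat_diff)
      finally show ?thesis using 2 by (simp add: u_def v_def)
    next
      case 3
      then have "(\<Sum>k\<in>{1..m}. w k i) = 0" by (intro sum.neutral) (auto simp: w_def cone_pt_def)
      then show ?thesis using 3 by (auto simp: u_def v_def)
    qed
    then show "Complex 0 ((\<Sum>k\<in>{1..m}. w k i) + (\<tau> * K - N) * u i) = (\<i> * K) * cx v i"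
      by (simp add: complex_eq_iff cx_def)
  qed
  finally show ?thesis
    using homog_eq_0_iff[OF stable_formD(2)[OF Q], of "\<i> * K" "cx v"] K by (simp add: Q_def v_def[abs_def])
qed

section \<open>Complexification of hyperbolic polynomials\<close>

lemma homogeneous_polynomial_scale:
  assumes "homogeneous_polynomial d h"
  shows "h (c *\<^sub>R x) = c ^ d * h x"
proof -
  obtain k where k: "\<And>x. h x = (\<Sum>\<alpha> | sum \<alpha> UNIV = d. k \<alpha> * (\<Prod>i\<in>UNIV. (x $ i) ^ \<alpha> i))"
    using assms unfolding homogeneous_polynomial_def by blast
  show ?thesis
    unfolding k sum_distrib_left
    by (intro sum.cong refl) (auto simp: power_mult_distrib prod.distrib simp flip: power_sum)
qed

lemma homogeneous_polynomial_RP: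
  fixes h :: "real ^ 'n \<Rightarrow> real"
  assumes "homogeneous_polynomial d h"
  shows "real_polynomial_function h"
proof -
  obtain k where k: "\<And>x. h x = (\<Sum>\<alpha> | sum \<alpha> UNIV = d. k \<alpha> * (\<Prod>i\<in>UNIV. (x $ i) ^ \<alpha> i))"
    using assms unfolding homogeneous_polynomial_def by blast
  have coord: "real_polynomial_function (\<lambda>x :: real ^ 'n. x $ i)" for i
    by (intro real_polynomial_function.intros(1) bounded_linear_vec_nth)
  have fin: "real_polynomial_function (\<lambda>x :: real ^ 'n. \<Sum>\<alpha>\<in>A. k \<alpha> * (\<Prod>i\<in>UNIV. (x $ i) ^ \<alpha> i))" for A
  \<comment> \<open>An infinite index set would give the sum 0, still a polynomial, so finiteness of
    the set of multi-indices need not be shown.\<close>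
  proof (cases "finite A")
    case True
    then show ?thesis
      by (intro real_polynomial_function_sum real_polynomial_function.intros(4) real_polynomial_function.intros(2)
          real_polynomial_function_prod real_polynomial_function_power coord) auto
  qed (auto intro: real_polynomial_function.intros(2))
  show ?thesis unfolding k by (rule fin)
qed

lemma real_polynomial_line:
  fixes h :: "'a::real_normed_vector \<Rightarrow> real"
  assumes "real_polynomial_function h"
  shows "\<exists>p. \<forall>t. h (a + t *\<^sub>R b) = poly p t"
  using assms
proof induction
  case (linear f)
  then have "f (a + t *\<^sub>R b) = poly [:f a, f b:] t" for t
    by (simp add: bounded_linear.linear linear_add linear_scale)
  then show ?case by blast
next
  case (const c)
  have "c = poly [:c:] t" for t :: real by simp
  then show ?case by blast
next
  case (add f g)
  then show ?case by (metis poly_add)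
next
  case (mult f g)
  then show ?case by (metis poly_mult)
qed

lemma poly_hyp_char_poly:
  assumes "homogeneous_polynomial d h"
  shows "poly (hyp_char_poly h e x) t = h (t *\<^sub>R e - x)"
proof -
  obtain p where p: "\<And>t. h (- x + t *\<^sub>R e) = poly p t"
    using real_polynomial_line[OF homogeneous_polynomial_RP[OF assms]] by metis
  have "hyp_char_poly h e x = p"
    unfolding hyp_char_poly_def
    by (rule the_equality) (auto simp: poly_eq_poly_eq_iff[symmetric] fun_eq_iff p[symmetric])
  then show ?thesis by (simp flip: p)
qed

lemma poly_map_of_real: "poly (map_poly of_real p) (complex_of_real t) = of_real (poly p t)"
  by (induction p) (auto simp: map_poly_pCons)

lemma poly_prod_linear:
  fixes t :: real
  shows "poly (\<Prod>a\<in>#M. [:-a, 1:]) t = (\<Prod>a\<in>#M. t - a)"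
  by (induction M) (auto simp: left_diff_distrib)

lemma real_rooted_proots:
  fixes p :: "real poly"
  assumes "p \<noteq> 0" "\<And>z::complex. poly (map_poly of_real p) z = 0 \<Longrightarrow> z \<in> \<real>"
  shows "\<exists>c. c \<noteq> 0 \<and> (\<forall>t. poly p t = c * (\<Prod>a\<in>#proots p. t - a))"
proof -
  have "map_poly complex_of_real p \<noteq> 0" using assms(1) by (simp add: map_poly_eq_0_iff)
  then obtain c M where cM: "c \<noteq> 0" "map_poly of_real p = smult c (rp M)"
    using real_rooted_split[OF _ assms(2)] by blast
  have val: "of_real (poly p t) = c * of_real (\<Prod>a\<in>#M. t - a)" for t
  proof -
    have "of_real (poly p t) = poly (smult c (rp M)) (of_real t)"
      by (simp only: poly_map_of_real flip: cM(2))
    also have "\<dots> = c * (\<Prod>a\<in>#M. of_real t - of_real a)" by (simp add: poly_rp)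
    also have "(\<Prod>a\<in>#M. of_real t - of_real a) = complex_of_real (\<Prod>a\<in>#M. t - a)"
      by (induction M) auto
    finally show ?thesis .
  qed
  \<comment> \<open>A point beyond all roots: there the product is nonzero, which shows that the
    complex leading coefficient \<open>c\<close> is real.\<close>
  define t0 where "t0 = Max (insert 0 (set_mset M)) + 1"
  have "a < t0" if "a \<in># M" for a
  proof -
    have "a \<le> Max (insert 0 (set_mset M))" using that by (intro Max_ge) auto
    then show ?thesis by (simp only: t0_def)
  qed
  then have w: "(\<Prod>a\<in>#M. t0 - a) \<noteq> 0" by (fastforce simp: prod_mset_zero_iff)
  define c' where "c' = poly p t0 / (\<Prod>a\<in>#M. t0 - a)"
  have c': "c = of_real c'" using val[of t0] w by (simp add: c'_def field_simps)
  have "complex_of_real (poly p t) = of_real (c' * (\<Prod>a\<in>#M. t - a))" for t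
    using val[of t] by (simp add: c')
  then have v: "poly p t = c' * (\<Prod>a\<in>#M. t - a)" for t using of_real_eq_iff by blast
  have "c' \<noteq> 0" using cM(1) c' by auto
  have "poly p = poly (smult c' (\<Prod>a\<in>#M. [:-a, 1:]))"
  proof
    fix t
    show "poly p t = poly (smult c' (\<Prod>a\<in>#M. [:-a, 1:])) t" by (simp add: v poly_prod_linear)
  qed
  then have p: "p = smult c' (\<Prod>a\<in>#M. [:-a, 1:])" by (simp add: poly_eq_poly_eq_iff)
  have "proots (\<Prod>a\<in>#M. [:-a, 1:]) = M"
  proof (induction M)
    case (add a M)
    have "(\<Prod>a\<in>#M. [:-a, 1:]) \<noteq> (0 :: real poly)" by (auto simp: prod_mset_zero_iff)
    then have "proots ([:-a, 1:] * (\<Prod>a\<in>#M. [:-a, 1:])) = {#a#} + M"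
      by (subst proots_mult) (auto simp: add)
    then show ?case by simp
  qed simp
  then have "proots p = M" using \<open>c' \<noteq> 0\<close> by (simp add: p)
  then show ?thesis using v \<open>c' \<noteq> 0\<close> by auto
qed

lemma poly_asymp_degree:
  fixes p :: "real poly"
  assumes "((\<lambda>t. poly p t / t ^ d) \<longlongrightarrow> L) at_top" "L \<noteq> 0"
  shows "degree p = d \<and> lead_coeff p = L"
proof -
  define n where "n = degree p"
  have n: "((\<lambda>t. poly p t / t ^ n) \<longlongrightarrow> lead_coeff p) at_top"
    using poly_divide_tendsto_aux[of p] at_top_le_at_infinity tendsto_mono unfolding n_def by blast
  have inv: "((\<lambda>t::real. inverse (t ^ k)) \<longlongrightarrow> 0) at_top" if "k > 0" for k
    using that by (intro tendsto_inverse_0_at_top filterlim_pow_at_top filterlim_ident) auto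
  have "p \<noteq> 0"
  proof
    assume "p = 0"
    then have "((\<lambda>t. poly p t / t ^ d) \<longlongrightarrow> 0) at_top" by simp
    from tendsto_unique[OF trivial_limit_at_top_linorder this assms(1)] show False using assms(2) by simp
  qed
  have "n = d"
  proof (rule linorder_cases[of n d])
    assume "n < d"
    then have "((\<lambda>t. poly p t / t ^ n * inverse (t ^ (d - n))) \<longlongrightarrow> lead_coeff p * 0) at_top"
      by (intro tendsto_mult n inv) simp
    moreover have "poly p t / t ^ n * inverse (t ^ (d - n)) = poly p t / t ^ d" for t
      using \<open>n < d\<close> by (simp add: divide_inverse flip: power_add inverse_mult_distrib mult.assoc)
    ultimately have "((\<lambda>t. poly p t / t ^ d) \<longlongrightarrow> 0) at_top" by simp
    from tendsto_unique[OF trivial_limit_at_top_linorder this assms(1)] show ?thesis using assms(2) by simp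
  next
    assume "d < n"
    then have "((\<lambda>t. poly p t / t ^ d * inverse (t ^ (n - d))) \<longlongrightarrow> L * 0) at_top"
      by (intro tendsto_mult assms inv) simp
    moreover have "poly p t / t ^ d * inverse (t ^ (n - d)) = poly p t / t ^ n" for t
      using \<open>d < n\<close> by (simp add: divide_inverse flip: power_add inverse_mult_distrib mult.assoc)
    ultimately have "((\<lambda>t. poly p t / t ^ n) \<longlongrightarrow> 0) at_top" by simp
    from tendsto_unique[OF trivial_limit_at_top_linorder this n] have "lead_coeff p = 0" by simp
    then show ?thesis using \<open>p \<noteq> 0\<close> by simp
  qed
  then show ?thesis using tendsto_unique[OF trivial_limit_at_top_linorder n] assms(1) by (simp add: n_def)
qed

text \<open>By homogeneity h(t e - x) / t^d = h(e - x/t), which tends to h(e). So the characteristic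
  polynomial has degree d and leading coefficient h(e), and real-rootedness makes
  \<open>proots\<close> account for all d zeros.\<close>

lemma hyperbolic_factor:
  assumes "hyperbolic d h e"
  shows "size (hyp_eigenvalues h e x) = d"
    and "h (t *\<^sub>R e - x) = h e * (\<Prod>l\<in>#hyp_eigenvalues h e x. t - l)"
proof -
  have hom: "homogeneous_polynomial d h" and he: "h e \<noteq> 0"
    using assms by (auto simp: hyperbolic_def)
  define p where "p = hyp_char_poly h e x"
  have p: "poly p t = h (t *\<^sub>R e - x)" for t unfolding p_def by (rule poly_hyp_char_poly[OF hom])
  have "isCont h y" for y
    by (rule differentiable_imp_continuous_within[OF
        differentiable_at_real_polynomial_function[OF homogeneous_polynomial_RP[OF hom]]])
  moreover have "((\<lambda>t::real. e - inverse t *\<^sub>R x) \<longlongrightarrow> e - 0 *\<^sub>R x) at_top"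
    by (intro tendsto_intros tendsto_inverse_0_at_top filterlim_ident)
  ultimately have "((\<lambda>t. h (e - inverse t *\<^sub>R x)) \<longlongrightarrow> h (e - 0 *\<^sub>R x)) at_top"
    using isCont_tendsto_compose by blast
  moreover have "\<forall>\<^sub>F t in at_top. h (e - inverse t *\<^sub>R x) = poly p t / t ^ d"
  proof (rule eventually_mono[OF eventually_gt_at_top[of 0]])
    fix t :: real assume "t > 0"
    then have "t *\<^sub>R e - x = t *\<^sub>R (e - inverse t *\<^sub>R x)" by (simp add: scaleR_diff_right)
    then show "h (e - inverse t *\<^sub>R x) = poly p t / t ^ d"
      using \<open>t > 0\<close> by (simp add: p homogeneous_polynomial_scale[OF hom])
  qed
  ultimately have "((\<lambda>t. poly p t / t ^ d) \<longlongrightarrow> h e) at_top"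
    using tendsto_cong[of "\<lambda>t. h (e - inverse t *\<^sub>R x)" "\<lambda>t. poly p t / t ^ d" at_top] by simp
  then have deg: "degree p = d" "lead_coeff p = h e" using poly_asymp_degree he by blast+
  then have "p \<noteq> 0" using he by auto
  then obtain c where c: "c \<noteq> 0" "\<And>t. poly p t = c * (\<Prod>a\<in>#proots p. t - a)"
    using real_rooted_proots[of p] assms unfolding hyperbolic_def p_def by blast
  have "poly p = poly (smult c (\<Prod>a\<in>#proots p. [:-a, 1:]))"
  proof
    fix t
    show "poly p t = poly (smult c (\<Prod>a\<in>#proots p. [:-a, 1:])) t" by (simp add: c poly_prod_linear)
  qed
  then have eq: "p = smult c (\<Prod>a\<in>#proots p. [:-a, 1:])" by (simp add: poly_eq_poly_eq_iff)
  have lin1: "degree (\<Prod>a\<in>#M. [:-a, 1:] :: real poly) = size M" for M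
  proof (induction M)
    case (add a M)
    have "(\<Prod>a\<in>#M. [:-a, 1:] :: real poly) \<noteq> 0" by auto
    then show ?case using add by (simp add: degree_mult_eq del: mult_pCons_left)
  qed simp
  have lin2: "lead_coeff (\<Prod>a\<in>#M. [:-a, 1:] :: real poly) = 1" for M
    by (induction M) (simp_all add: lead_coeff_mult del: mult_pCons_left)
  define R where "R = (\<Prod>a\<in>#proots p. [:-a, 1:])"
  have pR: "p = smult c R" unfolding R_def by (fact eq)
  have "degree p = size (proots p)" "lead_coeff p = c"
    using arg_cong[OF pR, of degree] arg_cong[OF pR, of lead_coeff] c(1)
      lin1[of "proots p", folded R_def] lin2[of "proots p", folded R_def]
    by (simp_all add: lead_coeff_smult)
  then have "size (proots p) = d" "c = h e" using deg by auto
  then show "size (hyp_eigenvalues h e x) = d"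
    "h (t *\<^sub>R e - x) = h e * (\<Prod>l\<in>#hyp_eigenvalues h e x. t - l)"
    using c(2) p by (auto simp: hyp_eigenvalues_def p_def)
qed

text \<open>Scaling by -s reduces to the previous factorization at -t/s. At s = 0 the number of
  eigenvalues supplies the power t^d.\<close>

lemma hyperbolic_factor_plus:
  assumes "hyperbolic d h e"
  shows "h (t *\<^sub>R e + s *\<^sub>R x) = h e * (\<Prod>l\<in>#hyp_eigenvalues h e x. t + s * l)"
proof (cases "s = 0")
  case True
  have hom: "homogeneous_polynomial d h" using assms by (auto simp: hyperbolic_def)
  show ?thesis using hyperbolic_factor(1)[OF assms, of x]
    by (simp add: True homogeneous_polynomial_scale[OF hom] prod_mset_constant mult.commute)
next
  case False
  have hom: "homogeneous_polynomial d h" using assms by (auto simp: hyperbolic_def)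
  have "t *\<^sub>R e + s *\<^sub>R x = (- s) *\<^sub>R ((- t / s) *\<^sub>R e - x)" using False by (simp add: algebra_simps)
  then have "h (t *\<^sub>R e + s *\<^sub>R x) = (- s) ^ d * (h e * (\<Prod>l\<in>#hyp_eigenvalues h e x. - t / s - l))"
    by (simp only: homogeneous_polynomial_scale[OF hom] hyperbolic_factor(2)[OF assms])
  also have "\<dots> = h e * ((- s) ^ size (hyp_eigenvalues h e x) * (\<Prod>l\<in>#hyp_eigenvalues h e x. - t / s - l))"
    by (simp add: hyperbolic_factor(1)[OF assms])
  also have "(- s) ^ size M * (\<Prod>l\<in>#M. - t / s - l) = (\<Prod>l\<in>#M. t + s * l)" for M
  proof (induction M)
    case (add l M)
    have "(- s) ^ size (add_mset l M) * (\<Prod>l\<in>#add_mset l M. - t / s - l)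
        = ((- s) * (- t / s - l)) * ((- s) ^ size M * (\<Prod>l\<in>#M. - t / s - l))"
      by (simp only: image_mset_add_mset prod_mset.add_mset size_add_mset power_Suc mult_ac)
    also have "(- s) * (- t / s - l) = t + s * l" using False by (simp add: field_simps)
    finally show ?case using add by simp
  qed simp
  finally show ?thesis .
qed

text \<open>\<open>P\<close> is h of the sum of the z_j v_j, with complex numbers put into the
  coefficient form of \<open>h\<close>. It ignores all coordinates beyond \<open>m\<close>, so those
  are free to hold the operator parameters.\<close>

lemma complexify:
  fixes h :: "real ^ 'n \<Rightarrow> real"
  assumes "homogeneous_polynomial d h"
  shows "\<exists>P. polyfun P \<and> homog d P \<and> (\<forall>z z'. (\<forall>j\<in>{1..m}. z j = z' j) \<longrightarrow> P z = P z') \<and>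
    (\<forall>x. P (cx x) = of_real (h (\<Sum>j=1..m. x j *\<^sub>R v j)))"
proof -
  obtain k where k: "\<And>x. h x = (\<Sum>\<alpha> | sum \<alpha> UNIV = d. k \<alpha> * (\<Prod>i\<in>UNIV. (x $ i) ^ \<alpha> i))"
    using assms unfolding homogeneous_polynomial_def by blast
  define P where "P z = (\<Sum>\<alpha> | sum \<alpha> UNIV = d. of_real (k \<alpha>) *
    (\<Prod>i\<in>UNIV. (\<Sum>j=1..m. z j * of_real (v j $ i)) ^ \<alpha> i))" for z :: "nat \<Rightarrow> complex"
  have "polyfun P"
    unfolding P_def[abs_def]
    by (intro polyfun_sum polyfun.mult polyfun.const polyfun_prod polyfun_power polyfun.coord)
  moreover have "homog d P"
    unfolding homog_def
  proof (intro allI)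
    fix c :: complex and z
    show "P (\<lambda>i. c * z i) = c ^ d * P z"
      unfolding P_def mult.assoc
      unfolding sum_distrib_left[symmetric, of c _ "{1..m}"]
      unfolding sum_distrib_left[of "c ^ d"]
      by (intro sum.cong refl) (auto simp: power_mult_distrib prod.distrib simp flip: power_sum)
  qed
  moreover have "P z = P z'" if "\<forall>j\<in>{1..m}. z j = z' j" for z z'
    unfolding P_def using that by (intro sum.cong refl arg_cong2[of _ _ _ _ "(*)"] prod.cong arg_cong2[of _ _ _ _ "(^)"]) auto
  moreover have "P (cx x) = of_real (h (\<Sum>j=1..m. x j *\<^sub>R v j))" for x
    unfolding P_def k by (simp add: cx_def)
  ultimately show ?thesis by blast
qed

section \<open>Directional derivatives and the mixed characteristic polynomial\<close>

lemma real_polynomial_derivative: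
  fixes f :: "'a::real_normed_vector \<Rightarrow> real"
  assumes "real_polynomial_function f"
  shows "\<exists>f'. (\<forall>x. (f has_derivative f' x) (at x)) \<and> (\<forall>v. real_polynomial_function (\<lambda>x. f' x v))"
  using assms
proof induction
  case (linear f)
  then show ?case
    by (intro exI[of _ "\<lambda>x. f"]) (auto intro: bounded_linear_imp_has_derivative real_polynomial_function.intros(2))
next
  case (const c)
  show ?case by (intro exI[of _ "\<lambda>x v. 0"]) (auto intro: real_polynomial_function.intros(2))
next
  case (add f g)
  then obtain f' g' where *: "\<And>x. (f has_derivative f' x) (at x)" "\<And>x. (g has_derivative g' x) (at x)"
    "\<And>v. real_polynomial_function (\<lambda>x. f' x v)" "\<And>v. real_polynomial_function (\<lambda>x. g' x v)" by metis
  show ?case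
    by (intro exI[of _ "\<lambda>x v. f' x v + g' x v"] conjI allI has_derivative_add * real_polynomial_function.intros(3))
next
  case (mult f g)
  then obtain f' g' where *: "\<And>x. (f has_derivative f' x) (at x)" "\<And>x. (g has_derivative g' x) (at x)"
    "\<And>v. real_polynomial_function (\<lambda>x. f' x v)" "\<And>v. real_polynomial_function (\<lambda>x. g' x v)" by metis
  show ?case
    by (intro exI[of _ "\<lambda>x v. f x * g' x v + f' x v * g x"] conjI allI has_derivative_mult *
        real_polynomial_function.intros(3) real_polynomial_function.intros(4) mult.hyps)
qed

lemma dir_deriv_real_polynomial:
  fixes f :: "real ^ 'n \<Rightarrow> real"
  assumes "real_polynomial_function f"
  shows "real_polynomial_function (dir_deriv v f)"
    and "((\<lambda>s. f (x + s *\<^sub>R v)) has_real_derivative dir_deriv v f x) (at 0)"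
proof -
  obtain f' where f': "\<And>x. (f has_derivative f' x) (at x)" "\<And>v. real_polynomial_function (\<lambda>x. f' x v)"
    using real_polynomial_derivative[OF assms] by blast
  have line: "((\<lambda>s. f (x + s *\<^sub>R w)) has_real_derivative f' x w) (at 0)" for x w
  proof -
    have "((\<lambda>s. x + s *\<^sub>R w) has_derivative (\<lambda>s. s *\<^sub>R w)) (at (0::real))"
      by (auto intro!: derivative_eq_intros)
    from has_derivative_compose[OF this, of f "f' x"] f'(1)[of x]
    have "((\<lambda>s. f (x + s *\<^sub>R w)) has_derivative (\<lambda>s. f' x (s *\<^sub>R w))) (at 0)" by simp
    moreover have "f' x (s *\<^sub>R w) = f' x w * s" for s
      using linear_scale[OF has_derivative_linear[OF f'(1)]] by simp
    ultimately show ?thesis by (simp add: has_field_derivative_def)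
  qed
  have eq: "dir_deriv v f x = f' x v" for x
  proof -
    have "dir_deriv v f x = (\<Sum>k\<in>UNIV. v $ k * f' x (axis k 1))"
      unfolding dir_deriv_def partial_deriv_def by (simp add: DERIV_imp_deriv[OF line])
    also have "\<dots> = f' x (\<Sum>k\<in>UNIV. v $ k *\<^sub>R axis k 1)"
      using has_derivative_linear[OF f'(1), of x] by (simp add: linear_sum linear_scale)
    also have "(\<Sum>k\<in>UNIV. v $ k *\<^sub>R axis k 1) = v" by (simp add: basis_expansion flip: scalar_mult_eq_scaleR)
    finally show ?thesis .
  qed
  show "real_polynomial_function (dir_deriv v f)" using f'(2)[of v] by (simp add: eq[abs_def])
  show "((\<lambda>s. f (x + s *\<^sub>R v)) has_real_derivative dir_deriv v f x) (at 0)"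
    unfolding eq by (rule line)
qed

text \<open>The chain rule: differentiating in x_j is differentiating in direction v_j. The identity
  is stated for all real x with parameters 1, not just on the line of \<open>e\<close>, since the
  next operator differentiates off that line.\<close>

lemma foldr_diff_op_mixed:
  fixes h :: "real ^ 'n \<Rightarrow> real" and v :: "nat \<Rightarrow> real ^ 'n"
  assumes P: "polyfun P" "\<And>x. P (cx x) = of_real (h (\<Sum>j=1..m. x j *\<^sub>R v j))"
    and h: "real_polynomial_function h" and js: "set js \<subseteq> {1..m}"
  shows "real_polynomial_function (foldr (\<lambda>v f x. f x - dir_deriv v f x) (map v js) h) \<and>
    (\<forall>x. (\<forall>j\<in>{1..m}. x (m + j) = 1) \<longrightarrow> foldr (diff_op m) js P (cx x) =
      of_real (foldr (\<lambda>v f x. f x - dir_deriv v f x) (map v js) h (\<Sum>j=1..m. x j *\<^sub>R v j)))"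
  using js
proof (induction js)
  case (Cons j js)
  define F where "F = foldr (diff_op m) js P"
  define f where "f = foldr (\<lambda>v f x. f x - dir_deriv v f x) (map v js) h"
  have f: "real_polynomial_function f"
    and Ff: "\<And>x. \<forall>j\<in>{1..m}. x (m + j) = 1 \<Longrightarrow> F (cx x) = of_real (f (\<Sum>j=1..m. x j *\<^sub>R v j))"
    using Cons by (auto simp: F_def f_def)
  have F: "polyfun F" unfolding F_def by (rule polyfun_foldr_diff_op[OF P(1)])
  have j: "j \<in> {1..m}" using Cons.prems by simp
  have "diff_op m j F (cx x) = of_real (f (\<Sum>j=1..m. x j *\<^sub>R v j) - dir_deriv (v j) f (\<Sum>j=1..m. x j *\<^sub>R v j))"
    if x: "\<forall>j\<in>{1..m}. x (m + j) = 1" for x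
  proof -
    let ?A = "\<Sum>j=1..m. x j *\<^sub>R v j"
    obtain p where p: "\<And>s. F ((cx x)(j := cx x j + s)) = poly p s" using polyfun_axis[OF F] by blast
    have ps: "poly p (of_real s) = of_real (f (?A + s *\<^sub>R v j))" for s
    proof -
      have "(\<Sum>i=1..m. (x(j := x j + s)) i *\<^sub>R v i) = (\<Sum>i=1..m. x i *\<^sub>R v i + (if i = j then s *\<^sub>R v i else 0))"
        by (intro sum.cong) (auto simp: scaleR_left_distrib)
      also have "\<dots> = ?A + s *\<^sub>R v j" using j by (simp add: sum.distrib)
      finally have "F (cx (x(j := x j + s))) = of_real (f (?A + s *\<^sub>R v j))"
        using Ff[of "x(j := x j + s)"] x j by auto
      then show ?thesis using p[of "of_real s"] by (simp add: cx_upd cx_def[of x j])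
    qed
    \<comment> \<open>The complex derivative along the axis and the real directional derivative are
      both derivatives of one function of real \<open>s\<close>, hence equal.\<close>
    have "((\<lambda>s. poly p (of_real s)) has_vector_derivative poly (pderiv p) 0) (at 0)"
      using has_vector_derivative_real_field[of "poly p" "poly (pderiv p) 0" 0 UNIV] poly_DERIV[of p 0] by simp
    moreover have "((\<lambda>s. poly p (of_real s)) has_vector_derivative of_real (dir_deriv (v j) f ?A)) (at 0)"
      unfolding ps by (intro has_vector_derivative_of_real dir_deriv_real_polynomial f)
    ultimately have "poly (pderiv p) 0 = of_real (dir_deriv (v j) f ?A)" by (rule vector_derivative_unique_at)
    then have "pd j F (cx x) = of_real (dir_deriv (v j) f ?A)"
      using polyfun_line_pd[OF F p, of 0] by simp
    moreover have "cx x (m + j) = 1" using x j by (simp add: cx_def)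
    ultimately show ?thesis using Ff[OF x] by (simp add: diff_op_def)
  qed
  moreover have "real_polynomial_function (\<lambda>x. f x - dir_deriv (v j) f x)"
    by (intro real_polynomial_function_diff f dir_deriv_real_polynomial)
  ultimately show ?case by (simp add: F_def f_def)
qed (use P h in simp)

section \<open>Rank, growth and the largest root\<close>

lemma prod_mset_of_real: "(\<Prod>l\<in>#M. of_real (f l)) = complex_of_real (\<Prod>l\<in>#M. f l)"
  by (induction M) auto

lemma poly_eq_on_reals:
  fixes p q :: "complex poly"
  assumes "\<And>t::real. t \<ge> 0 \<Longrightarrow> poly p (of_real t) = poly q (of_real t)"
  shows "p = q"
  using poly_eq_0_nonneg[of "p - q"] assms by simp

lemma poly_prod_pencil:
  "poly (\<Prod>l\<in>#M. [:of_real t, of_real l:]) z = (\<Prod>l\<in>#M. of_real t + z * of_real l)"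
  by (induction M) (auto simp: algebra_simps)

lemma pderiv_prod_pencil:
  fixes t :: real
  assumes "t > 0"
  shows "poly (pderiv (\<Prod>l\<in>#M. [:of_real t, of_real l:])) (0::complex) = of_real (t ^ size M * (\<Sum>\<^sub># M / t))"
  using assms
proof (induction M)
  case (add l M)
  have "poly (\<Prod>l\<in>#M. [:of_real t, of_real l:]) (0::complex) = of_real (t ^ size M)"
    by (induction M) auto
  then show ?case using add
    by (simp add: pderiv_mult pderiv_pCons del: mult_pCons_left) (simp add: field_simps)
qed simp

text \<open>Here rank becomes degree: a zero eigenvalue contributes a constant factor.\<close>

lemma degree_prod_pencil:
  "degree (\<Prod>l\<in>#M. [:C, l:] :: real poly) \<le> size {#l \<in># M. l \<noteq> 0#}"
proof (induction M)
  case (add l M)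
  have "degree ([:C, l:] * (\<Prod>l\<in>#M. [:C, l:])) \<le> degree [:C, l:] + degree (\<Prod>l\<in>#M. [:C, l:])"
    by (rule degree_mult_le)
  then show ?case using add by auto
qed simp

lemma degree_le_of_growth:
  fixes p :: "complex poly" and q :: "real poly"
  assumes "\<And>s::real. s \<ge> 0 \<Longrightarrow> norm (poly p (of_real s)) \<le> \<bar>poly q s\<bar>"
  shows "degree p \<le> degree q"
proof (rule ccontr)
  assume "\<not> degree p \<le> degree q"
  define n where "n = degree p"
  define k where "k = degree q"
  have kn: "k < n" using \<open>\<not> _\<close> by (simp add: n_def k_def)
  have "((\<lambda>s. poly p (of_real s) / of_real s ^ n) \<longlongrightarrow> lead_coeff p) at_top"
    unfolding n_def by (rule filterlim_compose[OF poly_divide_tendsto_aux filterlim_of_real_at_infinity])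
  then have lim: "((\<lambda>s. norm (poly p (of_real s) / of_real s ^ n)) \<longlongrightarrow> norm (lead_coeff p)) at_top"
    by (rule tendsto_norm)
  have "((\<lambda>s. poly q s / s ^ k) \<longlongrightarrow> lead_coeff q) at_top"
    using poly_divide_tendsto_aux[of q] at_top_le_at_infinity tendsto_mono unfolding k_def by blast
  moreover have "((\<lambda>s::real. inverse (s ^ (n - k))) \<longlongrightarrow> 0) at_top"
    using kn by (intro tendsto_inverse_0_at_top filterlim_pow_at_top filterlim_ident) auto
  ultimately have "((\<lambda>s. \<bar>poly q s / s ^ k * inverse (s ^ (n - k))\<bar>) \<longlongrightarrow> \<bar>lead_coeff q * 0\<bar>) at_top"
    by (intro tendsto_rabs tendsto_mult)
  moreover have "poly q s / s ^ k * inverse (s ^ (n - k)) = poly q s / s ^ n" for s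
    using kn by (simp add: divide_inverse flip: power_add inverse_mult_distrib mult.assoc)
  ultimately have "((\<lambda>s. \<bar>poly q s / s ^ n\<bar>) \<longlongrightarrow> 0) at_top"
    by (simp only: mult_zero_right abs_zero)
  moreover have "\<forall>\<^sub>F s in at_top. norm (poly p (of_real s) / of_real s ^ n) \<le> \<bar>poly q s / s ^ n\<bar>"
    using assms by (intro eventually_mono[OF eventually_ge_at_top[of 0]])
      (auto simp: norm_divide norm_power abs_divide power_abs intro!: divide_right_mono)
  ultimately have "norm (lead_coeff p) \<le> 0"
    by (intro tendsto_le[OF _ _ lim]) auto
  then show False using kn by (simp add: n_def)
qed

lemma norm_mono_axis:
  assumes F: "stable_form m d F" and x: "above_roots m F x" and j: "j \<in> {1..m}" and t: "t \<ge> 0"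
  shows "norm (F (cx x)) \<le> norm (F (cx (x(j := x j + t))))"
proof -
  obtain c M where cM: "c \<noteq> 0" "\<And>a. a \<in># M \<Longrightarrow> a < 0"
    "\<And>s. F ((cx x)(j := of_real (x j) + s)) = c * poly (rp M) s"
    using axis_roots[OF F x j] by blast
  have "0 \<le> (\<Prod>a\<in>#M. 0 - a) \<and> (\<Prod>a\<in>#M. 0 - a) \<le> (\<Prod>a\<in>#M. t - a)"
    using cM(2)
  proof (induction M)
    case (add a M)
    have "a < 0" using add.prems by simp
    moreover have "0 \<le> (\<Prod>a\<in>#M. 0 - a)" "(\<Prod>a\<in>#M. 0 - a) \<le> (\<Prod>a\<in>#M. t - a)" using add by auto
    ultimately have "(0 - a) * (\<Prod>a\<in>#M. 0 - a) \<le> (t - a) * (\<Prod>a\<in>#M. t - a)"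
      "0 \<le> (0 - a) * (\<Prod>a\<in>#M. 0 - a)"
      using t by (intro mult_mono mult_nonneg_nonneg; simp)+
    then show ?case by (simp only: image_mset_add_mset prod_mset.add_mset)
  qed simp
  moreover have "poly (rp M) (of_real s) = of_real (\<Prod>a\<in>#M. s - a)" for s
    unfolding poly_rp of_real_diff[symmetric] by (rule prod_mset_of_real)
  ultimately have "norm (poly (rp M) (of_real 0)) \<le> norm (poly (rp M) (of_real t))"
    by (simp only: norm_of_real) linarith
  then have "norm (c * poly (rp M) (of_real 0)) \<le> norm (c * poly (rp M) (of_real t))"
    by (simp add: norm_mult mult_left_mono)
  then show ?thesis
    unfolding cM(3)[symmetric] cx_upd using fun_upd_triv[of "cx x" j] by (simp add: cx_def[of x j])
qed

text \<open>Along each axis the relative roots are negative, so every factor s - a grows in modulus.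
  This transfers growth bounds from a multiple of the all-ones point to general points of the
  orthant.\<close>

lemma norm_mono:
  assumes F: "stable_form m d F" and x: "above_roots m F x"
    and y: "\<And>j. j \<in> {1..m} \<Longrightarrow> y j \<ge> 0" "\<And>j. j \<notin> {1..m} \<Longrightarrow> y j = 0"
  shows "norm (F (cx x)) \<le> norm (F (cx (\<lambda>l. x l + y l)))"
proof -
  have "norm (F (cx x)) \<le> norm (F (cx (\<lambda>l. x l + (if l \<in> S then y l else 0))))" if "finite S" "S \<subseteq> {1..m}" for S
    using that
  proof (induction S rule: finite_induct)
    case empty
    show ?case by simp
  next
    case (insert j S)
    let ?x = "\<lambda>l. x l + (if l \<in> S then y l else 0)"
    have "above_roots m F ?x" using above_roots_plus[OF x, of "\<lambda>l. if l \<in> S then y l else 0"] y insert by auto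
    moreover have "(\<lambda>l. x l + (if l \<in> insert j S then y l else 0)) = ?x(j := ?x j + y j)"
      using insert by auto
    ultimately have "norm (F (cx ?x)) \<le> norm (F (cx (\<lambda>l. x l + (if l \<in> insert j S then y l else 0))))"
      using norm_mono_axis[OF F, of ?x j "y j"] y insert by simp
    then show ?case using insert by simp
  qed
  moreover have "(\<lambda>l. x l + (if l \<in> {1..m} then y l else 0)) = (\<lambda>l. x l + y l)"
    using y(2) by auto
  ultimately show ?thesis by (metis finite_atLeastAtMost order_refl)
qed

text \<open>With b the least imaginary part, Im z is b times the all-ones vector plus nonnegative
  multiples of the axis vectors. The latter lie in the closed cone by \<open>axis\<close>, and
  \<open>garding_step\<close> adds them one at a time.\<close>

lemma stable_of_cone:
  fixes P :: "(nat \<Rightarrow> complex) \<Rightarrow> complex"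
  assumes P: "polyfun P" "homog d P" and m: "m \<ge> 1"
    and hyp: "\<And>x z. Im z > 0 \<Longrightarrow> P (\<lambda>i. of_real (x i) + z * of_real (if i \<in> {1..m} then 1 else 0)) \<noteq> 0"
    and axis: "\<And>j a t. j \<in> {1..m} \<Longrightarrow> a \<ge> 0 \<Longrightarrow> t > 0 \<Longrightarrow>
      P (\<lambda>i. of_real ((if i = j then a else 0) + t * (if i \<in> {1..m} then 1 else 0))) \<noteq> 0"
  shows "stable {1..m} P"
  unfolding stable_def
proof (intro allI impI)
  fix z :: "nat \<Rightarrow> complex"
  assume z: "\<forall>j\<in>{1..m}. Im (z j) > 0" "\<forall>j. j \<notin> {1..m} \<longrightarrow> Im (z j) = 0"
  define u where "u i = (if i \<in> {1..m} then 1 else 0 :: real)" for i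
  define b where "b = Min ((\<lambda>j. Im (z j)) ` {1..m})"
  have b: "b > 0" using z m by (simp add: b_def)
  have bz: "b \<le> Im (z j)" if "j \<in> {1..m}" for j using that by (simp add: b_def)
  have "P (\<lambda>i. Complex (x i) ((if i \<in> S then Im (z i) - b else 0) + c * u i)) \<noteq> 0"
    if "finite S" "S \<subseteq> {1..m}" "c > 0" for S x c
    using that
  proof (induction S arbitrary: x c rule: finite_induct)
    case empty
    have "(\<lambda>i. Complex (x i) (c * u i)) = (\<lambda>i. of_real (x i) + (\<i> * c) * of_real (u i))"
      by (auto simp: complex_eq_iff)
    then show ?case using hyp[of "\<i> * c" x] empty by (simp add: u_def)
  next
    case (insert k S)
    define a where "a = Im (z k) - b"
    have "P (\<lambda>i. Complex (x i) ((if i \<in> S then Im (z i) - b else 0) + (if i = k then a else 0) + c * u i)) \<noteq> 0"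
    proof (rule garding_step[OF P])
      show "P (\<lambda>i. of_real (x i) + z * of_real (u i)) \<noteq> 0" if "Im z > 0" for x z
        using hyp[OF that] by (simp add: u_def)
      show "P (\<lambda>i. of_real ((if i = k then a else 0) + t * u i)) \<noteq> 0" if "t > 0" for t
        using axis[of k a t] that bz insert.prems unfolding u_def a_def by auto
    qed (use insert in auto)
    moreover have "(if i \<in> S then Im (z i) - b else 0) + (if i = k then a else 0) =
        (if i \<in> insert k S then Im (z i) - b else 0)" for i
      using insert by (auto simp: a_def)
    ultimately show ?case by simp
  qed
  from this[of "{1..m}" b "\<lambda>i. Re (z i)"]
  have "P (\<lambda>i. Complex (Re (z i)) ((if i \<in> {1..m} then Im (z i) - b else 0) + b * u i)) \<noteq> 0"
    using b by simp
  moreover have "(\<lambda>i. Complex (Re (z i)) ((if i \<in> {1..m} then Im (z i) - b else 0) + b * u i)) = z"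
    using z(2) by (auto simp: complex_eq_iff u_def)
  ultimately show "P z \<noteq> 0" by simp
qed

lemma foldr_diff_op_param_zero:
  assumes "\<forall>j\<in>set js. z (m + j) = 0"
  shows "foldr (diff_op m) js P z = P z"
  using assms by (induction js) (auto simp: diff_op_def)

text \<open>Ensures that the infimum is over a nonempty set. For \<delta> = \<mu> = 2 the condition
  only asks that the quotient be at most 1.\<close>

lemma U_set_nonempty:
  assumes "r \<ge> 1"
  shows "(2, 2) \<in> U_set r"
proof -
  define q where "q = 2 / (real r * 2)"
  define k where "k = r - 1"
  have r: "r = Suc k" using assms by (simp add: k_def)
  have q: "q > 0" using assms by (simp add: q_def)
  have "q ^ k \<le> (1 + q) ^ k" using q by (intro power_mono) auto
  then have "(1 + q) ^ k - q ^ k \<le> (1 + q) * (1 + q) ^ k - q * q ^ k"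
  proof -
    have "q * q ^ k \<le> q * (1 + q) ^ k" "q ^ k \<ge> 0"
      using q \<open>q ^ k \<le> _\<close> by (auto intro: mult_left_mono)
    then show ?thesis by (simp add: distrib_right)
  qed
  moreover have "(1 + q) ^ Suc k - q ^ Suc k > 0" using q by (simp only: diff_gt_0_iff_gt power_strict_mono less_add_same_cancel2 zero_less_one less_imp_le zero_less_Suc)
  ultimately have "((1 + q) ^ (r - 1) - q ^ (r - 1)) / ((1 + q) ^ r - q ^ r) \<le> 1"
    unfolding r by simp
  then have "2 - (1::real) \<ge> 2 / 2 * (((1 + q) ^ (r - 1) - q ^ (r - 1)) / ((1 + q) ^ r - q ^ r))" by simp
  then show ?thesis unfolding U_set_def q_def mem_Collect_eq prod.case
    by (intro conjI disjI1) (assumption | simp)+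
qed

text \<open>\<open>Max\<close> is meaningful for a finite nonempty set of zeros, so besides the
  bound the proof shows that the mixed characteristic polynomial is nonzero and has a real zero; d
  >= 1 gives the latter.\<close>

theorem theorem5p6:
  fixes h :: "real ^ 'n \<Rightarrow> real" and e :: "real ^ 'n" and v :: "nat \<Rightarrow> real ^ 'n"
    and d r m :: nat and \<epsilon> :: real
  assumes "hyperbolic d h e" and "d \<ge> 1"
    and "r \<ge> 1" and "m \<ge> 1" and "\<epsilon> > 0"
    and "\<And>j. j \<in> {1..m} \<Longrightarrow> v j \<in> hyperbolicity_cone h e"
    and "\<And>j. j \<in> {1..m} \<Longrightarrow> hyp_rank h e (v j) \<le> r"
    and "e = (\<Sum>j=1..m. v j)"
    and "\<And>j. j \<in> {1..m} \<Longrightarrow> hyp_trace h e (v j) \<le> \<epsilon>"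
  shows "lambda_max h e (map v [1..<Suc m]) \<le> delta_bound \<epsilon> m r"
proof -
  have hom: "homogeneous_polynomial d h" and he: "h e \<noteq> 0" using assms(1) by (auto simp: hyperbolic_def)
  define E where "E j = hyp_eigenvalues h e (v j)" for j
  have sizeE: "size (E j) = d" for j unfolding E_def by (rule hyperbolic_factor(1)[OF assms(1)])
  have hE: "h (t *\<^sub>R e + s *\<^sub>R v j) = h e * (\<Prod>l\<in>#E j. t + s * l)" for t s j
    unfolding E_def by (rule hyperbolic_factor_plus[OF assms(1)])
  have Epos: "l \<ge> 0" if "j \<in> {1..m}" "l \<in># E j" for j l
  proof -
    have "Min (set_mset (E j)) \<ge> 0" using assms(6)[OF that(1)] by (simp add: hyperbolicity_cone_def E_def)
    also have "Min (set_mset (E j)) \<le> l" using that by simp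
    finally show ?thesis .
  qed
  obtain P where P: "polyfun P" "homog d P" "\<And>z z'. \<forall>j\<in>{1..m}. z j = z' j \<Longrightarrow> P z = P z'"
    "\<And>x. P (cx x) = of_real (h (\<Sum>j=1..m. x j *\<^sub>R v j))"
    using complexify[OF hom, of m v] by blast
  define A where "A x = (\<Sum>j=1..m. x j *\<^sub>R v j)" for x
  define u where "u i = (if i \<in> {1..m} then 1 else 0 :: real)" for i
  have PA: "P (cx x) = of_real (h (A x))" for x by (simp add: P(4) A_def)
  have A_add: "A (\<lambda>i. x i + y i) = A x + A y" for x y
    by (simp add: A_def scaleR_left_distrib sum.distrib)
  have A_u: "A (\<lambda>i. t * u i) = t *\<^sub>R e" for t
    unfolding A_def u_def assms(8) scaleR_sum_right by (intro sum.cong) auto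
  have A_axis: "A (\<lambda>i. if i = j then a else 0) = a *\<^sub>R v j" if "j \<in> {1..m}" for j a
  proof -
    have "A (\<lambda>i. if i = j then a else 0) = (\<Sum>i=1..m. if i = j then a *\<^sub>R v i else 0)"
      unfolding A_def by (intro sum.cong) auto
    then show ?thesis using that by simp
  qed
  have A_upd: "A (x(j := x j + s)) = A x + s *\<^sub>R v j" if "j \<in> {1..m}" for x j s
  proof -
    have "x(j := x j + s) = (\<lambda>i. x i + (if i = j then s else 0))" by auto
    then show ?thesis using that by (simp only: A_add A_axis)
  qed
  have A_const: "A x = t *\<^sub>R e" if "\<forall>l\<in>{1..m}. x l = t" for x t
    using that A_u[of t] by (simp add: A_def u_def)

  \<comment> \<open>Stability of the pulled-back polynomial\<close>
  have "stable {1..m} P"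
  proof (rule stable_of_cone[OF P(1,2) assms(4)])
    fix j a t assume "j \<in> {1..m}" "(a::real) \<ge> 0" "(t::real) > 0"
    have "P (cx (\<lambda>i. (if i = j then a else 0) + t * u i)) = of_real (h (t *\<^sub>R e + a *\<^sub>R v j))"
      using \<open>j \<in> {1..m}\<close> by (simp only: PA A_add A_axis A_u add.commute)
    also have "\<dots> \<noteq> 0"
      using he Epos[OF \<open>j \<in> {1..m}\<close>] \<open>a \<ge> 0\<close> \<open>t > 0\<close>
      by (fastforce simp: hE prod_mset_zero_iff add_pos_nonneg dest: mult_nonneg_nonneg)
    finally show "P (\<lambda>i. of_real ((if i = j then a else 0) + t * (if i \<in> {1..m} then 1 else 0))) \<noteq> 0"
      unfolding cx_def[abs_def] u_def .
  next
    fix x and z :: complex assume z: "Im z > 0"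
    \<comment> \<open>P at x + z u is h(z e + A x), the characteristic polynomial of -A x evaluated
      at z, so its zeros are real.\<close>
    define p where "p = hyp_char_poly h e (- A x)"
    obtain q where q: "\<And>s. P (\<lambda>i. cx x i + s * of_real (u i)) = poly q s"
      using polyfun_line[OF P(1)] by metis
    have "q = map_poly of_real p"
    proof (rule poly_eq_on_reals)
      fix t :: real
      have "poly q (of_real t) = P (cx (\<lambda>i. x i + t * u i))"
        by (simp add: cx_def[abs_def] flip: q)
      also have "\<dots> = of_real (h (t *\<^sub>R e - (- A x)))" by (simp add: PA A_add A_u add.commute)
      also have "\<dots> = of_real (poly p t)" by (simp only: p_def poly_hyp_char_poly[OF hom])
      finally show "poly q (of_real t) = poly (map_poly of_real p) (of_real t)"
        by (simp add: poly_map_of_real)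
    qed
    moreover have "z \<notin> \<real>" using z by (auto elim: Reals_cases)
    ultimately have "poly q z \<noteq> 0" using assms(1) by (auto simp: hyperbolic_def p_def)
    then show "P (\<lambda>i. of_real (x i) + z * of_real (if i \<in> {1..m} then 1 else 0)) \<noteq> 0"
      unfolding q[symmetric] cx_def u_def .
  qed
  then have stable_form: "stable_form m d P" using P by (simp add: stable_form_def)
  have above_roots: "above_roots m P x" if x: "\<forall>i\<in>{1..m}. x i > 0" for x
    unfolding above_roots_def
  proof (intro allI impI)
    fix y :: "nat \<Rightarrow> real" assume y: "\<forall>j\<in>{1..m}. y j \<ge> 0"
    \<comment> \<open>Stability excludes zeros at \<i> times a positive vector, and homogeneity
      removes \<i>. Coordinates beyond \<open>m\<close> are set to 0 to meet the definition of
      \<open>stable\<close>; \<open>P\<close> does not see them.\<close>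
    define w where "w i = (if i \<in> {1..m} then x i + y i else 0)" for i
    have "P (\<lambda>i. \<i> * cx w i) \<noteq> 0"
      using x y by (intro stable_formD(3)[OF stable_form, unfolded stable_def, rule_format])
        (auto simp: cx_def w_def add_pos_nonneg)
    then have "P (cx w) \<noteq> 0" using homog_eq_0_iff[OF P(2), of \<i>] by simp
    moreover have "P (cx w) = P (cx (\<lambda>i. x i + y i))" by (rule P(3)) (auto simp: cx_def w_def)
    ultimately show "P (cx (\<lambda>i. x i + y i)) \<noteq> 0" by simp
  qed
  \<comment> \<open>On the pencil t e + s v_i the logarithmic derivative at s = 0 is the sum of l /
    t over the eigenvalues l, that is, the trace divided by t.\<close>
  have PhiP: "Phi i P x \<le> \<epsilon> / t" if i: "i \<in> {1..m}" and x: "\<forall>l\<in>{1..m}. x l = t" and t: "t > 0" for i x t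
  proof -
    obtain p where p: "\<And>s. P ((cx x)(i := cx x i + s)) = poly p s" using polyfun_axis[OF P(1)] by blast
    have "p = smult (of_real (h e)) (\<Prod>l\<in>#E i. [:of_real t, of_real l:])"
    proof (rule poly_eq_on_reals)
      fix s :: real
      have "poly p (of_real s) = P (cx (x(i := x i + s)))"
        by (simp add: cx_upd cx_def[of x i] flip: p)
      also have "\<dots> = of_real (h (t *\<^sub>R e + s *\<^sub>R v i))" by (simp only: PA A_upd[OF i] A_const[OF x])
      also have "\<dots> = of_real (h e) * of_real (\<Prod>l\<in>#E i. t + s * l)" by (simp add: hE)
      finally show "poly p (of_real s) = poly (smult (of_real (h e)) (\<Prod>l\<in>#E i. [:of_real t, of_real l:])) (of_real s)"
        by (simp add: poly_prod_pencil prod_mset_of_real flip: of_real_mult of_real_add)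
    qed
    then have "poly (pderiv p) 0 = of_real (h e) * of_real (t ^ d * (\<Sum>\<^sub># (E i) / t))"
      "poly p 0 = of_real (h e) * of_real (t ^ d)"
      using pderiv_prod_pencil[OF t, of "E i"] sizeE[of i]
      by (simp_all add: pderiv_smult poly_prod_pencil prod_mset_constant mult.commute)
    then have "pd i P (cx x) / P (cx x) = of_real (\<Sum>\<^sub># (E i) / t)"
      using polyfun_line_pd[OF P(1) p, of 0] p[of 0] he t by simp
    then have "Phi i P x = \<Sum>\<^sub># (E i) / t" by (simp add: Phi_def)
    also have "\<dots> \<le> \<epsilon> / t" using assms(9)[OF i] t by (intro divide_right_mono) (auto simp: hyp_trace_def E_def)
    finally show ?thesis .
  qed
  \<comment> \<open>The rank controls the degree only on the pencils C e + s v_j. Raising all other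
    coordinates (and the base value of the j-th) to their maximum C increases |P|, so the growth in
    s at a general x is at most that of the pencil.\<close>
  have deg: "deg_le m r j P" if j: "j \<in> {1..m}" for j
  proof (rule deg_leI[OF P(1)])
    fix x :: "nat \<Rightarrow> real" assume x: "\<forall>i\<in>{1..m}. x i > 0"
    obtain p where p: "\<And>s. P ((cx x)(j := cx x j + s)) = poly p s" using polyfun_axis[OF P(1)] by blast
    define C where "C = Max (x ` {1..m})"
    have C: "x i \<le> C" if "i \<in> {1..m}" for i using that by (simp add: C_def)
    define q where "q = smult (h e) (\<Prod>l\<in>#E j. [:C, l:])"
    have "norm (poly p (of_real s)) \<le> \<bar>poly q s\<bar>" if s: "s \<ge> 0" for s
    proof -
      define xs where "xs = x(j := x j + s)"
      define y where "y i = (if i \<in> {1..m} then C - x i else 0)" for i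
      have "poly p (of_real s) = P (cx xs)"
        by (simp add: xs_def cx_upd cx_def[of x j] flip: p)
      also have "norm (P (cx xs)) \<le> norm (P (cx (\<lambda>i. xs i + y i)))"
      proof (rule norm_mono[OF stable_form])
        show "above_roots m P xs" using x s by (intro above_roots) (auto simp: xs_def add_pos_nonneg)
      qed (use C in \<open>auto simp: y_def\<close>)
      also have "P (cx (\<lambda>i. xs i + y i)) = of_real (h (A (\<lambda>i. x i + y i) + s *\<^sub>R v j))"
        unfolding PA A_add xs_def A_upd[OF j] by (simp add: algebra_simps)
      also have "A (\<lambda>i. x i + y i) = C *\<^sub>R e" by (rule A_const) (simp add: y_def)
      also have "norm (complex_of_real (h (C *\<^sub>R e + s *\<^sub>R v j))) = \<bar>poly q s\<bar>"
      proof -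
        have "poly (\<Prod>l\<in>#M. [:C, l:]) s = (\<Prod>l\<in>#M. C + s * l)" for M
          by (induction M) (auto simp: distrib_right)
        then show ?thesis by (simp only: hE q_def norm_of_real poly_smult)
      qed
      finally show ?thesis .
    qed
    then have "degree p \<le> degree q" by (rule degree_le_of_growth)
    also have "\<dots> \<le> hyp_rank h e (v j)"
      using degree_prod_pencil[of C "E j"] by (simp add: q_def hyp_rank_def E_def he)
    also have "\<dots> \<le> r" using assms(7)[OF j] .
    finally show "\<exists>p. degree p \<le> r \<and> (\<forall>s. P ((cx x)(j := of_real (x j) + s)) = poly p s)"
      using p by (auto simp: cx_def[of x j])
  qed

  \<comment> \<open>Zeros of the mixed characteristic polynomial\<close>
  define js where "js = [1..<Suc m]"
  define Q where "Q = foldr (diff_op m) js P"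
  have js: "distinct js" "set js = {1..m}" by (auto simp: js_def)
  define pt where "pt \<tau> i = (if i \<in> {1..m} then \<tau> else if i \<in> {m+1..2*m} then 1 else 0 :: real)" for \<tau> i
  define f where "f = mixed_char_poly h e (map v js)"
  have Qf: "Q (cx (pt \<tau>)) = of_real (f \<tau>)" for \<tau>
  proof -
    have "A (pt \<tau>) = \<tau> *\<^sub>R e" by (rule A_const) (simp add: pt_def)
    moreover have "\<forall>j\<in>{1..m}. pt \<tau> (m + j) = 1" by (auto simp: pt_def)
    ultimately show ?thesis
      using foldr_diff_op_mixed[OF P(1,4) homogeneous_polynomial_RP[OF hom], of js] js
      by (simp add: Q_def f_def mixed_char_poly_def A_def)
  qed
  have stableQ: "stable_form m d Q" unfolding Q_def using js by (intro stable_form_foldr stable_form) simp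
  define y where "y i = (if i \<in> {m+1..2*m} then 1 else 0 :: real)" for i
  obtain p where p: "\<And>s. Q (\<lambda>i. cx y i + s * of_real (u i)) = poly p s"
    using polyfun_line[OF stable_formD(1)[OF stableQ]] by metis
  have fp: "of_real (f \<tau>) = poly p (of_real \<tau>)" for \<tau>
  proof -
    have "cx (pt \<tau>) = (\<lambda>i. cx y i + of_real \<tau> * of_real (u i))"
      by (auto simp: cx_def pt_def y_def u_def)
    then show ?thesis by (simp add: p flip: Qf)
  qed
  have upper: "Q (\<lambda>i. of_real (y i) + s * of_real (u i)) \<noteq> 0" if "Im s > 0" for s y
    using that by (intro stable_formD(3)[OF stableQ, unfolded stable_def, rule_format]) (auto simp: u_def)
  have real_root: "z \<in> \<real>" if "poly p z = 0" for z
  proof -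
    have zero: "Q (\<lambda>i. of_real (y i) + z * of_real (u i)) = 0" using that by (simp add: cx_def flip: p)
    then have "\<not> Im z > 0" using upper by blast
    moreover have "\<not> Im z < 0"
    proof
      assume "Im z < 0"
      then have "Q (\<lambda>i. of_real (- y i) + (- z) * of_real (u i)) \<noteq> 0" by (intro upper) simp
      then show False
        using homog_minus[OF stable_formD(2)[OF stableQ], of "\<lambda>i. of_real (y i) + z * of_real (u i)"] zero by simp
    qed
    ultimately show ?thesis by (simp add: complex_is_Real_iff)
  qed
  \<comment> \<open>All zeros are real, so \<open>\<i>\<close> is none; hence \<open>p\<close> is
    not the zero polynomial.\<close>
  have pi: "poly p \<i> \<noteq> 0" using real_root[of \<i>] by (auto simp: complex_is_Real_iff)
  \<comment> \<open>If p were a constant c, homogeneity would give Q(u + s y) = s^d c for s > 0. For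
    s tending to 0 the right side vanishes as d >= 1, while the left side tends to Q with all
    parameters 0, which is P at the all-ones point, that is, h(e).\<close>
  have "degree p \<noteq> 0"
  proof
    assume "degree p = 0"
    then obtain c where c: "p = [:c:]" by (metis degree_eq_zeroE)
    have "Q (\<lambda>i. of_real (u i) + of_real s * of_real (y i)) = of_real s ^ d * c" if "s > 0" for s :: real
    proof -
      have "(\<lambda>i. of_real (u i) + of_real s * of_real (y i)) =
          (\<lambda>i. of_real s * (cx y i + of_real (1 / s) * of_real (u i)))"
        using that by (auto simp: cx_def field_simps)
      then show ?thesis
        using stable_formD(2)[OF stableQ] p[of "of_real (1 / s)"] by (simp add: homog_def c)
    qed
    then have "((\<lambda>s. Q (\<lambda>i. of_real (u i) + of_real s * of_real (y i))) \<longlongrightarrow> of_real 0 ^ d * c) (at_right 0)"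
      by (intro Lim_transform_eventually[OF tendsto_mult[OF tendsto_power[OF tendsto_of_real[OF tendsto_ident_at]] tendsto_const]])
        (auto intro: eventually_mono[OF eventually_at_right_less])
    moreover have "continuous_on UNIV (\<lambda>s. Q (\<lambda>i. of_real (u i) + of_real s * of_real (y i)))"
      by (intro polyfun_continuous[OF stable_formD(1)[OF stableQ]] continuous_intros)
    then have "((\<lambda>s. Q (\<lambda>i. of_real (u i) + of_real s * of_real (y i))) \<longlongrightarrow>
        Q (\<lambda>i. of_real (u i) + of_real 0 * of_real (y i))) (at_right 0)"
      unfolding continuous_on_def by (blast intro: tendsto_mono[OF at_le[OF subset_UNIV]])
    ultimately have "Q (\<lambda>i. of_real (u i) + of_real 0 * of_real (y i)) = of_real 0 ^ d * c"
      using tendsto_unique[OF trivial_limit_at_right_real] by blast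
    then have "Q (cx u) = 0" using assms(2) by (simp add: cx_def[abs_def] power_0_left)
    moreover have "Q (cx u) = P (cx u)"
      unfolding Q_def using js by (intro foldr_diff_op_param_zero) (auto simp: cx_def u_def)
    moreover have "A u = e" using A_u[of 1] by simp
    ultimately show False using he by (simp add: PA)
  qed
  then obtain z where z: "poly p z = 0"
    using fundamental_theorem_of_algebra[of p] constant_degree[of p] by auto
  then have "f (Re z) = 0" using fp[of "Re z"] real_root[OF z] by (simp add: of_real_Re)
  then have nonempty: "{t. f t = 0} \<noteq> {}" by blast
  have "p \<noteq> 0" using pi by auto
  then have "finite {z. poly p z = 0}" by (rule poly_roots_finite)
  then have "finite (complex_of_real -` {z. poly p z = 0})"
    by (rule finite_vimageI) (simp add: inj_of_real)
  moreover have "{t. f t = 0} = complex_of_real -` {z. poly p z = 0}"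
    using fp by (auto simp flip: fp)
  ultimately have fin: "finite {t. f t = 0}" by simp

  \<comment> \<open>The bound for a single pair, and the infimum\<close>
  have bound: "t \<le> (\<epsilon> * \<mu> + (1 - 1 / real m) * \<delta>) / (1 - 1 / real m + \<mu> / real m)"
    if U: "(\<delta>, \<mu>) \<in> U_set r" and t: "f t = 0" for \<delta> \<mu> t
  proof (rule ccontr)
    assume less: "\<not> ?thesis"
    have \<mu>: "\<mu> > 0" using U by (simp add: U_set_def)
    have "(real m * (\<epsilon> * \<mu>) + (real m - 1) * \<delta>) / (real m - 1 + \<mu>) =
        (real m * (\<epsilon> * \<mu> + (1 - 1 / real m) * \<delta>)) / (real m * (1 - 1 / real m + \<mu> / real m))"
      using assms(4) by (intro arg_cong2[of _ _ _ _ "(/)"]) (simp_all add: field_simps)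
    also have "\<dots> = (\<epsilon> * \<mu> + (1 - 1 / real m) * \<delta>) / (1 - 1 / real m + \<mu> / real m)"
      using assms(4) by (intro nonzero_mult_divide_mult_cancel_left) simp
    finally have gt: "t > (real m * (\<epsilon> * \<mu>) + (real m - 1) * \<delta>) / (real m - 1 + \<mu>)" using less by simp
    have "Q (cx (pt t)) \<noteq> 0"
      unfolding Q_def pt_def
    proof (rule mixed_nonzero[OF stable_form U assms(3) _ assms(4) above_roots _ deg js gt])
      show "\<epsilon> * \<mu> > 0" using \<mu> assms(5) by simp
      show "Phi i P x \<le> 1 / \<mu>" if "i \<in> {1..m}" "\<forall>l\<in>{1..m}. x l = \<epsilon> * \<mu>" for i x
        using PhiP[OF that] \<mu> assms(5) by simp
    qed
    then show False using t by (simp add: Qf)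
  qed
  have "lambda_max h e (map v js) = Max {t. f t = 0}" by (simp add: lambda_max_def f_def)
  also have "\<dots> \<le> delta_bound \<epsilon> m r"
    unfolding delta_bound_def
  proof (rule cInf_greatest)
    show "{(\<epsilon> * \<mu> + (1 - 1 / real m) * \<delta>) / (1 - 1 / real m + \<mu> / real m) | \<delta> \<mu>. (\<delta>, \<mu>) \<in> U_set r} \<noteq> {}"
      using U_set_nonempty[OF assms(3)] by blast
    have "f (Max {t. f t = 0}) = 0" using Max_in[OF fin nonempty] by simp
    then show "Max {t. f t = 0} \<le> b" if "b \<in> {(\<epsilon> * \<mu> + (1 - 1 / real m) * \<delta>) / (1 - 1 / real m + \<mu> / real m) | \<delta> \<mu>. (\<delta>, \<mu>) \<in> U_set r}" for b
      using that bound by blast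
  qed
  finally show ?thesis by (simp only: js_def)
qed

end
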